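(* Let $N\ge1$, $\delta=T/N$ and $t_i=i\delta$ for $0\le i\le N$. Given $u_h^0=\varPi_Wu_0\in W_h$ and given $\boldsymbol q_h^0\in\boldsymbol V_h$, $\widehat u_h^0\in M_h$, the fully discrete generalized Crank–Nicolson HDG scheme has a unique solution; that is, there exist unique $(u_h^j,\boldsymbol q_h^j,\widehat u_h^j)\in W_h\times\boldsymbol V_h\times M_h$, $1\le j\le N$, such that for every $1\le j\le N$ $$(\boldsymbol q_h^{j-\frac12},\boldsymbol r)-(u_h^{j-\frac12},\nabla\cdot\boldsymbol r)+\langle\widehat u_h^{j-\frac12},\boldsymbol r\cdot\boldsymbol n\rangle=0\quad\forall\,\boldsymbol r\in\boldsymbol V_h,$$ $$(\mathcal J_\alpha\overline u_h(t_j),w)-(\boldsymbol q_h^{j-\frac12},\nabla w)+\langle\widehat{\boldsymbol q}_h^{\,j-\frac12}\cdot\boldsymbol n,w\rangle=(f^{j-\frac12},w)\quad\forall\,w\in W_h,$$ $$\langle\widehat u_h^j,\mu\rangle_{\partial\Omega}=\langle g,\mu\rangle_{\partial\Omega}\quad\forall\,\mu\in M_h,$$ $$\langle\widehat{\boldsymbol q}_h^{\,j}\cdot\boldsymbol n,\mu_1\rangle-\langle\widehat{\boldsymbol q}_h^{\,j}\cdot\boldsymbol n,\mu_1\rangle_{\partial\Omega}=0\quad\forall\,\mu_1\in M_h,$$ where $\widehat{\boldsymbol q}_h^{\,j}=\boldsymbol q_h^j+\tau(u_h^j-\widehat u_h^j)\boldsymbol n$ on $\partial\mathcal T_h$ (for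 $0\le j\le N$).
   Context: **Data.** $\Omega\subset\mathbb R^d$ ($d=1,2,3$) is a convex polyhedral domain, $T>0$, $0<\alpha<1$, $\omega_\alpha(t)=t^{\alpha-1}/\Gamma(\alpha)$; $f$ on $\Omega\times[0,T]$, $g$ on $\partial\Omega$ and $u_0$ on $\Omega$ are given sufficiently regular functions. **Mesh and spaces.** $\mathcal T_h$ is a conforming triangulation of $\Omega$ into simplexes $K$, $\partial\mathcal T_h$ is the set of all boundaries $\partial K$, $\mathcal E_h$ is the union of the faces $F$ of the simplexes. $\mathcal P_k(D)$ denotes polynomials of total degree at most $k$ on $D$ ($k\ge0$ fixed), and $$W_h=\{w\in L^2(\Omega): w|_K\in\mathcal P_k(K)\ \forall K\},\quad \boldsymbol V_h=\{\boldsymbol v\in[L^2(\Omega)]^d:\boldsymbol v|_K\in[\mathcal P_k(K)]^d\ \forall K\},$$ $$M_h=\{\mu\in L^2(\mathcal E_h):\mu|_F\in\mathcal P_k(F)\ \forall F\}.$$ Here $(v,w)=\sum_K\int_K vw$ (dot product for vectors), $\langle v,w\rangle=\sum_K\int_{\partial K}vw$, $\langle v,w\rangle_{\partial\Omega}=\int_{\partial\Omega}vw$, differential operators on discrete functions are taken elementwise, and $\boldsymbol n$ is the outward unit normal to $\partial K$. The stabilization function $\tau\ge0$ on $\partial\mathcal T_h$ is, for each $K$, constant on each face of $K$. **Discrete-in-time notation.** $f^{j-\frac12}=\frac12(f(t_{j-1})+f(t_j))$, $\boldsymbol q_h^{j-\frac12}=\frac12(\boldsymbol q_h^{j}+\boldsymbol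 q_h^{j-1})$, and $u_h^{j-\frac12}$, $\widehat u_h^{j-\frac12}$, $\widehat{\boldsymbol q}_h^{\,j-\frac12}$ are defined similarly as averages. $\overline u_h(s)=\delta^{-1}(u_h^i-u_h^{i-1})$ for $s\in(t_{i-1},t_i)$, and $$\mathcal J_\alpha\overline u_h(t_j)=\int_{t_{j-1}}^{t_j}\int_0^t\omega_\alpha(t-s)\,\overline u_h(s)\,ds\,dt .$$ **Initial value.** $\varPi_Wu_0\in W_h$ is a fixed projection of the initial datum: with $\boldsymbol q(0)=-\nabla u_0$, $(\boldsymbol\varPi_V\boldsymbol q(0),\varPi_Wu_0)\in\boldsymbol V_h\times W_h$ is determined on each simplex $K$ and each face $F$ of $K$ by $(\boldsymbol\varPi_V\boldsymbol q(0),\boldsymbol v)_K=(\boldsymbol q(0),\boldsymbol v)_K$ for all $\boldsymbol v\in[\mathcal P_{k-1}(K)]^d$, $(\varPi_Wu_0,w)_K=(u_0,w)_K$ for all $w\in\mathcal P_{k-1}(K)$, and $\langle\boldsymbol\varPi_V\boldsymbol q(0)\cdot\boldsymbol n+\tau\varPi_Wu_0,\mu\rangle_F=\langle\boldsymbol q(0)\cdot\boldsymbol n+\tau u_0,\mu\rangle_F$ for all $\mu\in\mathcal P_k(F)$ (uniquely solvable when $\max\tau|_{\partial K}>0$ for each $K$). *)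

theory Defs
  imports "HOL-Analysis.Analysis"
begin

section \<open>Domain and mesh\<close>

definition convex_polyhedral_domain :: "(real^'n) set \<Rightarrow> bool" where
  "convex_polyhedral_domain \<Omega> \<longleftrightarrow>
     open \<Omega> \<and> \<Omega> \<noteq> {} \<and> convex \<Omega> \<and> bounded \<Omega> \<and> polytope (closure \<Omega>)"

text \<open>Cells are closed, full-dimensional simplexes; \<^const>\<open>triangulation\<close> says that the mesh is
  finite and that two cells meet in a common face.\<close>

definition conforming_mesh :: "(real^'n) set \<Rightarrow> (real^'n) set set \<Rightarrow> bool" where
  "conforming_mesh \<Omega> \<T> \<longleftrightarrow>
     triangulation \<T> \<and> (\<forall>K\<in>\<T>. int CARD('n) simplex K) \<and> \<Union>\<T> = closure \<Omega>"

definition mesh_faces :: "(real^'n) set set \<Rightarrow> (real^'n) set set" where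
  "mesh_faces \<T> = {F. \<exists>K\<in>\<T>. F facet_of K}"

definition outward_normal :: "(real^'n) set \<Rightarrow> (real^'n) set \<Rightarrow> real^'n" where
  "outward_normal K F = (THE n. norm n = 1 \<and> (\<forall>x\<in>K. \<forall>y\<in>F. n \<bullet> (x - y) \<le> 0))"

text \<open>Surface measure on a flat \<open>(d-1)\<close>-dimensional face \<open>F\<close>. Writing \<open>\<real>\<^sup>d\<close> as the orthogonal product
  of the hyperplane \<open>affine hull F\<close> and a line, Lebesgue measure is the product of the surface measure
  of the hyperplane and length on the line. Hence the surface measure on \<open>F\<close> is the image, under the
  orthogonal projection onto the hyperplane, of Lebesgue measure on the slab of thickness 1 centred
  at \<open>F\<close>. For \<open>d = 1\<close> this is the unit point mass at the vertex \<open>F\<close>.\<close>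

definition face_measure :: "(real^'n) set \<Rightarrow> (real^'n) measure" where
  "face_measure F =
     (let \<pi> = closest_point (affine hull F)
      in distr (lebesgue_on {z. \<pi> z \<in> F \<and> dist z (\<pi> z) \<le> 1/2}) (restrict_space borel F) \<pi>)"


section \<open>Polynomials and discrete spaces\<close>

definition L2_fun :: "'a measure \<Rightarrow> ('a \<Rightarrow> 'b::euclidean_space) \<Rightarrow> bool" where
  "L2_fun M v \<longleftrightarrow> v \<in> borel_measurable M \<and> integrable M (\<lambda>x. (norm (v x))\<^sup>2)"

text \<open>Polynomials of total degree at most \<open>k\<close>. The degree is an integer so that
  \<open>\<P>\<^bsub>-1\<^esub> = {0}\<close>, which occurs as \<open>\<P>\<^bsub>k-1\<^esub>\<close> for \<open>k = 0\<close>.\<close>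

definition polys :: "int \<Rightarrow> (real^'n \<Rightarrow> real) set" where
  "polys k = {p. \<exists>c :: ('n \<Rightarrow> nat) \<Rightarrow> real.
     p = (\<lambda>x. \<Sum>m | int (sum m UNIV) \<le> k. c m * (\<Prod>i\<in>UNIV. (x $ i) ^ m i))}"

definition vpolys :: "int \<Rightarrow> (real^'n \<Rightarrow> real^'n) set" where
  "vpolys k = {p. \<forall>i. (\<lambda>x. p x $ i) \<in> polys k}"

text \<open>Elements of the discrete spaces are square integrable functions that agree almost everywhere,
  on each cell or face, with a polynomial. They are identified up to almost everywhere equality by
  \<open>cells_eq\<close> and \<open>faces_eq\<close> below. A polynomial of degree at most \<open>k\<close> on a face is the restriction
  of one on the whole space.\<close>

definition W_space :: "(real^'n) set \<Rightarrow> (real^'n) set set \<Rightarrow> nat \<Rightarrow> (real^'n \<Rightarrow> real) set" where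
  "W_space \<Omega> \<T> k = {w. L2_fun (lebesgue_on \<Omega>) w \<and>
     (\<forall>K\<in>\<T>. \<exists>p\<in>polys (int k). AE x in lebesgue_on K. w x = p x)}"

definition V_space :: "(real^'n) set \<Rightarrow> (real^'n) set set \<Rightarrow> nat \<Rightarrow> (real^'n \<Rightarrow> real^'n) set" where
  "V_space \<Omega> \<T> k = {v. L2_fun (lebesgue_on \<Omega>) v \<and>
     (\<forall>K\<in>\<T>. \<exists>p\<in>vpolys (int k). AE x in lebesgue_on K. v x = p x)}"

definition M_space :: "(real^'n) set set \<Rightarrow> nat \<Rightarrow> (real^'n \<Rightarrow> real) set" where
  "M_space \<T> k = {\<mu>. \<forall>F\<in>mesh_faces \<T>. L2_fun (face_measure F) \<mu> \<and>
     (\<exists>p\<in>polys (int k). AE x in face_measure F. \<mu> x = p x)}"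

definition cells_eq :: "(real^'n) set \<Rightarrow> (real^'n \<Rightarrow> 'b) \<Rightarrow> (real^'n \<Rightarrow> 'b) \<Rightarrow> bool" where
  "cells_eq \<Omega> v w \<longleftrightarrow> (AE x in lebesgue_on \<Omega>. v x = w x)"

definition faces_eq :: "(real^'n) set set \<Rightarrow> (real^'n \<Rightarrow> real) \<Rightarrow> (real^'n \<Rightarrow> real) \<Rightarrow> bool" where
  "faces_eq \<T> \<mu> \<nu> \<longleftrightarrow> (\<forall>F\<in>mesh_faces \<T>. AE x in face_measure F. \<mu> x = \<nu> x)"

text \<open>The polynomial that represents \<open>w|\<^sub>K\<close>. Traces on \<open>\<partial>K\<close> and elementwise derivatives of discrete
  functions are those of this polynomial.\<close>

definition piece :: "nat \<Rightarrow> (real^'n) set \<Rightarrow> (real^'n \<Rightarrow> real) \<Rightarrow> real^'n \<Rightarrow> real" where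
  "piece k K w = (THE p. p \<in> polys (int k) \<and> (AE x in lebesgue_on K. w x = p x))"

definition vpiece :: "nat \<Rightarrow> (real^'n) set \<Rightarrow> (real^'n \<Rightarrow> real^'n) \<Rightarrow> real^'n \<Rightarrow> real^'n" where
  "vpiece k K v = (THE p. p \<in> vpolys (int k) \<and> (AE x in lebesgue_on K. v x = p x))"

definition grad :: "(real^'n \<Rightarrow> real) \<Rightarrow> real^'n \<Rightarrow> real^'n" where
  "grad p x = (\<chi> i. frechet_derivative p (at x) (axis i 1))"

definition divg :: "(real^'n \<Rightarrow> real^'n) \<Rightarrow> real^'n \<Rightarrow> real" where
  "divg p x = (\<Sum>i\<in>UNIV. frechet_derivative p (at x) (axis i 1) $ i)"


section \<open>Integrals over the mesh\<close>

text \<open>The integrands may depend on the cell, and on the face, since traces are double valued.\<close>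

definition cells_int ::
  "(real^'n) set set \<Rightarrow> ((real^'n) set \<Rightarrow> real^'n \<Rightarrow> real) \<Rightarrow> real" where
  "cells_int \<T> \<phi> = (\<Sum>K\<in>\<T>. \<integral>x. \<phi> K x \<partial>lebesgue_on K)"

definition skeleton_int ::
  "(real^'n) set set \<Rightarrow> ((real^'n) set \<Rightarrow> (real^'n) set \<Rightarrow> real^'n \<Rightarrow> real) \<Rightarrow> real" where
  "skeleton_int \<T> \<phi> = (\<Sum>K\<in>\<T>. \<Sum>F | F facet_of K. \<integral>x. \<phi> K F x \<partial>face_measure F)"

text \<open>The faces contained in \<open>\<partial>\<Omega>\<close> tile \<open>\<partial>\<Omega>\<close>, and each belongs to exactly one cell.\<close>

definition boundary_int ::
  "(real^'n) set \<Rightarrow> (real^'n) set set \<Rightarrow> ((real^'n) set \<Rightarrow> (real^'n) set \<Rightarrow> real^'n \<Rightarrow> real) \<Rightarrow> real"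
  where
  "boundary_int \<Omega> \<T> \<phi> =
     (\<Sum>K\<in>\<T>. \<Sum>F | F facet_of K \<and> F \<subseteq> frontier \<Omega>. \<integral>x. \<phi> K F x \<partial>face_measure F)"


section \<open>Projection of the initial datum\<close>

text \<open>The stabilization is constant on each face of each cell and may be double valued:
  \<open>\<tau> K F\<close> is its value on the face \<open>F\<close> of \<open>K\<close>.\<close>

definition hdg_projection ::
  "(real^'n) set \<Rightarrow> (real^'n) set set \<Rightarrow> nat \<Rightarrow> ((real^'n) set \<Rightarrow> (real^'n) set \<Rightarrow> real) \<Rightarrow>
   (real^'n \<Rightarrow> real^'n) \<Rightarrow> (real^'n \<Rightarrow> real) \<Rightarrow> (real^'n \<Rightarrow> real^'n) \<Rightarrow> (real^'n \<Rightarrow> real) \<Rightarrow> bool" where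
  "hdg_projection \<Omega> \<T> k \<tau> q0 u0 PV PW \<longleftrightarrow>
     PV \<in> V_space \<Omega> \<T> k \<and> PW \<in> W_space \<Omega> \<T> k \<and>
     (\<forall>K\<in>\<T>.
        (\<forall>v\<in>vpolys (int k - 1).
           (\<integral>x. PV x \<bullet> v x \<partial>lebesgue_on K) = (\<integral>x. q0 x \<bullet> v x \<partial>lebesgue_on K)) \<and>
        (\<forall>w\<in>polys (int k - 1).
           (\<integral>x. PW x * w x \<partial>lebesgue_on K) = (\<integral>x. u0 x * w x \<partial>lebesgue_on K)) \<and>
        (\<forall>F. F facet_of K \<longrightarrow> (\<forall>\<mu>\<in>polys (int k).
           (\<integral>x. (vpiece k K PV x \<bullet> outward_normal K F + \<tau> K F * piece k K PW x) * \<mu> x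
              \<partial>face_measure F) =
           (\<integral>x. (q0 x \<bullet> outward_normal K F + \<tau> K F * u0 x) * \<mu> x \<partial>face_measure F))))"


section \<open>The generalized Crank--Nicolson HDG scheme\<close>

text \<open>\<open>half v j\<close> is the average \<open>v\<^bsup>j-1/2\<^esup>\<close>, used for \<open>j \<ge> 1\<close>.\<close>

definition half :: "(nat \<Rightarrow> 'a \<Rightarrow> 'b::real_vector) \<Rightarrow> nat \<Rightarrow> 'a \<Rightarrow> 'b" where
  "half v j x = (1/2) *\<^sub>R (v j x + v (j - 1) x)"

definition omega :: "real \<Rightarrow> real \<Rightarrow> real" where
  "omega \<alpha> t = t powr (\<alpha> - 1) / Gamma \<alpha>"

text \<open>For \<open>s\<close> in the open interval \<open>(t\<^bsub>i-1\<^esub>, t\<^sub>i)\<close> the index \<open>i\<close> is the ceiling of \<open>s / \<delta>\<close>.\<close>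

definition ubar :: "real \<Rightarrow> (nat \<Rightarrow> 'a \<Rightarrow> real) \<Rightarrow> real \<Rightarrow> 'a \<Rightarrow> real" where
  "ubar \<delta> u s x = (let i = nat \<lceil>s / \<delta>\<rceil> in (u i x - u (i - 1) x) / \<delta>)"

definition J_op :: "real \<Rightarrow> real \<Rightarrow> (nat \<Rightarrow> 'a \<Rightarrow> real) \<Rightarrow> nat \<Rightarrow> 'a \<Rightarrow> real" where
  "J_op \<alpha> \<delta> u j x =
     (\<integral>t. (\<integral>s. omega \<alpha> (t - s) * ubar \<delta> u s x \<partial>lebesgue_on {0..t})
        \<partial>lebesgue_on {real (j - 1) * \<delta>..real j * \<delta>})"

definition flux ::
  "nat \<Rightarrow> ((real^'n) set \<Rightarrow> (real^'n) set \<Rightarrow> real) \<Rightarrow> (nat \<Rightarrow> real^'n \<Rightarrow> real) \<Rightarrow>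
   (nat \<Rightarrow> real^'n \<Rightarrow> real^'n) \<Rightarrow> (nat \<Rightarrow> real^'n \<Rightarrow> real) \<Rightarrow>
   (real^'n) set \<Rightarrow> (real^'n) set \<Rightarrow> nat \<Rightarrow> real^'n \<Rightarrow> real^'n" where
  "flux k \<tau> u q uh K F j x =
     vpiece k K (q j) x + (\<tau> K F * (piece k K (u j) x - uh j x)) *\<^sub>R outward_normal K F"

definition cn_hdg_solution ::
  "(real^'n) set \<Rightarrow> (real^'n) set set \<Rightarrow> nat \<Rightarrow> ((real^'n) set \<Rightarrow> (real^'n) set \<Rightarrow> real) \<Rightarrow>
   real \<Rightarrow> real \<Rightarrow> nat \<Rightarrow> (real^'n \<Rightarrow> real \<Rightarrow> real) \<Rightarrow> (real^'n \<Rightarrow> real) \<Rightarrow>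
   (nat \<Rightarrow> real^'n \<Rightarrow> real) \<Rightarrow> (nat \<Rightarrow> real^'n \<Rightarrow> real^'n) \<Rightarrow> (nat \<Rightarrow> real^'n \<Rightarrow> real) \<Rightarrow> bool" where
  "cn_hdg_solution \<Omega> \<T> k \<tau> \<alpha> \<delta> N f g u q uh \<longleftrightarrow> (\<forall>j\<in>{1..N}.
     u j \<in> W_space \<Omega> \<T> k \<and> q j \<in> V_space \<Omega> \<T> k \<and> uh j \<in> M_space \<T> k \<and>
     (\<forall>r\<in>V_space \<Omega> \<T> k.
        cells_int \<T> (\<lambda>K x. half q j x \<bullet> r x)
        - cells_int \<T> (\<lambda>K x. half u j x * divg (vpiece k K r) x)
        + skeleton_int \<T> (\<lambda>K F x. half uh j x * (vpiece k K r x \<bullet> outward_normal K F)) = 0) \<and>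
     (\<forall>w\<in>W_space \<Omega> \<T> k.
        cells_int \<T> (\<lambda>K x. J_op \<alpha> \<delta> u j x * w x)
        - cells_int \<T> (\<lambda>K x. half q j x \<bullet> grad (piece k K w) x)
        + skeleton_int \<T> (\<lambda>K F x.
            (half (flux k \<tau> u q uh K F) j x \<bullet> outward_normal K F) * piece k K w x)
        = cells_int \<T> (\<lambda>K x. half (\<lambda>i y. f y (real i * \<delta>)) j x * w x)) \<and>
     (\<forall>\<mu>\<in>M_space \<T> k.
        boundary_int \<Omega> \<T> (\<lambda>K F x. uh j x * \<mu> x) = boundary_int \<Omega> \<T> (\<lambda>K F x. g x * \<mu> x)) \<and>
     (\<forall>\<mu>\<in>M_space \<T> k.
        skeleton_int \<T> (\<lambda>K F x. (flux k \<tau> u q uh K F j x \<bullet> outward_normal K F) * \<mu> x)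
        - boundary_int \<Omega> \<T> (\<lambda>K F x. (flux k \<tau> u q uh K F j x \<bullet> outward_normal K F) * \<mu> x) = 0))"

end

theory Submission imports Defs
begin

text \<open>The memory term of step \<open>j\<close> is a linear combination of the increments \<open>u i - u (i - 1)\<close> with
  \<open>i \<le> j\<close>, and the weight of the newest one is positive (\<open>J_op_eq\<close>, \<open>memory_weight_pos\<close>). Hence each
  step is a linear problem for the new values. Its four equations are combined into one, an equation
  \<open>form \<beta> X Y = step_rhs \<dots> Y\<close> for all \<open>Y\<close>, in which \<open>X\<close> and \<open>Y\<close> are families of polynomials, one for
  every cell, every component of the flux in a cell, and every face (\<open>scheme_step_iff\<close>). Unknowns and
  test functions range over the same finite dimensional space, so that uniqueness implies existence
  (\<open>form_solvable\<close>). Both hold up to families that vanish almost everywhere, since different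
  polynomials may coincide on a face; \<open>data_of\<close> and \<open>glue\<close> translate between such families and the
  functions of the discrete spaces.

  For uniqueness let \<open>u\<close>, \<open>q\<close>, \<open>\<mu>\<close> solve the step with zero data. Tested with the solution itself, the
  equation becomes, after integration by parts in every cell, a vanishing sum of the nonnegative terms
  \<open>\<beta> u\<^sup>2 + |q|\<^sup>2 / 2\<close> in the cells and \<open>\<tau> (u - \<mu>)\<^sup>2 / 2\<close> on their facets, where \<open>\<beta>\<close> is the weight of the newest
  increment. Thus \<open>u = 0\<close> and \<open>q = 0\<close> (\<open>form_kernel_cells\<close>). All that is left of the first equation is
  that on the boundary of each cell the trace \<open>\<mu>\<close> is orthogonal to the normal components of all
  polynomial vector fields of degree at most \<open>k\<close>. For \<open>k \<ge> 1\<close> there are enough fields whose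
  normal component is supported by a single facet, and \<open>\<mu> = 0\<close> follows cell by cell (\<open>traces_zero\<close>).
  For \<open>k = 0\<close> the trace is the same constant on all facets of a cell (\<open>constant_traces_equal\<close>), and it
  vanishes because it does so on the boundary of the domain (\<open>form_kernel_constant_faces\<close>).

  The integration by parts rests on the divergence theorem on a simplex (\<open>divergence_simplex\<close>), where
  surface measure is the image of Lebesgue measure on a slab around the face. It is proved for radial
  fields first: the simplex is a cone over each of its facets, and on a cone the formula reduces to the
  fundamental theorem of calculus along the height (\<open>cone_integral\<close>).\<close>

section \<open>Finite linear systems\<close>

lemma underdetermined_system:
  fixes a :: "'i \<Rightarrow> 'j \<Rightarrow> real"
  assumes "finite I" "finite J" "card I < card J"
  shows "\<exists>x. (\<exists>j\<in>J. x j \<noteq> 0) \<and> (\<forall>i\<in>I. (\<Sum>j\<in>J. a i j * x j) = 0)"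
  using assms
proof (induction I arbitrary: J a rule: finite_induct)
  case empty
  then have "J \<noteq> {}" by auto
  then show ?case by (auto intro!: exI[of _ "\<lambda>_. 1"])
next
  case (insert i I)
  show ?case
  proof (cases "\<forall>j\<in>J. a i j = 0")
    case True
    have "card I < card J" using insert by simp
    from insert.IH[OF insert.prems(1) this, of a] obtain x
      where "\<exists>j\<in>J. x j \<noteq> 0" "\<forall>i\<in>I. (\<Sum>j\<in>J. a i j * x j) = 0" by blast
    with True show ?thesis by (auto intro!: exI[of _ x])
  next
    case False
    then obtain p where p: "p \<in> J" "a i p \<noteq> 0" by blast
    have fin: "finite (J - {p})" using insert.prems by simp
    have "card I < card (J - {p})" using insert p by simp
    from insert.IH[OF fin this, of "\<lambda>k j. a k j - a k p * a i j / a i p"] obtain x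
      where nz: "\<exists>j\<in>J - {p}. x j \<noteq> 0"
        and eq: "\<And>k. k \<in> I \<Longrightarrow> (\<Sum>j\<in>J - {p}. (a k j - a k p * a i j / a i p) * x j) = 0" by blast
    define s where "s = - (\<Sum>j\<in>J - {p}. a i j * x j) / a i p"
    define y where "y = x(p := s)"
    have split: "(\<Sum>j\<in>J. a k j * y j) = a k p * s + (\<Sum>j\<in>J - {p}. a k j * x j)" for k
    proof -
      have "(\<Sum>j\<in>J - {p}. a k j * y j) = (\<Sum>j\<in>J - {p}. a k j * x j)"
        by (rule sum.cong) (auto simp: y_def)
      then show ?thesis
        using sum.remove[OF insert.prems(1) p(1), of "\<lambda>j. a k j * y j"] by (simp add: y_def)
    qed
    have "(\<Sum>j\<in>J. a k j * y j) = 0" if "k \<in> insert i I" for k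
    proof (cases "k = i")
      case True
      then show ?thesis using p unfolding split s_def by simp
    next
      case False
      with that have "k \<in> I" by simp
      have "(\<Sum>j\<in>J - {p}. (a k j - a k p * a i j / a i p) * x j)
          = (\<Sum>j\<in>J - {p}. a k j * x j) - (\<Sum>j\<in>J - {p}. (a k p / a i p) * (a i j * x j))"
        by (simp add: algebra_simps sum_subtractf)
      also have "\<dots> = (\<Sum>j\<in>J - {p}. a k j * x j) + a k p * s"
        unfolding s_def sum_distrib_left[symmetric] by simp
      finally show ?thesis using eq[OF \<open>k \<in> I\<close>] unfolding split by simp
    qed
    moreover have "\<exists>j\<in>J. y j \<noteq> 0" using nz by (auto simp: y_def)
    ultimately show ?thesis by blast
  qed
qed

lemma square_system_solvable:
  fixes a :: "'i \<Rightarrow> 'i \<Rightarrow> real"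
  assumes fin: "finite I"
    and inj: "\<And>x. \<forall>i\<in>I. (\<Sum>j\<in>I. a i j * x j) = 0 \<Longrightarrow> \<forall>j\<in>I. x j = 0"
  shows "\<exists>x. \<forall>i\<in>I. (\<Sum>j\<in>I. a i j * x j) = b i"
proof -
  \<comment> \<open>The right-hand side is appended as one more column, indexed by \<open>None\<close>.\<close>
  let ?J = "insert None (Some ` I)"
  let ?a = "\<lambda>i j. case j of None \<Rightarrow> - b i | Some j \<Rightarrow> a i j"
  have "card I < card ?J" using fin by (subst card_insert_disjoint) (auto simp: card_image)
  from underdetermined_system[OF fin _ this, of ?a] fin obtain x
    where nz: "\<exists>j\<in>?J. x j \<noteq> 0" and eq: "\<And>i. i \<in> I \<Longrightarrow> (\<Sum>j\<in>?J. ?a i j * x j) = 0" by auto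
  have eq': "(\<Sum>j\<in>I. a i j * x (Some j)) = b i * x None" if "i \<in> I" for i
    using eq[OF that] fin by (simp add: sum.reindex)
  have "x None \<noteq> 0"
  proof
    assume 0: "x None = 0"
    have "\<forall>j\<in>I. x (Some j) = 0" by (rule inj) (use eq' 0 in auto)
    with nz 0 show False by auto
  qed
  then show ?thesis using eq'
    by (intro exI[of _ "\<lambda>j. x (Some j) / x None"]) (simp add: sum_divide_distrib[symmetric])
qed

definition linear_in :: "'i set \<Rightarrow> (('i \<Rightarrow> real) \<Rightarrow> real) \<Rightarrow> bool" where
  "linear_in I G \<longleftrightarrow> (\<exists>f. \<forall>x. G x = (\<Sum>i\<in>I. x i * f i))"

text \<open>The coefficient vectors in \<open>N\<close> represent the zero function. A largest set \<open>J\<close> of indices that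
  carries no nonzero such vector plays the role of a basis: the equations with index in \<open>J\<close> form a
  regular square system, and the remaining ones follow from them, because every further index is
  dependent on \<open>J\<close> modulo \<open>N\<close>.\<close>

lemma bilinear_equation_solvable:
  fixes B :: "('i \<Rightarrow> real) \<Rightarrow> ('i \<Rightarrow> real) \<Rightarrow> real"
  assumes fin: "finite I"
    and linl: "\<And>y. linear_in I (\<lambda>x. B x y)" and linr: "\<And>x. linear_in I (B x)" and linL: "linear_in I L"
    and ker: "\<And>x. (\<forall>y. B x y = 0) \<Longrightarrow> N x"
    and N: "\<And>x y. N y \<Longrightarrow> B x y = 0" "\<And>y. N y \<Longrightarrow> L y = 0"
  shows "\<exists>x. \<forall>y. B x y = L y"
proof -
  define e :: "'i \<Rightarrow> 'i \<Rightarrow> real" where "e i = (\<lambda>j. if j = i then 1 else 0)" for i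
  have expand: "G x = (\<Sum>i\<in>I. x i * G (e i))" if "linear_in I G" for G x
  proof -
    from that obtain f where f: "\<And>x. G x = (\<Sum>i\<in>I. x i * f i)" unfolding linear_in_def by blast
    have "G (e i) = f i" if "i \<in> I" for i
    proof -
      have "e i j * f j = (if i = j then f j else 0)" for j by (simp add: e_def)
      then show ?thesis using fin that by (simp add: f)
    qed
    then show ?thesis by (simp add: f[of x])
  qed
  define indep where "indep J \<longleftrightarrow> J \<subseteq> I \<and> (\<forall>x. (\<forall>i. i \<notin> J \<longrightarrow> x i = 0) \<and> N x \<longrightarrow> (\<forall>i. x i = 0))" for J
  define Js where "Js = {J. indep J}"
  have "{} \<in> Js" by (auto simp: Js_def indep_def)
  then obtain J where J: "J \<in> Js" and max: "\<And>J'. J' \<in> Js \<Longrightarrow> card J' \<le> card J"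
  proof -
    have "\<forall>J. J \<in> Js \<longrightarrow> card J < Suc (card I)"
      using fin by (auto simp: Js_def indep_def card_mono less_Suc_eq_le)
    from ex_has_greatest_nat[of "\<lambda>J. J \<in> Js", OF \<open>{} \<in> Js\<close> this] show ?thesis using that by blast
  qed
  have JI: "J \<subseteq> I" and ind: "\<And>x. (\<And>i. i \<notin> J \<Longrightarrow> x i = 0) \<Longrightarrow> N x \<Longrightarrow> x i = 0" for i
    using J by (auto simp: Js_def indep_def)
  have finJ: "finite J" using JI fin finite_subset by blast
  have dep: "\<exists>y. y i \<noteq> 0 \<and> (\<forall>k. k \<notin> insert i J \<longrightarrow> y k = 0) \<and> N y" if "i \<in> I" "i \<notin> J" for i
  proof -
    have "\<not> indep (insert i J)"
      using max[of "insert i J"] that finJ by (auto simp: Js_def)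
    then have "\<not> (\<forall>x. (\<forall>k. k \<notin> insert i J \<longrightarrow> x k = 0) \<and> N x \<longrightarrow> (\<forall>k. x k = 0))"
      using that JI by (simp add: indep_def)
    then obtain y k where y: "\<And>k. k \<notin> insert i J \<Longrightarrow> y k = 0" "N y" "y k \<noteq> 0"
      by metis
    have "y i \<noteq> 0"
    proof
      assume "y i = 0"
      then have "\<And>k. k \<notin> J \<Longrightarrow> y k = 0" using y(1) by (metis insertE)
      then have "y k = 0" using y(2) by (rule ind)
      with y show False by simp
    qed
    then show ?thesis using y(1,2) by (intro exI[of _ y] conjI allI impI)
  qed
  \<comment> \<open>An equation \<open>G = 0\<close> that is compatible with \<open>N\<close> needs to be tested on \<open>J\<close> only.\<close>
  have extend: "G y = 0" if G: "linear_in I G" "\<And>y. N y \<Longrightarrow> G y = 0" "\<And>i. i \<in> J \<Longrightarrow> G (e i) = 0" for G y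
  proof -
    have "G (e i) = 0" if "i \<in> I" for i
    proof (cases "i \<in> J")
      case False
      from dep[OF that False] obtain z
        where z: "z i \<noteq> 0" "\<And>k. k \<notin> insert i J \<Longrightarrow> z k = 0" "N z" by metis
      have "0 = G z" using G(2)[OF z(3)] by simp
      also have "\<dots> = (\<Sum>k\<in>I. z k * G (e k))" by (rule expand[OF G(1)])
      also have "\<dots> = (\<Sum>k\<in>{i}. z k * G (e k))"
        by (rule sum.mono_neutral_right) (use fin that z(2) G(3) in auto)
      finally show ?thesis using z by simp
    qed (use G in simp)
    then show ?thesis unfolding expand[OF G(1), of y] by simp
  qed
  have diff: "linear_in I (\<lambda>y. B x y - L y)" for x
  proof -
    obtain f g where "\<And>y. B x y = (\<Sum>i\<in>I. y i * f i)" "\<And>y. L y = (\<Sum>i\<in>I. y i * g i)"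
      using linr[of x] linL unfolding linear_in_def by blast
    then show ?thesis unfolding linear_in_def
      by (intro exI[of _ "\<lambda>i. f i - g i"]) (simp add: sum_subtractf right_diff_distrib)
  qed
  have restr: "B (\<lambda>i. if i \<in> J then x i else 0) y = (\<Sum>j\<in>J. B (e j) y * x j)" for x y
  proof -
    have "B (\<lambda>i. if i \<in> J then x i else 0) y = (\<Sum>j\<in>I. (if j \<in> J then x j else 0) * B (e j) y)"
      by (rule expand[OF linl])
    also have "\<dots> = (\<Sum>j\<in>J. (if j \<in> J then x j else 0) * B (e j) y)"
      by (rule sum.mono_neutral_right) (use fin JI in auto)
    also have "\<dots> = (\<Sum>j\<in>J. B (e j) y * x j)" by (rule sum.cong) auto
    finally show ?thesis .
  qed
  have "\<exists>x. \<forall>i\<in>J. (\<Sum>j\<in>J. B (e j) (e i) * x j) = L (e i)"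
  proof (rule square_system_solvable[OF finJ], intro ballI)
    fix x j assume eq: "\<forall>i\<in>J. (\<Sum>j\<in>J. B (e j) (e i) * x j) = 0" and j: "j \<in> J"
    let ?x = "\<lambda>i. if i \<in> J then x i else 0"
    have "B ?x (e i) = 0" if "i \<in> J" for i using eq that by (simp only: restr)
    then have "\<forall>y. B ?x y = 0" using extend[OF linr N(1)] by metis
    then have "N ?x" by (rule ker)
    have "?x j = 0" by (rule ind[OF _ \<open>N ?x\<close>]) simp
    then show "x j = 0" using j by simp
  qed
  then obtain x where x: "\<And>i. i \<in> J \<Longrightarrow> (\<Sum>j\<in>J. B (e j) (e i) * x j) = L (e i)" by blast
  let ?x = "\<lambda>i. if i \<in> J then x i else 0"
  have 1: "B ?x z - L z = 0" if "N z" for z using N that by simp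
  have 2: "B ?x (e i) - L (e i) = 0" if "i \<in> J" for i using x[OF that] by (simp only: restr diff_self)
  have "\<forall>y. B ?x y = L y"
  proof
    fix y
    have "B ?x y - L y = 0" using extend[OF diff[of ?x] 1 2] .
    then show "B ?x y = L y" by simp
  qed
  then show ?thesis by (rule exI[of "\<lambda>x. \<forall>y. B x y = L y"])
qed

section \<open>Polynomials\<close>

definition monom_fun :: "('n \<Rightarrow> nat) \<Rightarrow> real^'n \<Rightarrow> real" where
  "monom_fun m x = (\<Prod>i\<in>UNIV. (x $ i) ^ m i)"

definition exponents :: "int \<Rightarrow> ('n::finite \<Rightarrow> nat) set" where
  "exponents k = {m. int (sum m UNIV) \<le> k}"

lemma finite_exponents: "finite (exponents k :: ('n::finite \<Rightarrow> nat) set)"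
proof (rule finite_subset)
  show "exponents k \<subseteq> (UNIV :: 'n set) \<rightarrow>\<^sub>E {..nat k}"
  proof
    fix m :: "'n \<Rightarrow> nat" assume "m \<in> exponents k"
    moreover have "m i \<le> sum m UNIV" for i by (rule member_le_sum) auto
    ultimately show "m \<in> UNIV \<rightarrow>\<^sub>E {..nat k}"
      by (auto simp: exponents_def PiE_def le_nat_iff simp flip: of_nat_sum)
        (meson of_nat_mono order_trans)
  qed
qed (rule finite_PiE, auto)

lemma polys_iff: "p \<in> polys k \<longleftrightarrow> (\<exists>c. p = (\<lambda>x. \<Sum>m\<in>exponents k. c m * monom_fun m x))"
  by (simp add: polys_def monom_fun_def exponents_def)

lemma polys_lincomb:
  assumes "p \<in> polys k" "q \<in> polys k"
  shows "(\<lambda>x. c * p x + q x) \<in> polys k"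
proof -
  from assms obtain a b where p: "p = (\<lambda>x. \<Sum>m\<in>exponents k. a m * monom_fun m x)"
    and q: "q = (\<lambda>x. \<Sum>m\<in>exponents k. b m * monom_fun m x)"
    unfolding polys_iff by blast
  show ?thesis unfolding polys_iff p q
    by (intro exI[of _ "\<lambda>m. c * a m + b m"])
      (simp add: sum_distrib_left sum.distrib[symmetric] algebra_simps)
qed

lemma polys_zero: "(\<lambda>x. 0) \<in> polys k"
  unfolding polys_iff by (intro exI[of _ "\<lambda>_. 0"]) simp

lemma polys_add: "p \<in> polys k \<Longrightarrow> q \<in> polys k \<Longrightarrow> (\<lambda>x. p x + q x) \<in> polys k"
  using polys_lincomb[of p k q 1] by simp

lemma polys_cmult: "p \<in> polys k \<Longrightarrow> (\<lambda>x. c * p x) \<in> polys k"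
  using polys_lincomb[OF _ polys_zero, of p k c] by simp

lemma polys_diff: "p \<in> polys k \<Longrightarrow> q \<in> polys k \<Longrightarrow> (\<lambda>x. p x - q x) \<in> polys k"
  using polys_lincomb[of q k p "-1"] by simp

lemma polys_sum:
  assumes "\<And>i. i \<in> I \<Longrightarrow> p i \<in> polys k"
  shows "(\<lambda>x. \<Sum>i\<in>I. p i x) \<in> polys k"
  using assms
  by (induction I rule: infinite_finite_induct) (simp_all add: polys_zero polys_add)

lemma polys_monom:
  assumes "m \<in> exponents k"
  shows "monom_fun m \<in> polys k"
proof -
  have "monom_fun m x = (\<Sum>m'\<in>exponents k. (if m' = m then 1 else 0) * monom_fun m' x)" for x
  proof -
    have "(\<Sum>m'\<in>exponents k. (if m' = m then 1 else 0) * monom_fun m' x)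
        = (\<Sum>m'\<in>exponents k. if m = m' then monom_fun m x else 0)"
      by (rule sum.cong) auto
    also have "\<dots> = monom_fun m x"
      using assms by (subst sum.delta'[OF finite_exponents]) simp
    finally show ?thesis by simp
  qed
  then show ?thesis unfolding polys_iff by (intro exI[of _ "\<lambda>m'. if m' = m then 1 else 0"]) (rule ext)
qed

lemma polys_induct [consumes 1, case_names zero lincomb monom]:
  assumes "p \<in> polys k"
    and zero: "P (\<lambda>x. 0)"
    and lincomb: "\<And>c p q. P p \<Longrightarrow> P q \<Longrightarrow> P (\<lambda>x. c * p x + q x)"
    and monom: "\<And>m. m \<in> exponents k \<Longrightarrow> P (monom_fun m)"
  shows "P p"
proof -
  from assms(1) obtain c where p: "p = (\<lambda>x. \<Sum>m\<in>exponents k. c m * monom_fun m x)"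
    unfolding polys_iff by blast
  have "P (\<lambda>x. \<Sum>m\<in>I. c m * monom_fun m x)" if "finite I" "I \<subseteq> exponents k" for I
    using that by (induction I rule: finite_induct) (simp_all add: zero lincomb monom)
  then show ?thesis unfolding p by (simp add: finite_exponents)
qed

lemma polys_const: "0 \<le> k \<Longrightarrow> (\<lambda>x. c) \<in> polys k"
proof -
  assume "0 \<le> k"
  then have "monom_fun (\<lambda>_. 0) \<in> polys k" by (intro polys_monom) (simp add: exponents_def)
  from polys_cmult[OF this, of c] show ?thesis by (simp add: monom_fun_def)
qed

lemma monom_fun_Suc: "monom_fun (m(i := Suc (m i))) x = x $ i * monom_fun m x"
proof -
  have "monom_fun m' x = (x $ i) ^ m' i * (\<Prod>j\<in>UNIV - {i}. (x $ j) ^ m' j)" for m'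
    unfolding monom_fun_def by (rule prod.remove) auto
  from this[of "m(i := Suc (m i))"] this[of m] show ?thesis by simp
qed

lemma sum_exponents_Suc: "sum (m(i := Suc (m i))) UNIV = Suc (sum m (UNIV :: 'n::finite set))"
proof -
  have "sum m' UNIV = m' i + sum m' (UNIV - {i})" for m' :: "'n \<Rightarrow> nat"
    by (rule sum.remove) auto
  from this[of "m(i := Suc (m i))"] this[of m] show ?thesis by simp
qed

lemma polys_coord_mult:
  assumes "p \<in> polys k"
  shows "(\<lambda>x. x $ i * p x) \<in> polys (k + 1)"
  using assms
proof (induction rule: polys_induct)
  case zero
  show ?case by (simp add: polys_zero)
next
  case (lincomb c p q)
  from polys_lincomb[OF lincomb, of c] show ?case by (simp add: algebra_simps)
next
  case (monom m)
  have "monom_fun (m(i := Suc (m i))) \<in> polys (k + 1)"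
    using monom by (intro polys_monom) (simp only: exponents_def mem_Collect_eq sum_exponents_Suc of_nat_Suc)
  moreover have "monom_fun (m(i := Suc (m i))) = (\<lambda>x. x $ i * monom_fun m x)"
    by (rule ext) (rule monom_fun_Suc)
  ultimately show ?case by simp
qed

lemma polys_mono:
  assumes "p \<in> polys k" "k \<le> l"
  shows "p \<in> polys l"
  using assms(1)
proof (induction rule: polys_induct)
  case (monom m)
  then show ?case using assms(2) by (intro polys_monom) (simp add: exponents_def)
qed (simp_all add: polys_zero polys_lincomb)

lemma polys_affine_mult:
  assumes "p \<in> polys k"
  shows "(\<lambda>x. (a \<bullet> x + b) * p x) \<in> polys (k + 1)"
proof -
  have "(\<lambda>x. (\<Sum>i\<in>UNIV. a $ i * (x $ i * p x)) + b * p x) \<in> polys (k + 1)"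
    using polys_mono[OF assms, of "k + 1"]
    by (intro polys_add polys_sum polys_cmult polys_coord_mult assms) auto
  moreover have "(\<Sum>i\<in>UNIV. a $ i * (x $ i * p x)) + b * p x = (a \<bullet> x + b) * p x" for x
    by (simp add: inner_vec_def sum_distrib_right distrib_right mult.assoc)
  ultimately show ?thesis by simp
qed

text \<open>In every monomial of positive degree one variable is split off. On a face the variables will be
  replaced by combinations of barycentric coordinates.\<close>

lemma polys_split:
  fixes p :: "real^'n \<Rightarrow> real"
  assumes "p \<in> polys (k + 1)" "0 \<le> k"
  shows "\<exists>p0 s. p0 \<in> polys k \<and> (\<forall>i. s i \<in> polys k) \<and> p = (\<lambda>x. p0 x + (\<Sum>i\<in>UNIV. x $ i * s i x))"
  using assms(1)
proof (induction rule: polys_induct)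
  case zero
  show ?case by (intro exI[of _ "\<lambda>_. 0"] exI[of _ "\<lambda>_ _. 0"]) (simp add: polys_zero)
next
  case (lincomb c p q)
  from lincomb(1) obtain p0 s where 1: "p0 \<in> polys k" "\<And>i. s i \<in> polys k"
    "p = (\<lambda>x. p0 x + (\<Sum>i\<in>UNIV. x $ i * s i x))" by blast
  from lincomb(2) obtain q0 t where 2: "q0 \<in> polys k" "\<And>i. t i \<in> polys k"
    "q = (\<lambda>x. q0 x + (\<Sum>i\<in>UNIV. x $ i * t i x))" by blast
  show ?case
    by (intro exI[of _ "\<lambda>x. c * p0 x + q0 x"] exI[of _ "\<lambda>i x. c * s i x + t i x"])
      (auto simp: 1(3) 2(3) distrib_left sum.distrib sum_distrib_left mult.left_commute
        intro!: polys_lincomb 1 2)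
next
  case (monom m)
  show ?case
  proof (cases "m = (\<lambda>_. 0)")
    case True
    then have "monom_fun m \<in> polys k" using assms(2) by (intro polys_monom) (simp add: exponents_def)
    then show ?thesis by (intro exI[of _ "monom_fun m"] exI[of _ "\<lambda>_ _. 0"]) (auto simp: polys_zero)
  next
    case False
    then obtain i where i: "m i \<noteq> 0" by auto
    define m' where "m' = m(i := m i - 1)"
    have m: "m = m'(i := Suc (m' i))" using i by (auto simp: m'_def)
    have "m' \<in> exponents k" using monom unfolding m by (simp only: exponents_def mem_Collect_eq sum_exponents_Suc of_nat_Suc)
    then have s: "monom_fun m' \<in> polys k" by (rule polys_monom)
    define s where "s j = (if j = i then monom_fun m' else (\<lambda>_. 0))" for j
    have "x $ j * s j x = (if i = j then x $ i * monom_fun m' x else 0)" for x j by (simp add: s_def)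
    then have "monom_fun m = (\<lambda>x. 0 + (\<Sum>j\<in>UNIV. x $ j * s j x))"
      by (simp add: fun_eq_iff monom_fun_Suc m del: fun_upd_apply)
    moreover have "\<forall>j. s j \<in> polys k" using s by (simp add: s_def polys_zero)
    ultimately show ?thesis using polys_zero by blast
  qed
qed

lemma polys_real_polynomial: "p \<in> polys k \<Longrightarrow> real_polynomial_function p"
proof (induction rule: polys_induct)
  case (monom m)
  have "real_polynomial_function (\<lambda>x::real^'a. x $ i)" for i
    by (rule real_polynomial_function.intros(1)) (rule bounded_linear_vec_nth)
  then show ?case unfolding monom_fun_def
    by (intro real_polynomial_function_prod real_polynomial_function_power) auto
qed (simp_all add: real_polynomial_function.intros)

lemma real_polynomial_C1:
  assumes "real_polynomial_function (p :: real^'n \<Rightarrow> real)"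
  shows "(p has_derivative frechet_derivative p (at x)) (at x)"
    and "continuous_on UNIV (\<lambda>x. frechet_derivative p (at x) e)"
proof -
  have "\<exists>p'. (\<forall>x. (p has_derivative p' x) (at x)) \<and> (\<forall>e. continuous_on UNIV (\<lambda>x. p' x e))"
    using assms
  proof (induction rule: real_polynomial_function.induct)
    case (linear f)
    then show ?case
      by (intro exI[of _ "\<lambda>_. f"]) (simp add: bounded_linear_imp_has_derivative)
  next
    case (const c)
    show ?case by (intro exI[of _ "\<lambda>_ _. 0"]) simp
  next
    case (add f g)
    then obtain f' g' where *: "\<And>x. (f has_derivative f' x) (at x)" "\<And>x. (g has_derivative g' x) (at x)"
      "\<And>e. continuous_on UNIV (\<lambda>x. f' x e)" "\<And>e. continuous_on UNIV (\<lambda>x. g' x e)" by blast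
    then show ?case
      by (intro exI[of _ "\<lambda>x e. f' x e + g' x e"]) (auto intro!: has_derivative_add continuous_on_add)
  next
    case (mult f g)
    then obtain f' g' where *: "\<And>x. (f has_derivative f' x) (at x)" "\<And>x. (g has_derivative g' x) (at x)"
      "\<And>e. continuous_on UNIV (\<lambda>x. f' x e)" "\<And>e. continuous_on UNIV (\<lambda>x. g' x e)" by blast
    have "continuous_on UNIV f" "continuous_on UNIV g"
      using *(1,2) by (auto intro!: continuous_at_imp_continuous_on has_derivative_continuous)
    with * show ?case
      by (intro exI[of _ "\<lambda>x e. f x * g' x e + f' x e * g x"])
        (auto intro!: has_derivative_mult continuous_on_add continuous_on_mult)
  qed
  then obtain p' where *: "\<And>x. (p has_derivative p' x) (at x)" "\<And>e. continuous_on UNIV (\<lambda>x. p' x e)"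
    by blast
  have "frechet_derivative p (at x) = p' x" for x
    using frechet_derivative_at[OF *(1)] by simp
  with * show "(p has_derivative frechet_derivative p (at x)) (at x)"
    "continuous_on UNIV (\<lambda>x. frechet_derivative p (at x) e)" by simp_all
qed

lemma real_polynomial_continuous:
  "real_polynomial_function (p :: real^'n \<Rightarrow> real) \<Longrightarrow> continuous_on UNIV p"
  by (intro continuous_at_imp_continuous_on ballI has_derivative_continuous[OF real_polynomial_C1(1)])

text \<open>On the line through any point and a point of the open set, the polynomial is a univariate one
  with infinitely many zeros.\<close>

lemma real_polynomial_zero:
  fixes p :: "real^'n \<Rightarrow> real"
  assumes p: "real_polynomial_function p" and S: "open S" "a \<in> S" and 0: "\<And>x. x \<in> S \<Longrightarrow> p x = 0"
  shows "p x = 0"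
proof -
  define l where "l t = a + t *\<^sub>R (x - a)" for t :: real
  have "polynomial_function l"
    unfolding l_def
    by (intro polynomial_function_add polynomial_function_const polynomial_function_bounded_linear
        bounded_linear_scaleR_left)
  then have "real_polynomial_function (p \<circ> l)" using p by (rule real_polynomial_function_compose)
  then obtain c n where cn: "p \<circ> l = (\<lambda>t. \<Sum>i\<le>n. c i * t ^ i)"
    unfolding real_polynomial_function_iff_sum by blast
  have "continuous_on UNIV l" unfolding l_def by (intro continuous_intros)
  then have "open (l -` S)" using S(1) by (simp add: open_vimage)
  moreover have "0 \<in> l -` S" using S(2) by (simp add: l_def)
  ultimately have inf: "infinite (l -` S)" using finite_imp_not_open by blast
  have "\<forall>i\<le>n. c i = 0"
  proof (rule ccontr)
    assume "\<not> (\<forall>i\<le>n. c i = 0)"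
    then have "finite {t. (\<Sum>i\<le>n. c i * t ^ i) = 0}"
      using polyfun_roots_finite[of c _ n] by auto
    moreover have "l -` S \<subseteq> {t. (\<Sum>i\<le>n. c i * t ^ i) = 0}"
      using 0 by (auto simp flip: fun_cong[OF cn])
    ultimately show False using inf finite_subset by blast
  qed
  then have "(p \<circ> l) 1 = 0" unfolding cn by simp
  then show ?thesis by (simp add: l_def)
qed

section \<open>The discrete memory term\<close>

lemma integral_lebesgue_on_borel:
  fixes f :: "'a::euclidean_space \<Rightarrow> real"
  assumes "S \<in> sets borel" "f \<in> borel_measurable borel"
  shows "(\<integral>x. f x \<partial>lebesgue_on S) = (\<integral>x. indicator S x * f x \<partial>lborel)"
proof -
  have "(\<integral>x. f x \<partial>lebesgue_on S) = (\<integral>x. indicator S x * f x \<partial>lebesgue)"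
    using assms by (subst integral_restrict_space) auto
  also have "\<dots> = (\<integral>x. indicator S x * f x \<partial>lborel)"
    using assms by (intro integral_completion) auto
  finally show ?thesis .
qed

lemma integral_pos_on_interval:
  fixes f :: "real \<Rightarrow> real"
  assumes int: "integrable lborel f" and nonneg: "\<And>x. 0 \<le> f x"
    and pos: "\<And>x. a < x \<Longrightarrow> x < b \<Longrightarrow> 0 < f x" and ab: "a < b"
  shows "0 < (\<integral>x. f x \<partial>lborel)"
proof (rule ccontr)
  assume "\<not> ?thesis"
  moreover have "0 \<le> (\<integral>x. f x \<partial>lborel)" using nonneg by simp
  ultimately have "(\<integral>x. f x \<partial>lborel) = 0" by simp
  then have "AE x in lborel. f x = 0"
    using integral_nonneg_eq_0_iff_AE[OF int] nonneg by simp
  then have "AE x in lborel. x \<notin> {a<..<b}"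
    by (rule AE_mp) (use pos in \<open>auto intro!: AE_I2 simp: less_le\<close>)
  then have "{a<..<b} \<in> null_sets lborel"
    by (subst AE_iff_null_sets) auto
  then have "emeasure lborel {a<..<b} = 0" by (rule null_setsD1)
  then show False using ab by simp
qed

text \<open>The piecewise constant slope \<open>ubar\<close> is a combination of indicators of the half-open intervals
  \<open>(t\<^bsub>i-1\<^esub>, t\<^bsub>i\<^esub>]\<close>. The weight of the increment \<open>u i - u (i - 1)\<close> in step \<open>j\<close> is therefore the double integral
  of the kernel restricted to the \<open>i\<close>-th interval, divided by its length.\<close>

definition memory_kernel :: "real \<Rightarrow> real \<Rightarrow> nat \<Rightarrow> real \<Rightarrow> real \<Rightarrow> real" where
  "memory_kernel \<alpha> \<delta> i t s =
     indicator {0..t} s * (omega \<alpha> (t - s) * indicator {real (i - 1) * \<delta><..real i * \<delta>} s)"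

definition memory_weight :: "real \<Rightarrow> real \<Rightarrow> nat \<Rightarrow> nat \<Rightarrow> real" where
  "memory_weight \<alpha> \<delta> j i =
     (\<integral>t. indicator {real (j - 1) * \<delta>..real j * \<delta>} t * (\<integral>s. memory_kernel \<alpha> \<delta> i t s \<partial>lborel) \<partial>lborel) / \<delta>"

context
  fixes \<alpha> \<delta> :: real
  assumes \<alpha>: "0 < \<alpha>" and \<delta>: "0 < \<delta>"
begin

lemma omega_nonneg: "0 \<le> omega \<alpha> t"
  using \<alpha> by (simp add: omega_def Gamma_real_pos less_imp_le)

text \<open>The kernel is singular at \<open>0\<close>, but integrable because of \<open>\<alpha> > 0\<close>; this is the majorant for all
  memory integrals.\<close>

lemma omega_integral:
  "integrable lborel (\<lambda>s. indicator {0..t} s * omega \<alpha> (t - s))"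
  "(\<integral>s. indicator {0..t} s * omega \<alpha> (t - s) \<partial>lborel) \<le> \<bar>t\<bar> powr \<alpha> / \<alpha> / Gamma \<alpha>"
proof -
  let ?g = "\<lambda>r. indicator {0..t} r * omega \<alpha> r"
  have meas: "?g \<in> borel_measurable borel" unfolding omega_def by measurable
  have refl: "?g (t + (-1) * s) = indicator {0..t} s * omega \<alpha> (t - s)" for s
    by (auto simp: indicator_def)
  have "integrable lborel ?g \<and> (\<integral>r. ?g r \<partial>lborel) \<le> \<bar>t\<bar> powr \<alpha> / \<alpha> / Gamma \<alpha>"
  proof (cases "0 \<le> t")
    case True
    have hi: "((\<lambda>r. r powr (\<alpha> - 1)) has_integral (t powr \<alpha> / \<alpha>)) {0..t}"
      using has_integral_powr_from_0[of "\<alpha> - 1" t] \<alpha> True by simp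
    have "((\<lambda>r. if r \<in> {0..t} then r powr (\<alpha> - 1) else 0) has_integral (t powr \<alpha> / \<alpha>)) UNIV"
      using hi by (simp only: has_integral_restrict_UNIV)
    then have hi': "((\<lambda>r. indicator {0..t} r * r powr (\<alpha> - 1)) has_integral (t powr \<alpha> / \<alpha>)) UNIV"
      by (rule has_integral_eq[rotated]) (auto simp: indicator_def)
    have "(\<integral>\<^sup>+r. ennreal (indicator {0..t} r * r powr (\<alpha> - 1)) \<partial>lborel) = ennreal (t powr \<alpha> / \<alpha>)"
      by (rule nn_integral_has_integral_lborel[OF _ _ hi']) auto
    then have "has_bochner_integral lborel (\<lambda>r. indicator {0..t} r * r powr (\<alpha> - 1)) (t powr \<alpha> / \<alpha>)"
      by (intro has_bochner_integral_nn_integral) (use \<alpha> in auto)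
    then have "has_bochner_integral lborel ?g (t powr \<alpha> / \<alpha> / Gamma \<alpha>)"
      unfolding omega_def times_divide_eq_right by (rule has_bochner_integral_divide_zero)
    then show ?thesis using True
      by (simp add: has_bochner_integral_iff)
  next
    case False
    then have "?g = (\<lambda>_. 0)" by (auto simp: indicator_def)
    then show ?thesis using \<alpha> by (simp add: Gamma_real_pos less_imp_le)
  qed
  then show "integrable lborel (\<lambda>s. indicator {0..t} s * omega \<alpha> (t - s))"
    "(\<integral>s. indicator {0..t} s * omega \<alpha> (t - s) \<partial>lborel) \<le> \<bar>t\<bar> powr \<alpha> / \<alpha> / Gamma \<alpha>"
    using lborel_integrable_real_affine[of ?g "-1" t]
      lborel_integral_real_affine[where c = "-1" and f = ?g and t = t]
    unfolding refl by simp_all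
qed

lemma memory_kernel_nonneg: "0 \<le> memory_kernel \<alpha> \<delta> i t s"
  by (simp add: memory_kernel_def omega_nonneg)

lemma memory_kernel_le: "memory_kernel \<alpha> \<delta> i t s \<le> indicator {0..t} s * omega \<alpha> (t - s)"
  using omega_nonneg[of "t - s"] by (auto simp: memory_kernel_def indicator_def)

lemma memory_kernel_measurable:
  "(\<lambda>(t, s). memory_kernel \<alpha> \<delta> i t s) \<in> borel_measurable (borel \<Otimes>\<^sub>M borel)"
proof -
  have "(\<lambda>(t, s). memory_kernel \<alpha> \<delta> i t s) =
    (\<lambda>(t, s). if 0 \<le> s \<and> s \<le> t \<and> real (i - 1) * \<delta> < s \<and> s \<le> real i * \<delta>
      then (t - s) powr (\<alpha> - 1) / Gamma \<alpha> else 0)"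
    by (auto simp: fun_eq_iff memory_kernel_def omega_def indicator_def)
  then show ?thesis by simp
qed

lemma memory_kernel_measurable2 [measurable]: "memory_kernel \<alpha> \<delta> i t \<in> borel_measurable borel"
  unfolding memory_kernel_def omega_def indicator_def by measurable

lemma memory_kernel_integrable: "integrable lborel (memory_kernel \<alpha> \<delta> i t)"
  by (rule Bochner_Integration.integrable_bound[OF omega_integral(1)[of t]])
    (use memory_kernel_nonneg memory_kernel_le omega_nonneg in auto)

lemma memory_integrable:
  "integrable lborel (\<lambda>t. indicator {a..b} t * (\<integral>s. memory_kernel \<alpha> \<delta> i t s \<partial>lborel))"
proof (rule Bochner_Integration.integrable_bound)
  let ?C = "(\<bar>a\<bar> + \<bar>b\<bar>) powr \<alpha> / \<alpha> / Gamma \<alpha>"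
  show "integrable lborel (\<lambda>t. indicator {a..b} t * ?C)" by (intro integrable_mult_left) (auto simp: integrable_indicator_iff emeasure_lborel_Icc_eq)
  show "(\<lambda>t. indicator {a..b} t * (\<integral>s. memory_kernel \<alpha> \<delta> i t s \<partial>lborel)) \<in> borel_measurable lborel"
    using memory_kernel_measurable
    by (intro borel_measurable_times) (auto intro!: lborel.borel_measurable_lebesgue_integral)
  have "(\<integral>s. memory_kernel \<alpha> \<delta> i t s \<partial>lborel) \<le> ?C" if "t \<in> {a..b}" for t
  proof -
    have "(\<integral>s. memory_kernel \<alpha> \<delta> i t s \<partial>lborel) \<le> (\<integral>s. indicator {0..t} s * omega \<alpha> (t - s) \<partial>lborel)"
      by (intro integral_mono memory_kernel_integrable omega_integral memory_kernel_le)
    also have "\<dots> \<le> \<bar>t\<bar> powr \<alpha> / \<alpha> / Gamma \<alpha>" by (rule omega_integral)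
    also have "\<dots> \<le> ?C" using that \<alpha>
      by (intro divide_right_mono powr_mono2) (auto simp: Gamma_real_pos less_imp_le)
    finally show ?thesis .
  qed
  moreover have "0 \<le> (\<integral>s. memory_kernel \<alpha> \<delta> i t s \<partial>lborel)" for t
    by (simp add: memory_kernel_nonneg)
  ultimately show "AE t in lborel. norm (indicator {a..b} t * (\<integral>s. memory_kernel \<alpha> \<delta> i t s \<partial>lborel))
      \<le> norm (indicator {a..b} t * ?C)"
    using Gamma_real_pos[OF \<alpha>] \<alpha> by (auto intro!: AE_I2 simp: indicator_def abs_of_nonneg)
qed

lemma memory_weight_pos:
  assumes "1 \<le> j"
  shows "0 < memory_weight \<alpha> \<delta> j j"
proof -
  have lt: "real (j - 1) * \<delta> < real j * \<delta>" using \<delta> assms by simp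
  have "0 < (\<integral>s. memory_kernel \<alpha> \<delta> j t s \<partial>lborel)" if t: "real (j - 1) * \<delta> < t" "t < real j * \<delta>" for t
  proof (rule integral_pos_on_interval[OF memory_kernel_integrable memory_kernel_nonneg _ t(1)])
    fix s assume s: "real (j - 1) * \<delta> < s" "s < t"
    moreover have "0 \<le> real (j - 1) * \<delta>" using \<delta> by simp
    ultimately have "0 < s" by linarith
    then show "0 < memory_kernel \<alpha> \<delta> j t s"
      using s t \<alpha> by (simp add: memory_kernel_def omega_def Gamma_real_pos)
  qed
  then have "0 < (\<integral>t. indicator {real (j - 1) * \<delta>..real j * \<delta>} t * (\<integral>s. memory_kernel \<alpha> \<delta> j t s \<partial>lborel) \<partial>lborel)"
    by (intro integral_pos_on_interval[OF memory_integrable _ _ lt]) (auto simp: memory_kernel_nonneg)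
  then show ?thesis using \<delta> by (simp add: memory_weight_def)
qed

lemma J_op_eq:
  assumes j: "1 \<le> j"
  shows "J_op \<alpha> \<delta> u j x = (\<Sum>i=1..j. memory_weight \<alpha> \<delta> j i * (u i x - u (i - 1) x))"
proof -
  let ?d = "\<lambda>i. (u i x - u (i - 1) x) / \<delta>"
  have ubar: "ubar \<delta> u s x = (\<Sum>i=1..j. indicator {real (i - 1) * \<delta><..real i * \<delta>} s * ?d i)"
    if s: "0 \<le> s" "s \<le> real j * \<delta>" for s
  proof -
    define k where "k = nat \<lceil>s / \<delta>\<rceil>"
    have k: "s \<in> {real (i - 1) * \<delta><..real i * \<delta>} \<longleftrightarrow> k = i" if "1 \<le> i" for i
    proof -
      have "k = i \<longleftrightarrow> \<lceil>s / \<delta>\<rceil> = int i" using that s \<delta> by (auto simp: k_def)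
      also have "\<dots> \<longleftrightarrow> real i - 1 < s / \<delta> \<and> s / \<delta> \<le> real i" by (simp add: ceiling_eq_iff)
      also have "\<dots> \<longleftrightarrow> s \<in> {real (i - 1) * \<delta><..real i * \<delta>}"
        using that \<delta> by (simp add: field_simps of_nat_diff)
      finally show ?thesis by simp
    qed
    have "s / \<delta> \<le> real j" using s \<delta> by (simp add: field_simps)
    then have kj: "k \<le> j" by (simp add: k_def)
    have "(\<Sum>i=1..j. indicator {real (i - 1) * \<delta><..real i * \<delta>} s * ?d i)
        = (\<Sum>i=1..j. if k = i then ?d i else 0)"
    proof (rule sum.cong[OF refl])
      fix i assume "i \<in> {1..j}"
      then have "1 \<le> i" by simp
      from k[OF this] show "indicator {real (i - 1) * \<delta><..real i * \<delta>} s * ?d i = (if k = i then ?d i else 0)"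
        by (cases "k = i") (simp_all only: indicator_def simp_thms if_True if_False of_bool_eq mult_1 mult_zero_left)
    qed
    also have "\<dots> = ?d k" using kj by (cases k) auto
    finally show ?thesis by (simp add: ubar_def Let_def k_def)
  qed
  have inner: "(\<integral>s. omega \<alpha> (t - s) * ubar \<delta> u s x \<partial>lebesgue_on {0..t})
      = (\<Sum>i=1..j. ?d i * (\<integral>s. memory_kernel \<alpha> \<delta> i t s \<partial>lborel))" if t: "t \<le> real j * \<delta>" for t
  proof -
    have "(\<integral>s. omega \<alpha> (t - s) * ubar \<delta> u s x \<partial>lebesgue_on {0..t})
      = (\<integral>s. omega \<alpha> (t - s) * (\<Sum>i=1..j. indicator {real (i - 1) * \<delta><..real i * \<delta>} s * ?d i) \<partial>lebesgue_on {0..t})"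
      using t by (intro Bochner_Integration.integral_cong) (auto simp: ubar)
    also have "\<dots> = (\<integral>s. indicator {0..t} s * (omega \<alpha> (t - s) *
        (\<Sum>i=1..j. indicator {real (i - 1) * \<delta><..real i * \<delta>} s * ?d i)) \<partial>lborel)"
      unfolding omega_def by (intro integral_lebesgue_on_borel) auto
    also have "\<dots> = (\<integral>s. (\<Sum>i=1..j. ?d i * memory_kernel \<alpha> \<delta> i t s) \<partial>lborel)"
      by (intro Bochner_Integration.integral_cong refl)
        (simp add: memory_kernel_def sum_distrib_left mult_ac)
    also have "\<dots> = (\<Sum>i=1..j. ?d i * (\<integral>s. memory_kernel \<alpha> \<delta> i t s \<partial>lborel))"
      by (simp add: memory_kernel_integrable)
    finally show ?thesis .
  qed
  have meas: "(\<lambda>t. \<integral>s. memory_kernel \<alpha> \<delta> i t s \<partial>lborel) \<in> borel_measurable borel" for i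
    using memory_kernel_measurable by (auto intro!: lborel.borel_measurable_lebesgue_integral)
  let ?I = "{real (j - 1) * \<delta>..real j * \<delta>}"
  have "J_op \<alpha> \<delta> u j x = (\<integral>t. (\<Sum>i=1..j. ?d i * (\<integral>s. memory_kernel \<alpha> \<delta> i t s \<partial>lborel)) \<partial>lebesgue_on ?I)"
    unfolding J_op_def by (intro Bochner_Integration.integral_cong) (auto simp: inner)
  also have "\<dots> = (\<integral>t. indicator ?I t * (\<Sum>i=1..j. ?d i * (\<integral>s. memory_kernel \<alpha> \<delta> i t s \<partial>lborel)) \<partial>lborel)"
    using meas by (intro integral_lebesgue_on_borel) auto
  also have "\<dots> = (\<integral>t. (\<Sum>i=1..j. ?d i * (indicator ?I t * (\<integral>s. memory_kernel \<alpha> \<delta> i t s \<partial>lborel))) \<partial>lborel)"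
    by (simp add: sum_distrib_left mult_ac)
  also have "\<dots> = (\<Sum>i=1..j. ?d i * (\<integral>t. indicator ?I t * (\<integral>s. memory_kernel \<alpha> \<delta> i t s \<partial>lborel) \<partial>lborel))"
    by (simp add: memory_integrable)
  finally show ?thesis by (simp add: memory_weight_def mult_ac)
qed

end

section \<open>Integration over cones\<close>

lemma bounded_support_integrable:
  fixes g :: "'a::euclidean_space \<Rightarrow> real"
  assumes meas: "g \<in> borel_measurable borel" and C: "\<And>x. \<bar>g x\<bar> \<le> C"
    and R: "\<And>x. R < norm x \<Longrightarrow> g x = 0"
  shows "integrable lborel g"
proof (rule Bochner_Integration.integrable_bound)
  show "integrable lborel (\<lambda>x. C * indicator (cball 0 R) x)"
    using emeasure_bounded_finite[OF bounded_cball, of 0 R]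
    by (intro integrable_mult_right integrable_real_indicator) (auto simp: less_top)
  show "AE x in lborel. norm (g x) \<le> norm (C * indicator (cball 0 R) x)"
    using C R by (auto intro!: AE_I2 simp: indicator_def not_le dest: order_trans[OF _ abs_ge_self])
qed (use meas in simp)

lemma lborel_integral_scale:
  fixes f :: "'a::euclidean_space \<Rightarrow> real"
  assumes "s \<noteq> 0" "f \<in> borel_measurable borel"
  shows "(\<integral>x. f x \<partial>lborel) = \<bar>s\<bar> ^ DIM('a) * (\<integral>x. f (t + s *\<^sub>R x) \<partial>lborel)"
proof -
  have "(\<integral>x. f x \<partial>lborel) = (\<integral>x. f x \<partial>density (distr lborel borel (\<lambda>x. t + s *\<^sub>R x)) (\<lambda>_. ennreal (\<bar>s\<bar> ^ DIM('a))))"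
    using lborel_affine[OF assms(1), of t] by simp
  also have "\<dots> = (\<integral>x. \<bar>s\<bar> ^ DIM('a) * f x \<partial>distr lborel borel (\<lambda>x. t + s *\<^sub>R x))"
    using assms by (subst integral_density) auto
  also have "\<dots> = \<bar>s\<bar> ^ DIM('a) * (\<integral>x. f (t + s *\<^sub>R x) \<partial>lborel)"
    using assms by (subst integral_distr) auto
  finally show ?thesis .
qed

context
  fixes n :: "'a::euclidean_space"
  assumes n: "norm n = 1"
begin

abbreviation flat :: "'a \<Rightarrow> 'a" where "flat z \<equiv> z - (n \<bullet> z) *\<^sub>R n"
abbreviation slab :: "real \<Rightarrow> 'a set" where "slab \<rho> \<equiv> {z. \<bar>n \<bullet> z\<bar> \<le> \<rho>}"

lemma nn: "n \<bullet> n = 1" using n by (simp add: dot_square_norm)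

lemma slab_measurable [measurable]: "slab \<rho> \<in> sets borel"
  by measurable

text \<open>Slicing by the hyperplanes orthogonal to \<open>n\<close>, where surface measure on a hyperplane is
  replaced by Lebesgue measure on a slab of thickness 1. Only translation invariance and the
  interchange of integrals are needed: moving each point \<open>z\<close> of the slab along \<open>n\<close> does not change
  the integral over \<open>t\<close>, and afterwards the slab may be moved along \<open>n\<close> by \<open>t\<close>.\<close>

lemma nn_integral_slices:
  assumes [measurable]: "g \<in> borel_measurable borel"
  shows "(\<integral>\<^sup>+x. g x \<partial>lborel) =
    (\<integral>\<^sup>+t. \<integral>\<^sup>+z. indicator (slab (1/2)) z * g (flat z + t *\<^sub>R n) \<partial>lborel \<partial>(lborel :: real measure))"
proof -
  have [measurable]: "indicator (slab (1/2)) \<in> borel_measurable borel" by simp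
  have "(\<integral>\<^sup>+t. \<integral>\<^sup>+z. indicator (slab (1/2)) z * g (flat z + t *\<^sub>R n) \<partial>lborel \<partial>(lborel :: real measure))
    = (\<integral>\<^sup>+z. \<integral>\<^sup>+t. indicator (slab (1/2)) z * g (flat z + t *\<^sub>R n) \<partial>(lborel :: real measure) \<partial>lborel)"
    by (intro lborel_pair.Fubini') measurable
  also have "\<dots> = (\<integral>\<^sup>+z. \<integral>\<^sup>+t. indicator (slab (1/2)) z * g (z + t *\<^sub>R n) \<partial>(lborel :: real measure) \<partial>lborel)"
  proof (rule nn_integral_cong)
    fix z
    have "(\<integral>\<^sup>+t. g (flat z + t *\<^sub>R n) \<partial>lborel) = (\<integral>\<^sup>+t. g (z + t *\<^sub>R n) \<partial>lborel)"
      by (subst nn_integral_real_affine[where c=1 and t="n \<bullet> z"]) (auto simp: algebra_simps)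
    then show "(\<integral>\<^sup>+t. indicator (slab (1/2)) z * g (flat z + t *\<^sub>R n) \<partial>(lborel :: real measure))
      = (\<integral>\<^sup>+t. indicator (slab (1/2)) z * g (z + t *\<^sub>R n) \<partial>lborel)"
      by (simp add: nn_integral_cmult)
  qed
  also have "\<dots> = (\<integral>\<^sup>+t. \<integral>\<^sup>+z. indicator (slab (1/2)) z * g (z + t *\<^sub>R n) \<partial>lborel \<partial>(lborel :: real measure))"
    by (intro lborel_pair.Fubini'[symmetric]) measurable
  also have "\<dots> = (\<integral>\<^sup>+t. \<integral>\<^sup>+z. indicator (slab (1/2)) (z - t *\<^sub>R n) * g z \<partial>lborel \<partial>(lborel :: real measure))"
  proof (rule nn_integral_cong)
    fix t :: real
    have "(\<integral>\<^sup>+z. indicator (slab (1/2)) (z - t *\<^sub>R n) * g z \<partial>lborel)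
      = (\<integral>\<^sup>+z. indicator (slab (1/2)) (z - t *\<^sub>R n) * g z \<partial>distr lborel borel ((+) (t *\<^sub>R n)))"
      by (simp add: lborel_distr_plus)
    also have "\<dots> = (\<integral>\<^sup>+z. indicator (slab (1/2)) z * g (z + t *\<^sub>R n) \<partial>lborel)"
      by (subst nn_integral_distr) (auto simp: add.commute)
    finally show "(\<integral>\<^sup>+z. indicator (slab (1/2)) z * g (z + t *\<^sub>R n) \<partial>lborel)
      = (\<integral>\<^sup>+z. indicator (slab (1/2)) (z - t *\<^sub>R n) * g z \<partial>lborel)" by simp
  qed
  also have "\<dots> = (\<integral>\<^sup>+z. \<integral>\<^sup>+t. indicator (slab (1/2)) (z - t *\<^sub>R n) * g z \<partial>(lborel :: real measure) \<partial>lborel)"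
    by (intro lborel_pair.Fubini') measurable
  also have "\<dots> = (\<integral>\<^sup>+z. g z \<partial>lborel)"
  proof (rule nn_integral_cong)
    fix z
    have "indicator (slab (1/2)) (z - t *\<^sub>R n) = (indicator {n \<bullet> z - 1/2..n \<bullet> z + 1/2} t :: ennreal)" for t
    proof -
      have "n \<bullet> (z - t *\<^sub>R n) = n \<bullet> z - t" by (simp add: inner_diff_right nn)
      then show ?thesis unfolding indicator_def mem_Collect_eq atLeastAtMost_iff by (smt (verit))
    qed
    then show "(\<integral>\<^sup>+t. indicator (slab (1/2)) (z - t *\<^sub>R n) * g z \<partial>(lborel :: real measure)) = g z"
      by (simp add: nn_integral_multc)
  qed
  finally show ?thesis by simp
qed

text \<open>As an identity of measures, the slicing formula carries over to integrands of either sign.\<close>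

lemma lborel_slices:
  "lborel = distr (density (lborel \<Otimes>\<^sub>M lborel) (\<lambda>x :: real \<times> 'a. indicator (slab (1/2)) (snd x))) borel
      (\<lambda>x. flat (snd x) + fst x *\<^sub>R n)" (is "_ = distr ?D borel ?f")
proof (rule measure_eqI)
  fix A assume A: "A \<in> sets (lborel :: 'a measure)"
  have [measurable]: "indicator (slab (1/2)) \<in> borel_measurable borel" by simp
  have "emeasure (lborel :: 'a measure) A = (\<integral>\<^sup>+x. indicator A x \<partial>lborel)" using A by simp
  also have "\<dots> = (\<integral>\<^sup>+t. \<integral>\<^sup>+z. indicator (slab (1/2)) z * indicator A (flat z + t *\<^sub>R n) \<partial>lborel \<partial>(lborel :: real measure))"
    using A by (intro nn_integral_slices) auto
  also have "\<dots> = (\<integral>\<^sup>+x. indicator (slab (1/2)) (snd x) * indicator A (flat (snd x) + fst x *\<^sub>R n) \<partial>(lborel \<Otimes>\<^sub>M lborel))"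
    using A by (subst lborel.nn_integral_fst[symmetric]) auto
  also have "\<dots> = (\<integral>\<^sup>+x. indicator A (?f x) \<partial>?D)"
    using A by (subst nn_integral_density) auto
  also have "\<dots> = (\<integral>\<^sup>+x. indicator A x \<partial>distr ?D borel ?f)"
    using A by (subst nn_integral_distr) auto
  finally show "emeasure lborel A = emeasure (distr ?D borel ?f) A" using A by simp
qed simp

lemma integral_slices:
  fixes g :: "'a \<Rightarrow> real"
  assumes "integrable lborel g"
  shows "(\<integral>x. g x \<partial>lborel) =
    (\<integral>t. \<integral>z. indicator (slab (1/2)) z * g (flat z + t *\<^sub>R n) \<partial>lborel \<partial>(lborel :: real measure))"
proof -
  let ?D = "density (lborel \<Otimes>\<^sub>M lborel) (\<lambda>x :: real \<times> 'a. ennreal (indicator (slab (1/2)) (snd x)))"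
  let ?f = "\<lambda>x. flat (snd x) + fst x *\<^sub>R n"
  have [measurable]: "indicator (slab (1/2)) \<in> borel_measurable borel" by simp
  have [measurable]: "g \<in> borel_measurable borel" using assms by auto
  have eq: "lborel = distr ?D borel ?f" using lborel_slices by (simp add: ennreal_indicator)
  have "integrable (distr ?D borel ?f) g" using assms eq by simp
  then have "integrable ?D (\<lambda>x. g (?f x))" by (subst (asm) integrable_distr_eq) auto
  then have int: "integrable (lborel \<Otimes>\<^sub>M lborel) (\<lambda>x. indicator (slab (1/2)) (snd x) * g (?f x))"
    by (subst (asm) integrable_real_density) auto
  have "(\<integral>x. g x \<partial>lborel) = (\<integral>x. g x \<partial>distr ?D borel ?f)" using eq by simp
  also have "\<dots> = (\<integral>x. g (?f x) \<partial>?D)" by (subst integral_distr) auto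
  also have "\<dots> = (\<integral>x. indicator (slab (1/2)) (snd x) * g (?f x) \<partial>(lborel \<Otimes>\<^sub>M lborel))"
    by (subst integral_real_density) auto
  also have "\<dots> = (\<integral>t. \<integral>z. indicator (slab (1/2)) z * g (flat z + t *\<^sub>R n) \<partial>lborel \<partial>lborel)"
    using lborel_pair.integral_fst'[OF int] by simp
  finally show ?thesis .
qed

lemma flat_flat: "flat (flat z + t *\<^sub>R n) = flat z" "n \<bullet> (flat z + t *\<^sub>R n) = t"
  by (simp_all add: inner_add_right inner_diff_right nn)

lemma norm_le_flat: "norm z \<le> norm (flat z) + \<bar>n \<bullet> z\<bar>"
  using norm_triangle_ineq[of "flat z" "(n \<bullet> z) *\<^sub>R n"] n by simp

text \<open>A slice of a cone at relative height \<open>s\<close>, blown up to the size of the base, turns the slab of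
  thickness \<open>1\<close> into one of thickness \<open>1 / s\<close>.\<close>

lemma slab_thickness:
  fixes f :: "'a \<Rightarrow> real"
  assumes [measurable]: "f \<in> borel_measurable borel" and C: "\<And>x. \<bar>f x\<bar> \<le> C"
    and R: "\<And>x. R < norm x \<Longrightarrow> f x = 0" and \<rho>: "0 \<le> \<rho>"
  shows "(\<integral>z. indicator (slab \<rho>) z * f (flat z) \<partial>lborel)
    = 2 * \<rho> * (\<integral>z. indicator (slab (1/2)) z * f (flat z) \<partial>lborel)"
proof -
  let ?g = "\<lambda>z. indicator (slab \<rho>) z * f (flat z)"
  have [measurable]: "indicator (slab r) \<in> borel_measurable borel" for r :: real by simp
  have "integrable lborel ?g"
  proof (rule bounded_support_integrable)
    show "?g \<in> borel_measurable borel" by measurable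
    show "\<bar>?g x\<bar> \<le> \<bar>C\<bar>" for x using C[of "flat x"] by (auto simp: indicator_def)
    show "?g x = 0" if "R + \<rho> < norm x" for x
      using R[of "flat x"] norm_le_flat[of x] that by (auto simp: indicator_def)
  qed
  then have "(\<integral>z. ?g z \<partial>lborel) =
    (\<integral>t. \<integral>z. indicator (slab (1/2)) z * ?g (flat z + t *\<^sub>R n) \<partial>lborel \<partial>(lborel :: real measure))"
    by (rule integral_slices)
  also have "\<dots> = (\<integral>t. \<integral>z. indicator {-\<rho>..\<rho>} t * (indicator (slab (1/2)) z * f (flat z)) \<partial>lborel \<partial>(lborel :: real measure))"
    unfolding flat_flat by (intro Bochner_Integration.integral_cong refl) (auto simp: indicator_def flat_flat)
  also have "\<dots> = (\<integral>t. indicator {-\<rho>..\<rho>} t * (\<integral>z. indicator (slab (1/2)) z * f (flat z) \<partial>lborel) \<partial>(lborel :: real measure))"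
    by simp
  also have "\<dots> = 2 * \<rho> * (\<integral>z. indicator (slab (1/2)) z * f (flat z) \<partial>lborel)"
    using \<rho> by simp
  finally show ?thesis .
qed

text \<open>The vector field \<open>x \<mapsto> q x *\<^sub>R x\<close> has divergence \<open>d q + \<nabla>q \<bullet> x\<close> and is tangential to the lateral
  facets of the cone \<open>P\<close>, so that only the base contributes. In the slicing, the slice at height
  \<open>t = s h\<close> is a copy of the base scaled by \<open>s\<close>, and \<open>s\<^bsup>d-1\<^esup> (d q (s y) + s \<nabla>q (s y) \<bullet> y)\<close> is the
  derivative of \<open>s\<^sup>d q (s y)\<close>.\<close>

lemma cone_integral:
  fixes q :: "'a \<Rightarrow> real" and q' :: "'a \<Rightarrow> 'a \<Rightarrow> real"
  defines "G \<equiv> \<lambda>y. DIM('a) * q y + q' y y"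
  assumes h: "0 < h" and P: "closed P" and cone: "\<And>s y. 0 < s \<Longrightarrow> s *\<^sub>R y \<in> P \<longleftrightarrow> y \<in> P"
    and pos: "\<And>y. y \<in> P \<Longrightarrow> 0 \<le> n \<bullet> y" and bdd: "bounded (P \<inter> {y. n \<bullet> y \<le> h})"
    and deriv: "\<And>y. (q has_derivative q' y) (at y)" and cont: "continuous_on UNIV (\<lambda>y. q' y y)"
  shows "(\<integral>y. indicator (P \<inter> {y. n \<bullet> y \<le> h}) y * G y \<partial>lborel)
    = h * (\<integral>z. indicator (slab (1/2)) z * (indicator P (flat z + h *\<^sub>R n) * q (flat z + h *\<^sub>R n)) \<partial>lborel)"
proof -
  have contq: "continuous_on UNIV q"
    by (intro continuous_at_imp_continuous_on ballI has_derivative_continuous[OF deriv])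
  have contG: "continuous_on UNIV G" unfolding G_def by (intro continuous_intros contq cont)
  have [measurable]: "q \<in> borel_measurable borel" "G \<in> borel_measurable borel"
    using contq contG by (auto intro: borel_measurable_continuous_onI)
  have [measurable]: "P \<in> sets borel" using P by auto
  have [measurable]: "indicator (slab r) \<in> borel_measurable borel" for r :: real by simp
  let ?K = "P \<inter> {y. n \<bullet> y \<le> h}"
  obtain R where R: "\<And>y. y \<in> ?K \<Longrightarrow> norm y \<le> R" using bdd unfolding bounded_iff by blast
  have "compact (cball (0::'a) R)" by simp
  then have "bounded (G ` cball 0 R)"
    using compact_continuous_image[OF continuous_on_subset[OF contG]] compact_imp_bounded by blast
  then obtain C where C: "\<And>y. norm y \<le> R \<Longrightarrow> \<bar>G y\<bar> \<le> C"
    unfolding bounded_iff by (auto simp: image_iff) force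
  have intK: "integrable lborel (\<lambda>y. indicator ?K y * G y)"
  proof (rule bounded_support_integrable)
    show "\<bar>indicator ?K y * G y\<bar> \<le> \<bar>C\<bar>" for y
      using C[OF R[of y]] by (auto simp: indicator_def)
    show "indicator ?K y * G y = 0" if "R < norm y" for y
      using R[of y] that by (auto simp: indicator_def)
  qed measurable
  define f where "f t z = indicator (slab (1/2)) z * (indicator {0<..h} t * (indicator P (flat z + h *\<^sub>R n)
      * ((t / h) ^ (DIM('a) - 1) * G ((t / h) *\<^sub>R (flat z + h *\<^sub>R n)))))" for t :: real and z
  \<comment> \<open>Points of the base, and of its scaled copies, stay in the ball of radius \<open>R\<close>.\<close>
  have base: "norm (s *\<^sub>R (flat z + h *\<^sub>R n)) \<le> R" if "flat z + h *\<^sub>R n \<in> P" "0 < s" "s \<le> 1" for s z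
  proof (rule R)
    have "n \<bullet> (s *\<^sub>R (flat z + h *\<^sub>R n)) = s * h" unfolding inner_scaleR_right flat_flat ..
    then show "s *\<^sub>R (flat z + h *\<^sub>R n) \<in> ?K" using that h cone by (auto simp: mult_le_cancel_right2)
  qed
  have intf: "integrable (lborel \<Otimes>\<^sub>M lborel) (\<lambda>x. f (fst x) (snd x))"
  proof -
    have "integrable (lborel :: (real \<times> 'a) measure) (\<lambda>x. f (fst x) (snd x))"
    proof (rule bounded_support_integrable)
      have "(\<lambda>x. f (fst x) (snd x)) \<in> borel_measurable (borel \<Otimes>\<^sub>M borel)"
        unfolding f_def by measurable
      then show "(\<lambda>x. f (fst x) (snd x)) \<in> borel_measurable (borel :: (real \<times> 'a) measure)"
        by (simp add: borel_prod)
      show "\<bar>f (fst x) (snd x)\<bar> \<le> \<bar>C\<bar>" for x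
      proof (cases "fst x \<in> {0<..h} \<and> flat (snd x) + h *\<^sub>R n \<in> P")
        case True
        then have s: "0 < fst x / h" "fst x / h \<le> 1" using h by auto
        have "\<bar>(fst x / h) ^ (DIM('a) - 1) * G ((fst x / h) *\<^sub>R (flat (snd x) + h *\<^sub>R n))\<bar> \<le> 1 * C"
          unfolding abs_mult
          by (intro mult_mono C base) (use True s in \<open>auto simp: power_le_one\<close>)
        then show ?thesis using True by (auto simp: f_def indicator_def)
      qed (auto simp: f_def indicator_def)
      show "f (fst x) (snd x) = 0" if "h + (R + h + 1) < norm x" for x
      proof (rule ccontr)
        assume nz: "f (fst x) (snd x) \<noteq> 0"
        then have x: "fst x \<in> {0<..h}" "flat (snd x) + h *\<^sub>R n \<in> P" "snd x \<in> slab (1/2)"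
          by (auto simp: f_def indicator_def split: if_splits)
        have "norm (flat (snd x)) \<le> norm (1 *\<^sub>R (flat (snd x) + h *\<^sub>R n)) + norm (h *\<^sub>R n)"
          using norm_triangle_ineq4[of "flat (snd x) + h *\<^sub>R n" "h *\<^sub>R n"] by simp
        also have "\<dots> \<le> R + h" using base[OF x(2), of 1] h n by simp
        finally have "norm (snd x) \<le> R + h + 1" using norm_le_flat[of "snd x"] x(3) by simp
        moreover have "norm x \<le> norm (fst x) + norm (snd x)"
          using norm_Pair_le[of "fst x" "snd x"] by simp
        ultimately show False using that x(1) by simp
      qed
    qed
    then show ?thesis by (simp add: lborel_prod)
  qed
  have slice: "(\<integral>z. indicator (slab (1/2)) z * (indicator ?K (flat z + t *\<^sub>R n) * G (flat z + t *\<^sub>R n)) \<partial>lborel)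
      = (\<integral>z. f t z \<partial>lborel)" if "t \<noteq> 0" for t
  proof (cases "0 < t \<and> t \<le> h")
    case True
    define s where "s = t / h"
    have s: "0 < s" "s \<le> 1" "t = s * h" using True h by (auto simp: s_def)
    have "(\<integral>z. indicator (slab (1/2)) z * (indicator ?K (flat z + t *\<^sub>R n) * G (flat z + t *\<^sub>R n)) \<partial>lborel)
      = (\<integral>z. indicator (slab (1/2)) z * (indicator P (flat z + t *\<^sub>R n) * G (flat z + t *\<^sub>R n)) \<partial>lborel)"
      using True by (intro Bochner_Integration.integral_cong refl) (auto simp: indicator_def flat_flat)
    also have "\<dots> = s ^ DIM('a) * (\<integral>z. indicator (slab (1/2)) (0 + s *\<^sub>R z) *
        (indicator P (flat (0 + s *\<^sub>R z) + t *\<^sub>R n) * G (flat (0 + s *\<^sub>R z) + t *\<^sub>R n)) \<partial>lborel)"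
      using s by (subst lborel_integral_scale[where s = s and t = 0]) auto
    also have "\<dots> = s ^ DIM('a) * (\<integral>z. indicator (slab (1 / (2 * s))) z *
        (indicator P (flat z + h *\<^sub>R n) * G (s *\<^sub>R (flat z + h *\<^sub>R n))) \<partial>lborel)"
    proof -
      have 1: "flat (0 + s *\<^sub>R z) + t *\<^sub>R n = s *\<^sub>R (flat z + h *\<^sub>R n)" for z
        by (simp add: s(3) algebra_simps)
      have 2: "0 + s *\<^sub>R z \<in> slab (1/2) \<longleftrightarrow> z \<in> slab (1 / (2 * s))" for z
        using s by (simp add: abs_mult field_simps)
      show ?thesis unfolding 1 indicator_def 2 cone[OF s(1)] ..
    qed
    also have "\<dots> = s ^ DIM('a) * (2 * (1 / (2 * s)) * (\<integral>z. indicator (slab (1/2)) z *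
        (indicator P (flat z + h *\<^sub>R n) * G (s *\<^sub>R (flat z + h *\<^sub>R n))) \<partial>lborel))"
    proof -
      let ?E = "\<lambda>y. indicator P (y + h *\<^sub>R n) * G (s *\<^sub>R (y + h *\<^sub>R n)) * indicator (cball 0 (R + h)) y"
      have E: "?E (flat z) = indicator P (flat z + h *\<^sub>R n) * G (s *\<^sub>R (flat z + h *\<^sub>R n))" for z
      proof (cases "flat z + h *\<^sub>R n \<in> P")
        case True
        have "norm (flat z) \<le> norm (1 *\<^sub>R (flat z + h *\<^sub>R n)) + norm (h *\<^sub>R n)"
          using norm_triangle_ineq4[of "flat z + h *\<^sub>R n" "h *\<^sub>R n"] by simp
        also have "\<dots> \<le> R + h" using base[OF True, of 1] h n by simp
        finally show ?thesis by simp
      qed simp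
      have "bounded (G ` cball 0 (R + 2 * h))"
        using compact_continuous_image[OF continuous_on_subset[OF contG]] compact_imp_bounded compact_cball by blast
      then obtain C' where C': "\<And>y. norm y \<le> R + 2 * h \<Longrightarrow> \<bar>G y\<bar> \<le> C'"
        unfolding bounded_iff by (auto simp: image_iff) force
      have E1: "\<bar>?E y\<bar> \<le> \<bar>C'\<bar>" for y
      proof (cases "norm y \<le> R + h")
        case True
        have "norm (s *\<^sub>R (y + h *\<^sub>R n)) = s * norm (y + h *\<^sub>R n)" using s by simp
        also have "\<dots> \<le> 1 * norm (y + h *\<^sub>R n)" using s by (intro mult_right_mono) auto
        also have "\<dots> \<le> R + 2 * h" using norm_triangle_ineq[of y "h *\<^sub>R n"] True h n by simp
        finally show ?thesis using C'[of "s *\<^sub>R (y + h *\<^sub>R n)"] by (auto simp: indicator_def)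
      qed simp
      have E2: "?E y = 0" if "R + h < norm y" for y using that by simp
      have E3: "?E \<in> borel_measurable borel"
      proof -
        have [measurable]: "(indicator (cball 0 (R + h)) :: 'a \<Rightarrow> real) \<in> borel_measurable borel"
          by (intro borel_measurable_indicator) simp
        show ?thesis by measurable
      qed
      have "(\<integral>z. indicator (slab (1 / (2 * s))) z * ?E (flat z) \<partial>lborel)
        = 2 * (1 / (2 * s)) * (\<integral>z. indicator (slab (1/2)) z * ?E (flat z) \<partial>lborel)"
        by (rule slab_thickness[OF E3 E1 E2]) (use s in auto)
      then show ?thesis unfolding E by (rule arg_cong)
    qed
    also have "\<dots> = s ^ (DIM('a) - 1) * (\<integral>z. indicator (slab (1/2)) z *
        (indicator P (flat z + h *\<^sub>R n) * G (s *\<^sub>R (flat z + h *\<^sub>R n))) \<partial>lborel)"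
    proof -
      have "s ^ DIM('a) = s ^ (DIM('a) - 1) * s" by (metis DIM_positive power_minus_mult)
      then have "s ^ DIM('a) * (2 * (1 / (2 * s)) * X) = s ^ (DIM('a) - 1) * X" for X
        using s by (simp only:) simp
      then show ?thesis .
    qed
    also have "\<dots> = (\<integral>z. s ^ (DIM('a) - 1) * (indicator (slab (1/2)) z *
        (indicator P (flat z + h *\<^sub>R n) * G (s *\<^sub>R (flat z + h *\<^sub>R n)))) \<partial>lborel)"
      by simp
    also have "\<dots> = (\<integral>z. f t z \<partial>lborel)"
      using True by (intro Bochner_Integration.integral_cong refl)
        (simp add: f_def s_def indicator_def inner_diff_right nn mult_ac)
    finally show ?thesis .
  next
    case False
    have "indicator ?K (flat z + t *\<^sub>R n) = (0::real)" for z
      using False that pos[of "flat z + t *\<^sub>R n"] by (auto simp: indicator_def flat_flat)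
    moreover have "f t z = 0" for z using False by (auto simp: f_def indicator_def)
    ultimately show ?thesis by simp
  qed
  have ftc: "(\<integral>t. f t z \<partial>lborel) = h * (indicator (slab (1/2)) z * (indicator P (flat z + h *\<^sub>R n) * q (flat z + h *\<^sub>R n)))" for z
  proof -
    let ?y = "flat z + h *\<^sub>R n" and ?d = "DIM('a)"
    let ?p = "\<lambda>t. (t / h) ^ (?d - 1) * G ((t / h) *\<^sub>R ?y)"
    have d: "?d = Suc (?d - 1)" by simp
    have h0: "h \<noteq> 0" using h by simp
    have "((\<lambda>t. h * ((t / h) ^ ?d * q ((t / h) *\<^sub>R ?y))) has_real_derivative ?p t) (at t)" for t
    proof -
      have 1: "((\<lambda>t. q ((t / h) *\<^sub>R ?y)) has_derivative (\<lambda>e. q' ((t / h) *\<^sub>R ?y) ((e / h) *\<^sub>R ?y))) (at t)"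
        by (rule has_derivative_compose[OF _ deriv, where f = "\<lambda>t. (t / h) *\<^sub>R ?y"])
          (use h0 in \<open>auto intro!: derivative_eq_intros\<close>)
      have lin: "linear (q' y)" for y using deriv[of y] by (rule has_derivative_linear)
      have "((\<lambda>t. q ((t / h) *\<^sub>R ?y)) has_real_derivative (q' ((t / h) *\<^sub>R ?y) ?y / h)) (at t)"
        unfolding has_field_derivative_def
        by (rule has_derivative_eq_rhs[OF 1]) (auto simp: fun_eq_iff linear_cmul[OF lin])
      then show ?thesis
        by (auto intro!: derivative_eq_intros simp: G_def linear_cmul[OF lin] h0)
          (use h d in \<open>simp add: field_simps power_eq_if[of _ ?d]\<close>)
    qed
    moreover have "continuous_on UNIV ?p"
      by (intro continuous_intros continuous_on_compose2[OF contG]) (use h in auto)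
    then have "isCont ?p t" for t by (simp add: continuous_on_eq_continuous_at)
    ultimately have "(\<integral>t. ?p t * indicator {0..h} t \<partial>lborel) = h * ((h / h) ^ ?d * q ((h / h) *\<^sub>R ?y)) - h * ((0 / h) ^ ?d * q ((0 / h) *\<^sub>R ?y))"
      using h by (intro integral_FTC_Icc_real) auto
    then have "(\<integral>t. indicator {0..h} t * ?p t \<partial>lborel) = h * q ?y" using h by (simp add: mult.commute)
    moreover have "(\<integral>t. indicator {0<..h} t * ?p t \<partial>lborel) = (\<integral>t. indicator {0..h} t * ?p t \<partial>lborel)"
      using AE_lborel_singleton[of "0::real"]
      by (intro integral_cong_AE) (auto simp: indicator_def)
    moreover have "(\<integral>t. f t z \<partial>lborel) = indicator (slab (1/2)) z * (indicator P ?y * (\<integral>t. indicator {0<..h} t * ?p t \<partial>lborel))"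
      unfolding f_def by (simp add: mult.left_commute[of _ "indicator P ?y"])
    ultimately show ?thesis by simp
  qed
  have "(\<integral>y. indicator ?K y * G y \<partial>lborel) =
    (\<integral>t. \<integral>z. indicator (slab (1/2)) z * (indicator ?K (flat z + t *\<^sub>R n) * G (flat z + t *\<^sub>R n)) \<partial>lborel \<partial>(lborel :: real measure))"
    by (rule integral_slices[OF intK])
  also have "\<dots> = (\<integral>t. \<integral>z. f t z \<partial>lborel \<partial>(lborel :: real measure))"
  proof (rule integral_cong_AE)
    show "AE t in lborel. (\<integral>z. indicator (slab (1/2)) z * (indicator ?K (flat z + t *\<^sub>R n) * G (flat z + t *\<^sub>R n)) \<partial>lborel)
      = (\<integral>z. f t z \<partial>lborel)"
      using AE_lborel_singleton[of "0::real"] by eventually_elim (rule slice)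
    show "(\<lambda>t. \<integral>z. f t z \<partial>lborel) \<in> borel_measurable lborel"
      unfolding f_def by (intro lborel.borel_measurable_lebesgue_integral) measurable
  qed measurable
  also have "\<dots> = (\<integral>z. \<integral>t. f t z \<partial>(lborel :: real measure) \<partial>lborel)"
  proof -
    have "integrable (lborel \<Otimes>\<^sub>M lborel) (\<lambda>(x, y). f x y)" using intf by (simp add: case_prod_unfold)
    from lborel_pair.Fubini_integral[OF this] show ?thesis by simp
  qed
  also have "\<dots> = h * (\<integral>z. indicator (slab (1/2)) z * (indicator P (flat z + h *\<^sub>R n) * q (flat z + h *\<^sub>R n)) \<partial>lborel)"
    unfolding ftc by simp
  finally show ?thesis .
qed

end

section \<open>Barycentric coordinates\<close>

text \<open>The affine function \<open>x \<mapsto> a c \<bullet> x + b c\<close> is the barycentric coordinate of the vertex \<open>c\<close>, so that \<open>a c\<close> is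
  its gradient, an inner normal of the facet opposite to \<open>c\<close>.\<close>

locale simplex_coords =
  fixes K C :: "(real^'n) set" and a :: "real^'n \<Rightarrow> real^'n" and b :: "real^'n \<Rightarrow> real"
  assumes finite_C: "finite C" and indep: "\<not> affine_dependent C" and card_C: "card C = Suc CARD('n)"
    and hull: "K = convex hull C"
    and coord_vertex: "\<And>c c'. c \<in> C \<Longrightarrow> c' \<in> C \<Longrightarrow> a c \<bullet> c' + b c = (if c = c' then 1 else 0)"
    and coord_sum: "\<And>x. (\<Sum>c\<in>C. a c \<bullet> x + b c) = 1"
    and coord_rep: "\<And>x. (\<Sum>c\<in>C. (a c \<bullet> x + b c) *\<^sub>R c) = x"
    and in_simplex: "\<And>x. x \<in> K \<longleftrightarrow> (\<forall>c\<in>C. 0 \<le> a c \<bullet> x + b c)"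
    and facets: "\<And>F. F facet_of K \<longleftrightarrow> (\<exists>c\<in>C. F = {x\<in>K. a c \<bullet> x + b c = 0})"

lemma simplex_coords_exist:
  fixes K :: "(real^'n) set"
  assumes "int CARD('n) simplex K"
  shows "\<exists>C a b. simplex_coords K C a b"
proof -
  from assms obtain C where C: "\<not> affine_dependent C" "card C = Suc CARD('n)" "K = convex hull C"
    unfolding simplex_def by auto
  have fin: "finite C" using C(1) aff_independent_finite by blast
  have "\<exists>a b. \<forall>c'\<in>C. a \<bullet> c' + b = (if c = c' then 1 else 0)" if c: "c \<in> C" for c
  proof -
    have "card (C - {c}) \<noteq> 0" using c C(2) fin by simp
    then have "C - {c} \<noteq> {}" by (metis card.empty)
    then obtain c1 where c1: "c1 \<in> C" "c1 \<noteq> c" by blast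
    have "independent ((\<lambda>x. - c1 + x) ` (C - {c1}))"
      using affine_dependent_iff_dependent2[OF c1(1)] C(1) by simp
    from linear_independent_extend[OF this, of "\<lambda>y. if y = c - c1 then 1 else (0::real)"]
    obtain g where g: "linear g" "\<forall>x\<in>C - {c1}. g (x - c1) = (if x = c then 1 else (0::real))"
      by auto
    have "g 0 = 0" using g(1) by (rule linear_0)
    have "g x = adjoint g 1 \<bullet> x" for x
      using adjoint_works[OF g(1), of x 1] by (simp add: inner_commute)
    then have "adjoint g 1 \<bullet> x + - (adjoint g 1 \<bullet> c1) = g (x - c1)" for x
      by (simp add: inner_diff_right)
    moreover have "g (x - c1) = (if c = x then 1 else 0)" if "x \<in> C" for x
      using g(2) \<open>g 0 = 0\<close> c1 that by (cases "x = c1") auto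
    ultimately show ?thesis by (intro exI[of _ "adjoint g 1"] exI[of _ "- (adjoint g 1 \<bullet> c1)"]) simp
  qed
  then obtain a b where ab: "\<And>c c'. c \<in> C \<Longrightarrow> c' \<in> C \<Longrightarrow> a c \<bullet> c' + b c = (if c = c' then 1 else 0)"
    by metis
  have aff: "affine hull C = UNIV"
    using aff_dim_affine_independent[OF C(1)] C(2) aff_dim_eq_full[of C] by simp
  have coord: "a c \<bullet> x + b c = u c" if "c \<in> C" "sum u C = 1" "(\<Sum>v\<in>C. u v *\<^sub>R v) = x" for u c x
  proof -
    have "a c \<bullet> x + b c = (\<Sum>v\<in>C. u v * (a c \<bullet> v)) + sum u C * b c"
      using that by (simp add: inner_sum_right flip: that(3))
    also have "\<dots> = (\<Sum>v\<in>C. u v * (a c \<bullet> v + b c))"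
      by (simp add: sum_distrib_right sum.distrib distrib_left)
    also have "\<dots> = (\<Sum>v\<in>C. if c = v then u v else 0)"
      by (rule sum.cong) (use ab that(1) in auto)
    finally show ?thesis using fin that(1) by simp
  qed
  have rep: "(\<Sum>c\<in>C. a c \<bullet> x + b c) = 1 \<and> (\<Sum>c\<in>C. (a c \<bullet> x + b c) *\<^sub>R c) = x" for x
  proof -
    have "x \<in> affine hull C" using aff by simp
    then obtain u where u: "sum u C = 1" "(\<Sum>v\<in>C. u v *\<^sub>R v) = x"
      unfolding affine_hull_finite[OF fin] by auto
    have "(\<Sum>c\<in>C. a c \<bullet> x + b c) = sum u C" "(\<Sum>c\<in>C. (a c \<bullet> x + b c) *\<^sub>R c) = (\<Sum>v\<in>C. u v *\<^sub>R v)"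
      using coord[OF _ u] by (auto intro: sum.cong)
    then show ?thesis using u by simp
  qed
  have inK: "x \<in> K \<longleftrightarrow> (\<forall>c\<in>C. 0 \<le> a c \<bullet> x + b c)" for x
  proof
    assume "x \<in> K"
    then obtain u where "\<forall>v\<in>C. 0 \<le> u v" "sum u C = 1" "(\<Sum>v\<in>C. u v *\<^sub>R v) = x"
      unfolding C(3) convex_hull_finite[OF fin] by auto
    then show "\<forall>c\<in>C. 0 \<le> a c \<bullet> x + b c" using coord by simp
  next
    assume "\<forall>c\<in>C. 0 \<le> a c \<bullet> x + b c"
    then show "x \<in> K" unfolding C(3) convex_hull_finite[OF fin]
      using rep[of x] by (intro CollectI exI[of _ "\<lambda>c. a c \<bullet> x + b c"]) simp
  qed
  have face: "convex hull (C - {c}) = {x\<in>K. a c \<bullet> x + b c = 0}" if c: "c \<in> C" for c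
  proof (intro equalityI subsetI)
    fix x assume "x \<in> convex hull (C - {c})"
    then obtain u where u: "\<forall>v\<in>C - {c}. 0 \<le> u v" "sum u (C - {c}) = 1" "(\<Sum>v\<in>C - {c}. u v *\<^sub>R v) = x"
      using fin by (auto simp: convex_hull_finite)
    let ?u = "u(c := 0)"
    have "sum ?u C = sum ?u (C - {c})" "(\<Sum>v\<in>C. ?u v *\<^sub>R v) = (\<Sum>v\<in>C - {c}. ?u v *\<^sub>R v)"
      using sum.remove[OF fin c, of ?u] sum.remove[OF fin c, of "\<lambda>v. ?u v *\<^sub>R v"] by simp_all
    moreover have "sum ?u (C - {c}) = sum u (C - {c})" "(\<Sum>v\<in>C - {c}. ?u v *\<^sub>R v) = (\<Sum>v\<in>C - {c}. u v *\<^sub>R v)"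
      by (auto intro: sum.cong)
    ultimately have *: "a c' \<bullet> x + b c' = ?u c'" if "c' \<in> C" for c'
      using coord[OF that, of ?u x] u by simp
    show "x \<in> {x\<in>K. a c \<bullet> x + b c = 0}" using * c u(1) by (auto simp: inK)
  next
    fix x assume x: "x \<in> {x\<in>K. a c \<bullet> x + b c = 0}"
    then have "(\<Sum>c'\<in>C - {c}. a c' \<bullet> x + b c') = 1" "(\<Sum>c'\<in>C - {c}. (a c' \<bullet> x + b c') *\<^sub>R c') = x"
      using rep[of x] sum.remove[OF fin c, of "\<lambda>c. a c \<bullet> x + b c"]
        sum.remove[OF fin c, of "\<lambda>c. (a c \<bullet> x + b c) *\<^sub>R c"] by simp_all
    then show "x \<in> convex hull (C - {c})"
      using x fin by (auto simp: convex_hull_finite inK intro!: exI[of _ "\<lambda>c. a c \<bullet> x + b c"])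
  qed
  have ne: "convex hull (C - {c}) \<noteq> {}" if "c \<in> C" for c
  proof -
    have "card (C - {c}) \<noteq> 0" using that C(2) fin by simp
    then show ?thesis by (metis card.empty convex_hull_eq_empty)
  qed
  have "F facet_of K \<longleftrightarrow> (\<exists>c\<in>C. F = {x\<in>K. a c \<bullet> x + b c = 0})" for F
    unfolding C(3) facet_of_convex_hull_affine_independent[OF C(1)]
    using ne face by (auto simp: C(3)[symmetric])
  then have "simplex_coords K C a b"
    by unfold_locales (use fin C ab rep inK in auto)
  then show ?thesis by blast
qed

context simplex_coords
begin

definition "face c = {x\<in>K. a c \<bullet> x + b c = 0}"

lemma facet_iff: "F facet_of K \<longleftrightarrow> (\<exists>c\<in>C. F = face c)"
  using facets by (simp add: face_def)

lemma other_vertex: "\<exists>c'\<in>C. c' \<noteq> c"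
proof -
  have "card C - card {c} \<le> card (C - {c})" by (rule diff_card_le_card_Diff) simp
  then have "0 < card (C - {c})" using card_C by (simp add: less_le_trans[OF zero_less_card_finite])
  then have "C - {c} \<noteq> {}" by (metis card.empty less_irrefl)
  then show ?thesis by blast
qed

lemma vertex_in_simplex: "c \<in> C \<Longrightarrow> c \<in> K" by (simp add: in_simplex coord_vertex)

lemma vertex_in_face: "c \<in> C \<Longrightarrow> c' \<in> C \<Longrightarrow> c' \<noteq> c \<Longrightarrow> c' \<in> face c"
  by (simp add: face_def vertex_in_simplex coord_vertex)

lemma compact_K: "compact K" unfolding hull using finite_C by (simp add: finite_imp_compact_convex_hull)
lemma convex_K: "convex K" unfolding hull by simp

lemma compact_face: "compact (face c)"
proof -
  have "face c = K \<inter> {x. a c \<bullet> x = - b c}" by (auto simp: face_def)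
  then show ?thesis using compact_K by (simp add: compact_Int_closed closed_hyperplane)
qed

lemma face_inj: "c \<in> C \<Longrightarrow> c' \<in> C \<Longrightarrow> face c = face c' \<Longrightarrow> c = c'"
  using vertex_in_face[of c c'] coord_vertex[of c' c'] by (auto simp: face_def)

lemma facet_set: "{F. F facet_of K} = face ` C" by (auto simp: facet_iff)

lemma sum_facets: "(\<Sum>F | F facet_of K. g F) = (\<Sum>c\<in>C. g (face c))"
  unfolding facet_set by (subst sum.reindex) (auto simp: inj_on_def face_inj)

lemma normal_nonzero: "c \<in> C \<Longrightarrow> a c \<noteq> 0"
proof
  assume "c \<in> C" "a c = 0"
  moreover obtain c' where "c' \<in> C" "c' \<noteq> c" using other_vertex by blast
  ultimately show False using coord_vertex[of c c] coord_vertex[of c c'] by simp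
qed

lemma gradient_sum: "(\<Sum>c\<in>C. a c) = 0"
proof -
  have "(\<Sum>c\<in>C. a c) \<bullet> x = 0" for x
    using coord_sum[of x] coord_sum[of 0] by (simp add: sum.distrib inner_sum_left)
  then show ?thesis using inner_eq_zero_iff by blast
qed

lemma open_coords: "D \<subseteq> C \<Longrightarrow> open {x. \<forall>c\<in>D. 0 < a c \<bullet> x + b c}"
proof -
  assume D: "D \<subseteq> C"
  have "0 < r + s \<longleftrightarrow> - s < r" for r s :: real by linarith
  then have "{x. \<forall>c\<in>D. 0 < a c \<bullet> x + b c} = (\<Inter>c\<in>D. {x. - b c < a c \<bullet> x})" by auto
  then show ?thesis using finite_subset[OF D finite_C] by (simp add: open_INT open_halfspace_gt)
qed

lemma inner_subset: "{x. \<forall>c\<in>C. 0 < a c \<bullet> x + b c} \<subseteq> interior K"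
  by (rule interior_maximal[OF _ open_coords[OF order_refl]]) (auto simp: in_simplex less_imp_le)

lemma barycentre:
  assumes "D \<subseteq> C" "D \<noteq> {}"
  shows "\<exists>y. \<forall>c\<in>C. a c \<bullet> y + b c = (if c \<in> D then 1 / card D else 0)"
proof -
  have finD: "finite D" using assms finite_C finite_subset by blast
  let ?y = "\<Sum>v\<in>D. (1 / card D) *\<^sub>R v"
  have "a c \<bullet> ?y + b c = (if c \<in> D then 1 / card D else 0)" if c: "c \<in> C" for c
  proof -
    have "a c \<bullet> ?y + b c = (\<Sum>v\<in>D. (1 / card D) * (a c \<bullet> v)) + (\<Sum>v\<in>D. (1 / card D) * b c)"
      using assms finD by (simp add: inner_sum_right)
    also have "\<dots> = (\<Sum>v\<in>D. (1 / card D) * (a c \<bullet> v + b c))"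
      by (simp add: sum.distrib distrib_left)
    also have "\<dots> = (\<Sum>v\<in>D. if c = v then 1 / card D else 0)"
      by (rule sum.cong) (use assms c coord_vertex in auto)
    finally show ?thesis using finD by simp
  qed
  then show ?thesis by blast
qed

lemma inner_nonempty: "\<exists>y. \<forall>c\<in>C. 0 < a c \<bullet> y + b c"
proof -
  have "C \<noteq> {}" using card_C by auto
  from barycentre[OF order_refl this] obtain y where "\<forall>c\<in>C. a c \<bullet> y + b c = 1 / card C" by auto
  then show ?thesis using card_C by (intro exI[of _ y]) simp
qed

lemma interior_nonempty: "interior K \<noteq> {}"
  using inner_nonempty inner_subset by blast

lemma face_inner: "c \<in> C \<Longrightarrow> \<exists>y. a c \<bullet> y + b c = 0 \<and> (\<forall>c'\<in>C - {c}. 0 < a c' \<bullet> y + b c')"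
proof -
  assume c: "c \<in> C"
  have ne: "C - {c} \<noteq> {}" using other_vertex by blast
  then have "0 < card (C - {c})" using finite_C by (simp only: card_gt_0_iff) simp
  moreover from barycentre[OF Diff_subset ne] obtain y
    where "\<forall>c'\<in>C. a c' \<bullet> y + b c' = (if c' \<in> C - {c} then 1 / card (C - {c}) else 0)" by blast
  ultimately show ?thesis using c by (intro exI[of _ y]) (simp del: card_Diff_insert card_Diff_singleton)
qed

lemma affine_hull_face:
  assumes "c \<in> C"
  shows "affine hull (face c) = {x. a c \<bullet> x + b c = 0}"
proof
  have "affine {x. a c \<bullet> x = - b c}" by (rule affine_hyperplane)
  moreover have "{x. a c \<bullet> x + b c = 0} = {x. a c \<bullet> x = - b c}" by auto
  ultimately show "affine hull (face c) \<subseteq> {x. a c \<bullet> x + b c = 0}"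
    by (intro hull_minimal) (auto simp: face_def)
next
  show "{x. a c \<bullet> x + b c = 0} \<subseteq> affine hull (face c)"
  proof
    fix x assume x: "x \<in> {x. a c \<bullet> x + b c = 0}"
    then have "(\<Sum>c'\<in>C - {c}. a c' \<bullet> x + b c') = 1" "(\<Sum>c'\<in>C - {c}. (a c' \<bullet> x + b c') *\<^sub>R c') = x"
      using coord_sum[of x] coord_rep[of x] sum.remove[OF finite_C assms, of "\<lambda>c. a c \<bullet> x + b c"]
        sum.remove[OF finite_C assms, of "\<lambda>c. (a c \<bullet> x + b c) *\<^sub>R c"] by simp_all
    then have "x \<in> affine hull (C - {c})"
      using finite_C by (auto simp: affine_hull_finite intro!: exI[of _ "\<lambda>c. a c \<bullet> x + b c"])
    moreover have "C - {c} \<subseteq> face c" using vertex_in_face[OF assms] by blast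
    ultimately show "x \<in> affine hull (face c)" using hull_mono by blast
  qed
qed

text \<open>For a normal \<open>n\<close> as in the definition the linear function \<open>n \<bullet> x\<close> takes the same value at all
  vertices other than \<open>c\<close>. Hence it is an affine function of the coordinate of \<open>c\<close> alone, and \<open>n\<close> is a
  multiple of \<open>a c\<close>.\<close>

lemma outward_normal_face:
  assumes c: "c \<in> C"
  shows "outward_normal K (face c) = (- 1 / norm (a c)) *\<^sub>R a c"
  unfolding outward_normal_def
proof (rule the_equality)
  have na: "norm (a c) > 0" using normal_nonzero[OF c] by simp
  show "norm ((- 1 / norm (a c)) *\<^sub>R a c) = 1 \<and>
      (\<forall>x\<in>K. \<forall>y\<in>face c. ((- 1 / norm (a c)) *\<^sub>R a c) \<bullet> (x - y) \<le> 0)"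
  proof (intro conjI ballI)
    fix x y assume "x \<in> K" "y \<in> face c"
    then have "0 \<le> a c \<bullet> (x - y)" using c by (auto simp: in_simplex face_def inner_diff_right)
    then show "((- 1 / norm (a c)) *\<^sub>R a c) \<bullet> (x - y) \<le> 0" using na by simp
  qed (use na in simp)
next
  have na: "norm (a c) > 0" using normal_nonzero[OF c] by simp
  fix n assume n: "norm n = 1 \<and> (\<forall>x\<in>K. \<forall>y\<in>face c. n \<bullet> (x - y) \<le> 0)"
  obtain c1 where c1: "c1 \<in> C" "c1 \<noteq> c" using other_vertex by blast
  have eq: "n \<bullet> c' = n \<bullet> c1" if "c' \<in> C - {c}" for c'
    using n vertex_in_face[OF c] vertex_in_simplex that c1
    by (intro antisym) (auto simp: inner_diff_right)
  define t where "t = n \<bullet> c - n \<bullet> c1"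
  have t: "t \<le> 0" using n vertex_in_face[OF c c1] vertex_in_simplex[OF c] by (simp add: t_def inner_diff_right)
  have form: "n \<bullet> x = n \<bullet> c1 + (a c \<bullet> x + b c) * t" for x
  proof -
    have "n \<bullet> x = n \<bullet> (\<Sum>c'\<in>C. (a c' \<bullet> x + b c') *\<^sub>R c')" by (simp add: coord_rep)
    also have "\<dots> = (\<Sum>c'\<in>C. (a c' \<bullet> x + b c') * (n \<bullet> c'))" by (simp add: inner_sum_right)
    also have "\<dots> = (\<Sum>c'\<in>C. (a c' \<bullet> x + b c') * (n \<bullet> c1) + (if c = c' then (a c \<bullet> x + b c) * t else 0))"
      by (rule sum.cong) (use eq in \<open>auto simp: t_def algebra_simps\<close>)
    also have "\<dots> = n \<bullet> c1 + (a c \<bullet> x + b c) * t"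
      using coord_sum[of x] finite_C c by (simp add: sum.distrib sum_distrib_right[symmetric])
    finally show ?thesis .
  qed
  have "(n - t *\<^sub>R a c) \<bullet> x = 0" for x
    using form[of x] form[of 0] by (simp add: inner_diff_left algebra_simps)
  then have n': "n = t *\<^sub>R a c" using inner_eq_zero_iff by (metis right_minus_eq)
  then have "\<bar>t\<bar> * norm (a c) = 1" using n by (metis norm_scaleR)
  then have "t = - 1 / norm (a c)" using t na by (simp add: field_simps)
  then show "n = (- 1 / norm (a c)) *\<^sub>R a c" using n' by simp
qed

end

section \<open>Surface integrals and the divergence theorem on a simplex\<close>

lemma integrable_lebesgue_on_compact:
  fixes f :: "'a::euclidean_space \<Rightarrow> real"
  assumes "compact K" "continuous_on UNIV f"
  shows "integrable (lebesgue_on K) f"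
proof -
  have f [measurable]: "f \<in> borel_measurable borel" using assms(2) by (rule borel_measurable_continuous_onI)
  have K [measurable]: "K \<in> sets borel" using assms(1) by (simp add: compact_imp_closed)
  obtain R where R: "\<And>x. x \<in> K \<Longrightarrow> norm x \<le> R"
    using compact_imp_bounded[OF assms(1)] unfolding bounded_iff by blast
  have "bounded (f ` K)"
    by (intro compact_imp_bounded compact_continuous_image continuous_on_subset[OF assms(2)] assms(1)) simp
  then obtain C where C: "\<And>x. x \<in> K \<Longrightarrow> \<bar>f x\<bar> \<le> C"
    unfolding bounded_iff by auto
  have "integrable lborel (\<lambda>x. indicator K x * f x)"
  proof (rule bounded_support_integrable)
    show "\<bar>indicator K x * f x\<bar> \<le> \<bar>C\<bar>" for x using C[of x] by (auto simp: indicator_def)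
    show "indicator K x * f x = 0" if "R < norm x" for x using R[of x] that by (auto simp: indicator_def)
  qed measurable
  then have "integrable lebesgue (\<lambda>x. indicator K x * f x)"
    by (subst integrable_completion) auto
  then show ?thesis by (subst integrable_restrict_space) auto
qed

lemma continuous_radial_derivative:
  fixes \<phi> :: "'a::euclidean_space \<Rightarrow> real"
  assumes deriv: "\<And>x. (\<phi> has_derivative \<phi>' x) (at x)"
    and cont: "\<And>e. continuous_on UNIV (\<lambda>x. \<phi>' x e)"
  shows "continuous_on UNIV (\<lambda>x. \<phi>' x (x - c))"
proof -
  have lin: "linear (\<phi>' x)" for x by (rule has_derivative_linear[OF deriv])
  have "\<phi>' x y = (\<Sum>i\<in>Basis. (y \<bullet> i) * \<phi>' x i)" for x y
  proof -
    have "\<phi>' x y = \<phi>' x (\<Sum>i\<in>Basis. (y \<bullet> i) *\<^sub>R i)" by (simp add: euclidean_representation)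
    then show ?thesis by (simp only: linear_sum[OF lin] linear_cmul[OF lin] real_scaleR_def)
  qed
  then have "(\<lambda>x. \<phi>' x (x - c)) = (\<lambda>x. \<Sum>i\<in>Basis. ((x - c) \<bullet> i) * \<phi>' x i)" by blast
  then show ?thesis by (simp only:) (intro continuous_intros cont)
qed

text \<open>On a hyperplane the closest point projection is the orthogonal one.\<close>

lemma face_measure_hyperplane:
  fixes F :: "(real^'n) set"
  assumes n: "norm n = 1" and hull: "affine hull F = {x. n \<bullet> x = \<beta>}" and F: "compact F"
  defines "p \<equiv> \<lambda>z. z - (n \<bullet> z - \<beta>) *\<^sub>R n"
  defines "S \<equiv> {z. p z \<in> F \<and> \<bar>n \<bullet> z - \<beta>\<bar> \<le> 1/2}"
  shows "face_measure F = distr (lebesgue_on S) (restrict_space borel F) p"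
    and "p \<in> lebesgue_on S \<rightarrow>\<^sub>M restrict_space borel F" and "compact S"
proof -
  have nn: "n \<bullet> n = 1" using n by (simp add: dot_square_norm)
  have cp: "closest_point (affine hull F) z = p z" for z
  proof (rule closest_point_unique[symmetric])
    show "p z \<in> affine hull F" unfolding hull p_def by (simp add: inner_diff_right nn)
    have dz: "dist z (p z) = \<bar>n \<bullet> z - \<beta>\<bar>" using n by (simp add: p_def dist_norm)
    show "\<forall>w\<in>affine hull F. dist z (p z) \<le> dist z w"
    proof
      fix w assume "w \<in> affine hull F"
      then have "\<bar>n \<bullet> z - \<beta>\<bar> = \<bar>n \<bullet> (z - w)\<bar>" unfolding hull by (simp add: inner_diff_right)
      also have "\<dots> \<le> dist z w" using Cauchy_Schwarz_ineq2[of n "z - w"] n by (simp add: dist_norm)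
      finally show "dist z (p z) \<le> dist z w" using dz by simp
    qed
  qed (simp_all add: closed_affine_hull affine_imp_convex)
  have dist: "dist z (p z) = \<bar>n \<bullet> z - \<beta>\<bar>" for z using n by (simp add: p_def dist_norm)
  show fm: "face_measure F = distr (lebesgue_on S) (restrict_space borel F) p"
    unfolding face_measure_def Let_def cp[abs_def] dist S_def by (simp add: fun_eq_iff)
  have contp: "continuous_on UNIV p" unfolding p_def by (intro continuous_intros)
  have "p \<in> borel_measurable (lebesgue_on S)"
    by (intro measurable_restrict_space1 measurable_completion)
      (simp add: borel_measurable_continuous_onI contp)
  then show "p \<in> lebesgue_on S \<rightarrow>\<^sub>M restrict_space borel F"
    by (intro measurable_restrict_space2) (auto simp: S_def space_restrict_space)
  have "S = p -` F \<inter> {z. \<bar>n \<bullet> z - \<beta>\<bar> \<le> 1/2}" by (auto simp: S_def)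
  moreover have "closed (p -` F)"
    using contp F by (simp add: closed_vimage compact_imp_closed)
  moreover have "closed {z. \<bar>n \<bullet> z - \<beta>\<bar> \<le> 1/2}" by (intro closed_Collect_le continuous_intros)
  ultimately have "closed S" by (simp add: closed_Int)
  moreover have "bounded S"
  proof -
    obtain R where R: "\<And>x. x \<in> F \<Longrightarrow> norm x \<le> R" using compact_imp_bounded[OF F] unfolding bounded_iff by blast
    have "norm z \<le> R + 1/2" if "z \<in> S" for z
    proof -
      have "norm z \<le> norm (p z) + dist z (p z)" by (metis dist_norm norm_triangle_sub)
      then show ?thesis using that R[of "p z"] dist[of z] by (simp add: S_def)
    qed
    then show ?thesis unfolding bounded_iff by blast
  qed
  ultimately show "compact S" by (simp add: compact_eq_bounded_closed)
qed

context simplex_coords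
begin

definition "normal c = outward_normal K (face c)"

lemma normal_eq: "c \<in> C \<Longrightarrow> normal c = (- 1 / norm (a c)) *\<^sub>R a c"
  by (simp add: normal_def outward_normal_face)

lemma norm_normal: "c \<in> C \<Longrightarrow> norm (normal c) = 1"
  using normal_nonzero by (simp add: normal_eq)

lemma hull_face_normal:
  assumes c: "c \<in> C"
  shows "affine hull (face c) = {x. normal c \<bullet> x = b c / norm (a c)}"
proof -
  have "normal c \<bullet> x = b c / norm (a c) \<longleftrightarrow> a c \<bullet> x + b c = 0" for x
    using normal_nonzero[OF c] by (simp add: normal_eq[OF c] field_simps) linarith
  then show ?thesis unfolding affine_hull_face[OF c] by simp
qed

lemmas face_measure_face = face_measure_hyperplane[OF norm_normal hull_face_normal compact_face]

lemma space_face_measure: "c \<in> C \<Longrightarrow> space (face_measure (face c)) = face c"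
  using compact_face[of c] by (simp add: face_measure_face(1) space_restrict_space)

lemma sets_face_measure: "c \<in> C \<Longrightarrow> sets (face_measure (face c)) = sets (restrict_space borel (face c))"
  by (simp add: face_measure_face(1))

lemma finite_face_measure:
  assumes c: "c \<in> C"
  shows "finite_measure (face_measure (face c))"
proof -
  let ?S = "{z. z - (normal c \<bullet> z - b c / norm (a c)) *\<^sub>R normal c \<in> face c \<and> \<bar>normal c \<bullet> z - b c / norm (a c)\<bar> \<le> 1/2}"
  have "compact ?S" by (rule face_measure_face(3)[OF c c])
  then have "finite_measure (lebesgue_on ?S)"
    by (intro finite_measure_lebesgue_on lmeasurable_compact)
  then show ?thesis unfolding face_measure_face(1)[OF c c]
    by (rule finite_measure.finite_measure_distr[OF _ face_measure_face(2)[OF c c]])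
qed

lemma measurable_face_measure:
  "c \<in> C \<Longrightarrow> f \<in> borel_measurable borel \<Longrightarrow> f \<in> borel_measurable (face_measure (face c))"
  by (subst measurable_cong_sets[OF sets_face_measure refl]) (auto intro: measurable_restrict_space1)

lemma integrable_face_measure:
  fixes f :: "real^'n \<Rightarrow> real"
  assumes c: "c \<in> C" and f: "continuous_on UNIV f"
  shows "integrable (face_measure (face c)) f"
proof -
  have "bounded (f ` face c)"
    by (intro compact_imp_bounded compact_continuous_image continuous_on_subset[OF f] compact_face) simp
  then obtain B where B: "\<And>x. x \<in> face c \<Longrightarrow> \<bar>f x\<bar> \<le> B"
    unfolding bounded_iff by auto
  show ?thesis
  proof (rule finite_measure.integrable_const_bound[OF finite_face_measure[OF c]])
    show "AE x in face_measure (face c). norm (f x) \<le> B"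
      using B by (intro AE_I2) (simp add: space_face_measure[OF c])
    show "f \<in> borel_measurable (face_measure (face c))"
      using c f by (intro measurable_face_measure borel_measurable_continuous_onI)
  qed
qed

text \<open>This form of the surface integral, with the hyperplane moved to the origin, is the right-hand
  side of the cone formula.\<close>

lemma face_integral_eq:
  fixes f :: "real^'n \<Rightarrow> real"
  assumes c: "c \<in> C" and w: "a c \<bullet> w + b c = 0" and [measurable]: "f \<in> borel_measurable borel"
  shows "(\<integral>x. f x \<partial>face_measure (face c)) = (\<integral>z. indicator {z. \<bar>normal c \<bullet> z\<bar> \<le> 1/2} z *
    (indicator (face c) (w + (z - (normal c \<bullet> z) *\<^sub>R normal c)) * f (w + (z - (normal c \<bullet> z) *\<^sub>R normal c))) \<partial>lborel)"
proof -
  define n where "n = normal c"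
  define \<beta> where "\<beta> = b c / norm (a c)"
  let ?p = "\<lambda>z. z - (n \<bullet> z - \<beta>) *\<^sub>R n"
  let ?S = "{z. ?p z \<in> face c \<and> \<bar>n \<bullet> z - \<beta>\<bar> \<le> 1/2}"
  note fm = face_measure_face[OF c c, folded n_def \<beta>_def]
  have nw: "n \<bullet> w = \<beta>"
    using w normal_nonzero[OF c] by (simp add: n_def \<beta>_def normal_eq[OF c] field_simps)
  have S: "?S \<in> sets borel" using fm(3) by (simp add: compact_imp_closed)
  have pm [measurable]: "?p \<in> borel_measurable borel" by measurable
  have "(\<integral>x. f x \<partial>face_measure (face c)) = (\<integral>z. f (?p z) \<partial>lebesgue_on ?S)"
    unfolding fm(1) by (rule integral_distr[OF fm(2)]) (auto intro: measurable_restrict_space1)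
  also have "\<dots> = (\<integral>z. indicator ?S z * f (?p z) \<partial>lborel)"
    by (rule integral_lebesgue_on_borel[OF S]) measurable
  also have "\<dots> = (\<integral>z. indicator ?S (w + 1 *\<^sub>R z) * f (?p (w + 1 *\<^sub>R z)) \<partial>lborel)"
    using S by (subst lborel_integral_scale[where s = 1 and t = w]) auto
  also have "\<dots> = (\<integral>z. indicator {z. \<bar>n \<bullet> z\<bar> \<le> 1/2} z * (indicator (face c) (w + (z - (n \<bullet> z) *\<^sub>R n))
      * f (w + (z - (n \<bullet> z) *\<^sub>R n))) \<partial>lborel)"
  proof (intro Bochner_Integration.integral_cong refl)
    fix z
    have 1: "?p (w + 1 *\<^sub>R z) = w + (z - (n \<bullet> z) *\<^sub>R n)" by (simp add: inner_add_right nw)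
    have 2: "w + 1 *\<^sub>R z \<in> ?S \<longleftrightarrow> w + (z - (n \<bullet> z) *\<^sub>R n) \<in> face c \<and> \<bar>n \<bullet> z\<bar> \<le> 1/2"
      unfolding mem_Collect_eq 1 by (simp add: inner_add_right nw)
    show "indicator ?S (w + 1 *\<^sub>R z) * f (?p (w + 1 *\<^sub>R z)) =
      indicator {z. \<bar>n \<bullet> z\<bar> \<le> 1/2} z * (indicator (face c) (w + (z - (n \<bullet> z) *\<^sub>R n)) * f (w + (z - (n \<bullet> z) *\<^sub>R n)))"
      unfolding indicator_def 2 1 by (auto simp: of_bool_def)
  qed
  finally show ?thesis by (simp only: n_def)
qed

text \<open>The simplex is a cone with apex \<open>c\<close> and base the opposite face, at distance \<open>1 / norm (a c)\<close>.\<close>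

lemma simplex_cone_integral:
  fixes \<phi> :: "real^'n \<Rightarrow> real"
  assumes c: "c \<in> C" and deriv: "\<And>x. (\<phi> has_derivative \<phi>' x) (at x)"
    and cont: "\<And>e. continuous_on UNIV (\<lambda>x. \<phi>' x e)"
  shows "(\<integral>x. CARD('n) * \<phi> x + \<phi>' x (x - c) \<partial>lebesgue_on K)
      = (\<integral>x. \<phi> x \<partial>face_measure (face c)) / norm (a c)"
proof -
  define n where "n = normal c"
  define h where "h = 1 / norm (a c)"
  define P where "P = {y. \<forall>c'\<in>C - {c}. 0 \<le> a c' \<bullet> y}"
  have na: "0 < norm (a c)" using normal_nonzero[OF c] by simp
  then have h: "0 < h" by (simp add: h_def)
  have n: "norm n = 1" using norm_normal[OF c] by (simp add: n_def)
  have ny: "n \<bullet> y = - (a c \<bullet> y) * h" for y by (simp add: n_def normal_eq[OF c] h_def)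
  have shift: "a c' \<bullet> (c + y) + b c' = (if c' = c then 1 + a c \<bullet> y else a c' \<bullet> y)" if "c' \<in> C" for c' y
    using coord_vertex[OF that c] by (auto simp: inner_add_right)
  have ineq: "n \<bullet> y \<le> h \<longleftrightarrow> 0 \<le> 1 + a c \<bullet> y" for y
    using mult_le_cancel_right_pos[OF h, of "- (a c \<bullet> y)" 1] unfolding ny by auto
  have inK: "c + y \<in> K \<longleftrightarrow> y \<in> P \<inter> {y. n \<bullet> y \<le> h}" for y
    unfolding in_simplex using c by (auto simp: shift P_def ineq)
  have inF: "c + y \<in> face c \<longleftrightarrow> y \<in> P" if "n \<bullet> y = h" for y
  proof -
    have "- (a c \<bullet> y) = 1" using that h unfolding ny by (metis mult_cancel_right2 less_irrefl)
    then have "a c \<bullet> (c + y) + b c = 0" using shift[OF c, of y] by simp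
    then show ?thesis using that inK[of y] by (simp add: face_def)
  qed
  have closedP: "closed P"
  proof -
    have "P = (\<Inter>c'\<in>C - {c}. {y. 0 \<le> a c' \<bullet> y})" by (auto simp: P_def)
    then show ?thesis using closed_halfspace_ge by (auto intro!: closed_INT)
  qed
  have cone: "s *\<^sub>R y \<in> P \<longleftrightarrow> y \<in> P" if "0 < s" for s y
    using that by (simp add: P_def zero_le_mult_iff)
  have pos: "0 \<le> n \<bullet> y" if "y \<in> P" for y
  proof -
    have "0 = (\<Sum>c'\<in>C. a c') \<bullet> y" by (simp add: gradient_sum)
    also have "\<dots> = a c \<bullet> y + (\<Sum>c'\<in>C - {c}. a c' \<bullet> y)"
      unfolding inner_sum_left by (rule sum.remove[OF finite_C c])
    finally have "a c \<bullet> y \<le> 0" using that sum_nonneg[of "C - {c}" "\<lambda>c'. a c' \<bullet> y"] by (simp add: P_def)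
    then show ?thesis using h by (simp add: ny mult_nonpos_nonneg)
  qed
  have bdd: "bounded (P \<inter> {y. n \<bullet> y \<le> h})"
  proof -
    have "P \<inter> {y. n \<bullet> y \<le> h} \<subseteq> (\<lambda>x. x - c) ` K" using inK by (auto intro!: image_eqI[where x = "c + y" for y])
    moreover have "bounded ((\<lambda>x. x - c) ` K)" using compact_K compact_imp_bounded bounded_translation_minus by blast
    ultimately show ?thesis using bounded_subset by blast
  qed
  have cont\<phi>: "continuous_on UNIV \<phi>"
    by (intro continuous_at_imp_continuous_on ballI has_derivative_continuous[OF deriv])
  have contd: "continuous_on UNIV (\<lambda>x. \<phi>' x (x - c))"
    by (rule continuous_radial_derivative[OF deriv cont])
  define q where "q y = \<phi> (c + y)" for y
  have q: "(q has_derivative \<phi>' (c + y)) (at y)" for y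
  proof -
    have "((\<lambda>y. \<phi> (c + y)) has_derivative (\<lambda>e. \<phi>' (c + y) e)) (at y)"
      by (rule has_derivative_compose[OF _ deriv, where f = "\<lambda>y. c + y"]) (auto intro!: derivative_eq_intros)
    then show ?thesis unfolding q_def[abs_def] .
  qed
  have contq: "continuous_on UNIV (\<lambda>y. \<phi>' (c + y) y)"
    using continuous_on_compose2[OF contd, of UNIV "\<lambda>y. c + y"] by (simp add: continuous_on_add)
  have meas [measurable]: "(\<lambda>x. CARD('n) * \<phi> x + \<phi>' x (x - c)) \<in> borel_measurable borel"
    by (intro borel_measurable_continuous_onI continuous_intros cont\<phi> contd)
  have K [measurable]: "K \<in> sets borel" using compact_K by (simp add: compact_imp_closed)
  have "(\<integral>x. CARD('n) * \<phi> x + \<phi>' x (x - c) \<partial>lebesgue_on K)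
    = (\<integral>x. indicator K x * (CARD('n) * \<phi> x + \<phi>' x (x - c)) \<partial>lborel)"
    by (rule integral_lebesgue_on_borel) auto
  also have "\<dots> = (\<integral>y. indicator K (c + 1 *\<^sub>R y) * (CARD('n) * \<phi> (c + 1 *\<^sub>R y) + \<phi>' (c + 1 *\<^sub>R y) (c + 1 *\<^sub>R y - c)) \<partial>lborel)"
    by (subst lborel_integral_scale[where s = 1 and t = c]) auto
  also have "\<dots> = (\<integral>y. indicator (P \<inter> {y. n \<bullet> y \<le> h}) y * (DIM(real^'n) * q y + \<phi>' (c + y) y) \<partial>lborel)"
    by (simp add: indicator_def inK q_def)
  also have "\<dots> = h * (\<integral>z. indicator {z. \<bar>n \<bullet> z\<bar> \<le> 1/2} z * (indicator P ((z - (n \<bullet> z) *\<^sub>R n) + h *\<^sub>R n)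
      * q ((z - (n \<bullet> z) *\<^sub>R n) + h *\<^sub>R n)) \<partial>lborel)"
    by (rule cone_integral[OF n h closedP cone pos bdd q contq])
  also have "\<dots> = h * (\<integral>x. \<phi> x \<partial>face_measure (face c))"
  proof -
    have nn: "n \<bullet> n = 1" using n by (simp add: dot_square_norm)
    have w: "a c \<bullet> (c + h *\<^sub>R n) + b c = 0"
    proof -
      have "n \<bullet> (h *\<^sub>R n) = h" using nn by simp
      then have "- (a c \<bullet> (h *\<^sub>R n)) * h = h" unfolding ny .
      then have "- (a c \<bullet> (h *\<^sub>R n)) = 1" using h by (metis mult_cancel_right2 less_irrefl)
      then show ?thesis using shift[OF c, of "h *\<^sub>R n"] by simp
    qed
    have *: "c + h *\<^sub>R n + (z - (n \<bullet> z) *\<^sub>R n) = c + ((z - (n \<bullet> z) *\<^sub>R n) + h *\<^sub>R n)" for z by simp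
    have "n \<bullet> ((z - (n \<bullet> z) *\<^sub>R n) + h *\<^sub>R n) = h" for z by (simp add: inner_add_right inner_diff_right nn)
    note ** = inF[OF this]
    have "\<phi> \<in> borel_measurable borel" using cont\<phi> by (rule borel_measurable_continuous_onI)
    from face_integral_eq[OF c w this] show ?thesis
      unfolding n_def[symmetric] * indicator_def ** q_def by simp
  qed
  finally show ?thesis by (simp add: h_def)
qed

text \<open>A constant vector \<open>e\<close> is the combination \<open>- (\<Sum>c\<in>C. (a c \<bullet> e) *\<^sub>R (x - c))\<close> of the radial fields
  of the vertices, for which the cone formula is available.\<close>

theorem divergence_simplex:
  fixes \<phi> :: "real^'n \<Rightarrow> real"
  assumes deriv: "\<And>x. (\<phi> has_derivative \<phi>' x) (at x)"
    and cont: "\<And>e. continuous_on UNIV (\<lambda>x. \<phi>' x e)"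
  shows "(\<integral>x. \<phi>' x e \<partial>lebesgue_on K) = (\<Sum>c\<in>C. (e \<bullet> normal c) * (\<integral>x. \<phi> x \<partial>face_measure (face c)))"
proof -
  have lin: "linear (\<phi>' x)" for x by (rule has_derivative_linear[OF deriv])
  have sum0: "(\<Sum>c\<in>C. a c \<bullet> e) = 0" using gradient_sum by (simp add: inner_sum_left[symmetric])
  have rep: "(\<Sum>c\<in>C. (a c \<bullet> e) *\<^sub>R c) = e"
  proof -
    have "(\<Sum>c\<in>C. (a c \<bullet> e) *\<^sub>R c) = (\<Sum>c\<in>C. (a c \<bullet> e + b c) *\<^sub>R c) - (\<Sum>c\<in>C. (a c \<bullet> 0 + b c) *\<^sub>R c)"
      by (simp add: sum_subtractf[symmetric] scaleR_left.diff[symmetric])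
    then show ?thesis unfolding coord_rep by simp
  qed
  have cont\<phi>: "continuous_on UNIV \<phi>"
    by (intro continuous_at_imp_continuous_on ballI has_derivative_continuous[OF deriv])
  have contd: "continuous_on UNIV (\<lambda>x. \<phi>' x (x - c))" for c
    by (rule continuous_radial_derivative[OF deriv cont])
  let ?g = "\<lambda>c x. CARD('n) * \<phi> x + \<phi>' x (x - c)"
  have int: "integrable (lebesgue_on K) (?g c)" for c
    by (intro integrable_lebesgue_on_compact compact_K continuous_intros cont\<phi> contd)
  have "\<phi>' x e = (\<Sum>c\<in>C. - (a c \<bullet> e) * ?g c x)" for x
  proof -
    have "(\<Sum>c\<in>C. (- (a c \<bullet> e)) *\<^sub>R (x - c)) = e"
      using rep sum0 by (simp add: scaleR_diff_right sum_subtractf sum_negf flip: scaleR_sum_left)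
    then have "\<phi>' x e = \<phi>' x (\<Sum>c\<in>C. (- (a c \<bullet> e)) *\<^sub>R (x - c))" by simp
    also have "\<dots> = (\<Sum>c\<in>C. - (a c \<bullet> e) * \<phi>' x (x - c))"
      by (simp add: linear_sum[OF lin] linear_cmul[OF lin] linear_neg[OF lin] del: scaleR_minus_left)
    also have "\<dots> = (\<Sum>c\<in>C. - (a c \<bullet> e) * \<phi>' x (x - c)) + (\<Sum>c\<in>C. - (a c \<bullet> e)) * (CARD('n) * \<phi> x)"
      using sum0 by (simp add: sum_negf)
    also have "\<dots> = (\<Sum>c\<in>C. - (a c \<bullet> e) * ?g c x)"
      unfolding sum_distrib_right sum.distrib[symmetric] by (intro sum.cong refl) (simp add: algebra_simps)
    finally show ?thesis .
  qed
  then have "(\<integral>x. \<phi>' x e \<partial>lebesgue_on K) = (\<integral>x. (\<Sum>c\<in>C. - (a c \<bullet> e) * ?g c x) \<partial>lebesgue_on K)" by simp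
  also have "\<dots> = (\<Sum>c\<in>C. - (a c \<bullet> e) * (\<integral>x. ?g c x \<partial>lebesgue_on K))"
    using int by simp
  also have "\<dots> = (\<Sum>c\<in>C. - (a c \<bullet> e) * ((\<integral>x. \<phi> x \<partial>face_measure (face c)) / norm (a c)))"
    by (intro sum.cong refl) (simp add: simplex_cone_integral[OF _ deriv cont])
  also have "\<dots> = (\<Sum>c\<in>C. (e \<bullet> normal c) * (\<integral>x. \<phi> x \<partial>face_measure (face c)))"
    by (intro sum.cong refl) (simp add: normal_eq inner_commute)
  finally show ?thesis .
qed

end

section \<open>The mesh\<close>

context simplex_coords
begin

lemma normal_dot: "c \<in> C \<Longrightarrow> a c \<bullet> normal c = - norm (a c)"
  using normal_nonzero[of c] by (simp add: normal_eq dot_square_norm power2_eq_square)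

lemma hull_coord_zero:
  assumes "D \<subseteq> C" "c' \<in> C" "c' \<notin> D" "x \<in> convex hull D"
  shows "a c' \<bullet> x + b c' = 0"
proof -
  have "a c' \<bullet> d = - b c'" if "d \<in> D" for d
    using coord_vertex[OF assms(2), of d] assms(1,3) that by (auto split: if_splits)
  then have "convex hull D \<subseteq> {x. a c' \<bullet> x = - b c'}"
    by (intro hull_minimal) (auto simp: convex_hyperplane)
  then show ?thesis using assms(4) by auto
qed

lemma face_hull:
  assumes c: "c \<in> C"
  shows "face c = convex hull (C - {c})"
proof -
  have "face c facet_of K" using c facet_iff by blast
  then obtain D where D: "D \<subseteq> C" "face c = convex hull D"
    using face_of_convex_hull_affine_independent[OF indep] unfolding facet_of_def hull by blast
  have "D \<subseteq> face c" unfolding D(2) by (rule hull_subset)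
  then have "c \<notin> D" using coord_vertex[OF c c] by (auto simp: face_def)
  moreover have "c' \<in> D" if c': "c' \<in> C" "c' \<noteq> c" for c'
  proof (rule ccontr)
    assume "c' \<notin> D"
    then have "a c' \<bullet> c' + b c' = 0"
      using hull_coord_zero[OF D(1) c'(1)] vertex_in_face[OF c c'] D(2) by blast
    then show False using coord_vertex[OF c'(1) c'(1)] by simp
  qed
  ultimately have "D = C - {c}" using D(1) by blast
  with D(2) show ?thesis by simp
qed

lemma proper_subface:
  assumes c: "c \<in> C" and G: "G face_of K" "G \<subseteq> face c" "G \<noteq> face c"
  shows "\<exists>c'\<in>C - {c}. \<forall>x\<in>G. a c' \<bullet> x + b c' = 0"
proof -
  obtain D where D: "D \<subseteq> C" "G = convex hull D"
    using G(1) face_of_convex_hull_affine_independent[OF indep] unfolding hull by blast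
  have "D \<subseteq> G" unfolding D(2) by (rule hull_subset)
  then have "c \<notin> D" using coord_vertex[OF c c] G(2) by (auto simp: face_def)
  moreover have "D \<noteq> C - {c}" using G(3) D(2) face_hull[OF c] by auto
  ultimately obtain c' where c': "c' \<in> C" "c' \<noteq> c" "c' \<notin> D" using D(1) by blast
  then have "\<forall>x\<in>G. a c' \<bullet> x + b c' = 0" using hull_coord_zero[OF D(1)] D(2) by blast
  then show ?thesis using c' by (intro bexI[of _ c']) auto
qed

lemma face_subset_face_of:
  assumes c: "c \<in> C" and G: "G face_of K" and y: "y \<in> G" "\<And>c'. c' \<in> C - {c} \<Longrightarrow> 0 < a c' \<bullet> y + b c'"
  shows "face c \<subseteq> G"
proof -
  obtain D where D: "D \<subseteq> C" "G = convex hull D"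
    using G(1) face_of_convex_hull_affine_independent[OF indep] unfolding hull by blast
  have "c' \<in> D" if c': "c' \<in> C - {c}" for c'
  proof (rule ccontr)
    assume "c' \<notin> D"
    then have "a c' \<bullet> y + b c' = 0" using hull_coord_zero[OF D(1)] c' y(1) D(2) by blast
    then show False using y(2)[OF c'] by simp
  qed
  then show ?thesis unfolding face_hull[OF c] D(2) by (intro hull_mono) blast
qed

text \<open>Another coordinate vanishes on a null set of the face only: its gradient could be parallel to
  the normal of the face, but then it takes the constant value 1 there.\<close>

lemma coord_nonzero_AE:
  assumes c: "c \<in> C" and c': "c' \<in> C" "c' \<noteq> c"
  shows "AE x in face_measure (face c). a c' \<bullet> x + b c' \<noteq> 0"
proof -
  define n where "n = normal c"
  define \<beta> where "\<beta> = b c / norm (a c)"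
  let ?p = "\<lambda>z. z - (n \<bullet> z - \<beta>) *\<^sub>R n"
  let ?S = "{z. ?p z \<in> face c \<and> \<bar>n \<bullet> z - \<beta>\<bar> \<le> 1/2}"
  note fm = face_measure_face[OF c c, folded n_def \<beta>_def]
  define v where "v = a c' - (n \<bullet> a c') *\<^sub>R n"
  have coord: "a c' \<bullet> ?p z + b c' = v \<bullet> z + (\<beta> * (n \<bullet> a c') + b c')" for z
    by (simp add: v_def inner_diff_right inner_diff_left algebra_simps inner_commute)
  have "AE z in lebesgue_on ?S. a c' \<bullet> ?p z + b c' \<noteq> 0"
  proof (cases "v = 0")
    case True
    have "n \<bullet> c' = \<beta>"
      using hull_subset[of "face c" affine] vertex_in_face[OF c c'] hull_face_normal[OF c]
      unfolding n_def \<beta>_def by auto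
    then have "a c' \<bullet> ?p c' + b c' = 1" using coord_vertex[OF c'(1) c'(1)] by simp
    then have "a c' \<bullet> ?p z + b c' = 1" for z unfolding coord True by simp
    then show ?thesis by simp
  next
    case False
    let ?H = "{z. v \<bullet> z = - (\<beta> * (n \<bullet> a c') + b c')}"
    have "negligible ?H" using False by (intro negligible_hyperplane) simp
    then have "?H \<in> null_sets lebesgue" by (simp add: negligible_iff_null_sets)
    then have "AE z in lebesgue. z \<notin> ?H" by (rule AE_not_in)
    moreover have "?S \<in> sets lebesgue" using fm(3) by (simp add: lmeasurable_compact fmeasurableD)
    ultimately show ?thesis
      unfolding coord by (subst AE_restrict_space_iff) (auto elim!: eventually_mono)
  qed
  moreover have "{x \<in> space (restrict_space borel (face c)). a c' \<bullet> x + b c' \<noteq> 0} \<in> sets (restrict_space borel (face c))"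
  proof -
    have [measurable]: "(\<lambda>x. a c' \<bullet> x + b c') \<in> borel_measurable (restrict_space borel (face c))"
      by (intro measurable_restrict_space1) measurable
    show ?thesis by measurable
  qed
  ultimately show ?thesis unfolding fm(1) by (subst AE_distr_iff[OF fm(2)])
qed

end

locale hdg_mesh =
  fixes \<Omega> :: "(real^'n) set" and \<T> :: "(real^'n) set set"
  assumes domain: "convex_polyhedral_domain \<Omega>" and mesh: "conforming_mesh \<Omega> \<T>"
begin

lemma finite_mesh: "finite \<T>" and cell_Int: "K \<in> \<T> \<Longrightarrow> K' \<in> \<T> \<Longrightarrow> K \<inter> K' face_of K"
  and cell_Union: "\<Union>\<T> = closure \<Omega>" and simplex: "K \<in> \<T> \<Longrightarrow> int CARD('n) simplex K"
  using mesh unfolding conforming_mesh_def triangulation_def by auto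

lemma cell_Int': "K \<in> \<T> \<Longrightarrow> K' \<in> \<T> \<Longrightarrow> K \<inter> K' face_of K'"
  using cell_Int[of K' K] by (simp add: Int_commute)

lemma cell_coords: "K \<in> \<T> \<Longrightarrow> \<exists>C a b. simplex_coords K C a b"
  using simplex simplex_coords_exist by blast

lemma open_domain: "open \<Omega>" and convex_domain: "convex \<Omega>" and bounded_domain: "bounded \<Omega>"
  using domain unfolding convex_polyhedral_domain_def by auto

lemma finite_facets: "K \<in> \<T> \<Longrightarrow> finite {F. F facet_of K}"
  using cell_coords simplex_coords.facet_set simplex_coords.finite_C by (metis finite_imageI)

lemma compact_cell: "K \<in> \<T> \<Longrightarrow> compact K"
  using cell_coords simplex_coords.compact_K by blast

lemma interior_cell: "K \<in> \<T> \<Longrightarrow> interior K \<noteq> {}"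
  using cell_coords simplex_coords.interior_nonempty by blast

lemma facet_coords:
  assumes "K \<in> \<T>" "F facet_of K"
  shows "\<exists>C a b c. simplex_coords K C a b \<and> c \<in> C \<and> F = simplex_coords.face K a b c"
  using cell_coords[OF assms(1)] assms(2) simplex_coords.facet_iff by metis

lemma finite_mesh_faces: "finite (mesh_faces \<T>)"
proof -
  have "mesh_faces \<T> = (\<Union>K\<in>\<T>. {F. F facet_of K})" by (auto simp: mesh_faces_def)
  then show ?thesis using finite_mesh finite_facets by simp
qed

lemma mesh_face_coords:
  assumes "F \<in> mesh_faces \<T>"
  shows "\<exists>K C a b c. K \<in> \<T> \<and> simplex_coords K C a b \<and> c \<in> C \<and> F = simplex_coords.face K a b c"
  using assms facet_coords unfolding mesh_faces_def by blast

lemma compact_mesh_face: "F \<in> mesh_faces \<T> \<Longrightarrow> compact F"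
  using mesh_face_coords simplex_coords.compact_face by blast

lemma finite_measure_face: "F \<in> mesh_faces \<T> \<Longrightarrow> finite_measure (face_measure F)"
  using mesh_face_coords simplex_coords.finite_face_measure by blast

lemma space_face: "F \<in> mesh_faces \<T> \<Longrightarrow> space (face_measure F) = F"
  using mesh_face_coords simplex_coords.space_face_measure by blast

lemma measurable_face: "F \<in> mesh_faces \<T> \<Longrightarrow> f \<in> borel_measurable borel \<Longrightarrow> f \<in> borel_measurable (face_measure F)"
  using mesh_face_coords simplex_coords.measurable_face_measure by blast

lemma integrable_face:
  "F \<in> mesh_faces \<T> \<Longrightarrow> continuous_on UNIV f \<Longrightarrow> integrable (face_measure F) (f :: real^'n \<Rightarrow> real)"
  using mesh_face_coords simplex_coords.integrable_face_measure by blast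

lemma integrable_cell:
  "K \<in> \<T> \<Longrightarrow> continuous_on UNIV f \<Longrightarrow> integrable (lebesgue_on K) (f :: real^'n \<Rightarrow> real)"
  using compact_cell integrable_lebesgue_on_compact by blast

lemma norm_outward_normal:
  assumes "K \<in> \<T>" "F facet_of K"
  shows "norm (outward_normal K F) = 1"
proof -
  obtain C a b c where "simplex_coords K C a b" and c: "c \<in> C" "F = simplex_coords.face K a b c"
    using facet_coords[OF assms] by blast
  then interpret simplex_coords K C a b by simp
  show ?thesis using norm_normal[OF c(1)] c(2) by (simp add: normal_def)
qed

lemma divergence_cell:
  fixes \<phi> :: "real^'n \<Rightarrow> real"
  assumes "K \<in> \<T>" and "\<And>x. (\<phi> has_derivative \<phi>' x) (at x)" and "\<And>e. continuous_on UNIV (\<lambda>x. \<phi>' x e)"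
  shows "(\<integral>x. \<phi>' x e \<partial>lebesgue_on K)
    = (\<Sum>F | F facet_of K. (\<integral>x. \<phi> x * (e \<bullet> outward_normal K F) \<partial>face_measure F))"
proof -
  obtain C a b where "simplex_coords K C a b" using cell_coords[OF assms(1)] by blast
  then interpret simplex_coords K C a b .
  show ?thesis unfolding sum_facets divergence_simplex[OF assms(2,3)]
    by (intro sum.cong refl) (simp add: normal_def mult.commute)
qed

lemma cells_overlap_frontier:
  assumes "K \<in> \<T>" "K' \<in> \<T>" "K \<noteq> K'"
  shows "K \<inter> K' \<subseteq> frontier K \<or> K \<inter> K' \<subseteq> frontier K'"
proof -
  have *: "G \<subseteq> frontier S" if "G face_of S" "G \<noteq> S" "S \<in> \<T>" for G S
    using face_of_disjoint_interior[OF that(1,2)] face_of_imp_subset[OF that(1)] compact_cell[OF that(3)]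
    by (auto simp: frontier_def closure_closed compact_imp_closed)
  have "K \<inter> K' \<noteq> K \<or> K \<inter> K' \<noteq> K'" using assms by auto
  then show ?thesis using *[OF cell_Int] *[OF cell_Int'] assms by blast
qed

lemma interior_disjoint:
  assumes "K \<in> \<T>" "K' \<in> \<T>" "x \<in> interior K" "x \<in> interior K'"
  shows "K = K'"
  using cells_overlap_frontier[OF assms(1,2)] assms interior_subset by (auto simp: frontier_def)

lemma convex_cell: "K \<in> \<T> \<Longrightarrow> convex K"
  using cell_coords simplex_coords.convex_K by blast

lemma cells_overlap_negligible:
  assumes "K \<in> \<T>" "K' \<in> \<T>" "K \<noteq> K'"
  shows "negligible (K \<inter> K')"
  using cells_overlap_frontier[OF assms] negligible_convex_frontier convex_cell assms negligible_subset by meson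

lemma cells_overlap_AE:
  assumes "K \<in> \<T>"
  shows "AE x in lebesgue_on K. \<forall>K'\<in>\<T> - {K}. x \<notin> K'"
proof -
  have "AE x in lebesgue_on K. x \<notin> K'" if "K' \<in> \<T> - {K}" for K'
  proof -
    have "K \<inter> K' \<in> null_sets lebesgue"
      using cells_overlap_negligible[OF assms] that by (auto simp: negligible_iff_null_sets)
    then have "AE x in lebesgue. x \<notin> K \<inter> K'" by (rule AE_not_in)
    moreover have "K \<in> sets lebesgue" using compact_cell[OF assms] by (simp add: lmeasurable_compact fmeasurableD)
    ultimately show ?thesis by (subst AE_restrict_space_iff) (auto elim!: eventually_mono)
  qed
  then show ?thesis using finite_mesh by (subst AE_ball_countable) (auto intro: countable_finite)
qed

text \<open>By conformity two facets meet in a common face. If they are different, it is a proper face of the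
  first one, on which some further barycentric coordinate vanishes.\<close>

lemma faces_overlap_AE:
  assumes F: "F \<in> mesh_faces \<T>"
  shows "AE x in face_measure F. \<forall>F'\<in>mesh_faces \<T> - {F}. x \<notin> F'"
proof -
  have "AE x in face_measure F. x \<notin> F'" if F': "F' \<in> mesh_faces \<T> - {F}" for F'
  proof -
    obtain K C a b c where K: "K \<in> \<T>" and coords: "simplex_coords K C a b" and c: "c \<in> C"
      and Fc: "F = simplex_coords.face K a b c" using mesh_face_coords[OF F] by metis
    interpret simplex_coords K C a b by (rule coords)
    obtain K' where K': "K' \<in> \<T>" "F' facet_of K'" using F' by (auto simp: mesh_faces_def)
    have FK: "F facet_of K" using facet_iff c Fc by blast
    have faces: "F face_of K" "F' face_of K'" using FK K' by (auto simp: facet_of_def)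
    have G: "F \<inter> F' face_of F \<and> F \<inter> F' face_of F'"
      using face_of_Int_subface[OF cell_Int[OF K K'(1)] cell_Int'[OF K K'(1)] faces] .
    have "F \<inter> F' \<noteq> F"
    proof
      assume "F \<inter> F' = F"
      then have FF': "F face_of F'" using G by simp
      have "aff_dim F = aff_dim F'"
        using FK K' aff_dim_simplex[OF simplex[OF K]] aff_dim_simplex[OF simplex[OF K'(1)]]
        by (simp add: facet_of_def)
      moreover have "convex F'" by (rule face_of_imp_convex[OF faces(2)])
      ultimately have "F = F'" using face_of_aff_dim_lt[OF _ FF'] by force
      then show False using F' by simp
    qed
    moreover have "F \<inter> F' face_of K" using G faces face_of_trans by blast
    ultimately obtain c' where c': "c' \<in> C - {c}" "\<forall>x\<in>F \<inter> F'. a c' \<bullet> x + b c' = 0"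
      using proper_subface[OF c, of "F \<inter> F'"] Fc by auto
    have "AE x in face_measure F. a c' \<bullet> x + b c' \<noteq> 0"
      using coord_nonzero_AE[OF c] c' Fc by auto
    moreover have "AE x in face_measure F. x \<in> F" using space_face[OF F] by (intro AE_I2) simp
    ultimately show ?thesis by eventually_elim (use c' in blast)
  qed
  then show ?thesis using finite_mesh_faces by (subst AE_ball_countable) (auto intro: countable_finite)
qed

lemma small_step:
  fixes y v :: "real^'n"
  assumes "open U" "y \<in> U"
  shows "\<exists>\<epsilon>>0. \<epsilon> \<le> 1 \<and> y + \<epsilon> *\<^sub>R v \<in> U"
proof -
  obtain r where r: "0 < r" "ball y r \<subseteq> U" using assms openE by blast
  define w where "w = norm v + 1"
  have w: "0 < w" "norm v \<le> w" by (simp_all add: w_def add_nonneg_pos)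
  define \<epsilon> where "\<epsilon> = min 1 (r / (2 * w))"
  have pos: "0 < \<epsilon>" using r w by (simp add: \<epsilon>_def)
  have "\<epsilon> * norm v \<le> r / (2 * w) * w"
    using w r by (intro mult_mono) (auto simp: \<epsilon>_def)
  also have "\<dots> < r" using w r by simp
  finally have "y + \<epsilon> *\<^sub>R v \<in> ball y r" using pos by (simp add: dist_norm)
  then show ?thesis using pos r by (intro exI[of _ \<epsilon>]) (auto simp: \<epsilon>_def)
qed

text \<open>Two cells with a common facet and the same outward normal both contain the points slightly below
  the facet in their interior.\<close>

lemma same_normal_same_cell:
  assumes K: "K1 \<in> \<T>" "K2 \<in> \<T>" and F: "F facet_of K1" "F facet_of K2"
    and n: "outward_normal K1 F = outward_normal K2 F"
  shows "K1 = K2"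
proof -
  obtain C1 a1 b1 c1 where coords1: "simplex_coords K1 C1 a1 b1" and c1: "c1 \<in> C1"
    and F1: "F = simplex_coords.face K1 a1 b1 c1" using facet_coords[OF K(1) F(1)] by metis
  obtain C2 a2 b2 c2 where coords2: "simplex_coords K2 C2 a2 b2" and c2: "c2 \<in> C2"
    and F2: "F = simplex_coords.face K2 a2 b2 c2" using facet_coords[OF K(2) F(2)] by metis
  interpret k1: simplex_coords K1 C1 a1 b1 by (rule coords1)
  interpret k2: simplex_coords K2 C2 a2 b2 by (rule coords2)
  define n where "n = outward_normal K1 F"
  obtain y1 where y1: "a1 c1 \<bullet> y1 + b1 c1 = 0" "\<And>c. c \<in> C1 - {c1} \<Longrightarrow> 0 < a1 c \<bullet> y1 + b1 c"
    using k1.face_inner[OF c1] by blast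
  obtain y2 where y2: "a2 c2 \<bullet> y2 + b2 c2 = 0" "\<And>c. c \<in> C2 - {c2} \<Longrightarrow> 0 < a2 c \<bullet> y2 + b2 c"
    using k2.face_inner[OF c2] by blast
  have "y1 \<in> F" unfolding F1 k1.face_def k1.in_simplex mem_Collect_eq
    using y1 by (metis DiffI empty_iff insert_iff less_imp_le order_refl)
  then have 12: "a2 c2 \<bullet> y1 + b2 c2 = 0" "\<And>c. c \<in> C2 \<Longrightarrow> 0 \<le> a2 c \<bullet> y1 + b2 c"
    unfolding F2 k2.face_def k2.in_simplex by auto
  have "y2 \<in> F" unfolding F2 k2.face_def k2.in_simplex mem_Collect_eq
    using y2 by (metis DiffI empty_iff insert_iff less_imp_le order_refl)
  then have 21: "a1 c1 \<bullet> y2 + b1 c1 = 0" "\<And>c. c \<in> C1 \<Longrightarrow> 0 \<le> a1 c \<bullet> y2 + b1 c"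
    unfolding F1 k1.face_def k1.in_simplex by auto
  define y where "y = (1/2) *\<^sub>R y1 + (1/2) *\<^sub>R y2"
  have avg: "v \<bullet> y + t = ((v \<bullet> y1 + t) + (v \<bullet> y2 + t)) / 2" for v t
    by (simp add: y_def inner_add_right field_simps)
  define U where "U = {x. \<forall>c\<in>C1 - {c1}. 0 < a1 c \<bullet> x + b1 c} \<inter> {x. \<forall>c\<in>C2 - {c2}. 0 < a2 c \<bullet> x + b2 c}"
  have "open U" unfolding U_def by (intro open_Int k1.open_coords k2.open_coords) auto
  moreover have "y \<in> U"
  proof -
    have "0 < a1 c \<bullet> y + b1 c" if "c \<in> C1 - {c1}" for c
      using y1(2)[OF that] 21(2)[of c] that unfolding avg by auto
    moreover have "0 < a2 c \<bullet> y + b2 c" if "c \<in> C2 - {c2}" for c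
      using y2(2)[OF that] 12(2)[of c] that unfolding avg by auto
    ultimately show ?thesis unfolding U_def by blast
  qed
  ultimately obtain \<epsilon> where \<epsilon>: "0 < \<epsilon>" "y + \<epsilon> *\<^sub>R (- n) \<in> U" using small_step by blast
  let ?z = "y + \<epsilon> *\<^sub>R (- n)"
  have d1: "a1 c1 \<bullet> n = - norm (a1 c1)"
    unfolding n_def using k1.normal_dot[OF c1] F1 by (simp add: k1.normal_def)
  have d2: "a2 c2 \<bullet> n = - norm (a2 c2)"
    unfolding n_def n using k2.normal_dot[OF c2] F2 by (simp add: k2.normal_def)
  have "a1 c1 \<bullet> ?z + b1 c1 = (a1 c1 \<bullet> y + b1 c1) + \<epsilon> * norm (a1 c1)"
    by (simp add: inner_diff_right d1)
  moreover have "a1 c1 \<bullet> y + b1 c1 = 0" unfolding avg y1(1) 21(1) by simp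
  moreover have "a2 c2 \<bullet> ?z + b2 c2 = (a2 c2 \<bullet> y + b2 c2) + \<epsilon> * norm (a2 c2)"
    by (simp add: inner_diff_right d2)
  moreover have "a2 c2 \<bullet> y + b2 c2 = 0" unfolding avg y2(1) 12(1) by simp
  ultimately have "0 < a1 c1 \<bullet> ?z + b1 c1" "0 < a2 c2 \<bullet> ?z + b2 c2"
    using \<epsilon>(1) k1.normal_nonzero[OF c1] k2.normal_nonzero[OF c2] by auto
  moreover have "0 < a1 c \<bullet> ?z + b1 c" if "c \<in> C1 - {c1}" for c
    using \<epsilon>(2) that unfolding U_def by blast
  moreover have "0 < a2 c \<bullet> ?z + b2 c" if "c \<in> C2 - {c2}" for c
    using \<epsilon>(2) that unfolding U_def by blast
  ultimately have "?z \<in> {x. \<forall>c\<in>C1. 0 < a1 c \<bullet> x + b1 c}" "?z \<in> {x. \<forall>c\<in>C2. 0 < a2 c \<bullet> x + b2 c}" by blast+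
  then have "?z \<in> interior K1" "?z \<in> interior K2" using k1.inner_subset k2.inner_subset by blast+
  then show ?thesis by (rule interior_disjoint[OF K])
qed

lemma normals_parallel:
  assumes K: "K1 \<in> \<T>" "K2 \<in> \<T>" and F: "F facet_of K1" "F facet_of K2"
  shows "outward_normal K2 F = outward_normal K1 F \<or> outward_normal K2 F = - outward_normal K1 F"
proof -
  obtain C1 a1 b1 c1 where coords1: "simplex_coords K1 C1 a1 b1" and c1: "c1 \<in> C1"
    and F1: "F = simplex_coords.face K1 a1 b1 c1" using facet_coords[OF K(1) F(1)] by metis
  obtain C2 a2 b2 c2 where coords2: "simplex_coords K2 C2 a2 b2" and c2: "c2 \<in> C2"
    and F2: "F = simplex_coords.face K2 a2 b2 c2" using facet_coords[OF K(2) F(2)] by metis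
  interpret k1: simplex_coords K1 C1 a1 b1 by (rule coords1)
  interpret k2: simplex_coords K2 C2 a2 b2 by (rule coords2)
  define n1 where "n1 = outward_normal K1 F"
  define n2 where "n2 = outward_normal K2 F"
  have n: "n1 \<bullet> n1 = 1" "n2 \<bullet> n2 = 1"
    using norm_outward_normal K F by (simp_all add: n1_def n2_def dot_square_norm)
  obtain \<beta>1 where h1: "affine hull F = {x. n1 \<bullet> x = \<beta>1}"
    using k1.hull_face_normal[OF c1] F1 by (auto simp: n1_def k1.normal_def)
  obtain \<beta>2 where h2: "affine hull F = {x. n2 \<bullet> x = \<beta>2}"
    using k2.hull_face_normal[OF c2] F2 by (auto simp: n2_def k2.normal_def)
  have "\<beta>1 *\<^sub>R n1 \<in> affine hull F" unfolding h1 using n by simp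
  moreover have "\<beta>1 *\<^sub>R n1 + (n2 - (n1 \<bullet> n2) *\<^sub>R n1) \<in> affine hull F"
    unfolding h1 using n by (simp add: inner_add_right inner_diff_right)
  ultimately have "n2 \<bullet> (n2 - (n1 \<bullet> n2) *\<^sub>R n1) = 0"
    unfolding h2 by (simp add: inner_add_right)
  then have sq: "(n1 \<bullet> n2) * (n1 \<bullet> n2) = 1" using n by (simp add: inner_diff_right inner_commute)
  have "(n2 - (n1 \<bullet> n2) *\<^sub>R n1) \<bullet> (n2 - (n1 \<bullet> n2) *\<^sub>R n1) = 0"
    using n sq by (simp add: inner_diff_left inner_diff_right inner_commute)
  then have "n2 = (n1 \<bullet> n2) *\<^sub>R n1" by simp
  moreover have "n1 \<bullet> n2 = 1 \<or> n1 \<bullet> n2 = -1" using sq by (simp add: square_eq_1_iff)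
  ultimately show ?thesis unfolding n1_def n2_def by (metis scaleR_minus1_left scaleR_one)
qed

text \<open>Since the cells are closed and finite in number, only those containing a given point are met near
  it. Thus a small step out of \<open>K\<close>, from a point of \<open>\<Omega>\<close> in the relative interior of the facet, leads
  into a cell through that point. By conformity its intersection with \<open>K\<close> is a face of \<open>K\<close>, hence
  contains the whole facet.\<close>

lemma interior_facet_neighbour:
  assumes K: "K \<in> \<T>" and F: "F facet_of K" and int: "\<not> F \<subseteq> frontier \<Omega>"
  shows "\<exists>K'\<in>\<T>. K' \<noteq> K \<and> F facet_of K'"
proof -
  obtain C a b c where coords: "simplex_coords K C a b" and c: "c \<in> C"
    and Fc: "F = simplex_coords.face K a b c" using facet_coords[OF K F] by metis
  interpret simplex_coords K C a b by (rule coords)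
  define n where "n = outward_normal K F"
  have FK: "F \<subseteq> K" by (auto simp: Fc face_def)
  obtain y0 where y0: "y0 \<in> F" "y0 \<in> \<Omega>"
    using int FK K cell_Union open_domain by (auto simp: frontier_def interior_open)
  obtain y1 where y1: "a c \<bullet> y1 + b c = 0" "\<And>c'. c' \<in> C - {c} \<Longrightarrow> 0 < a c' \<bullet> y1 + b c'"
    using face_inner[OF c] by blast
  \<comment> \<open>\<open>y0\<close> may lie on the relative boundary of \<open>F\<close>; a small step towards \<open>y1\<close> leaves it but stays in \<open>\<Omega>\<close>.\<close>
  obtain \<epsilon> where \<epsilon>: "0 < \<epsilon>" "\<epsilon> \<le> 1" "y0 + \<epsilon> *\<^sub>R (y1 - y0) \<in> \<Omega>"
    using small_step[OF open_domain y0(2)] by blast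
  define y where "y = y0 + \<epsilon> *\<^sub>R (y1 - y0)"
  have conv: "v \<bullet> y + t = (1 - \<epsilon>) * (v \<bullet> y0 + t) + \<epsilon> * (v \<bullet> y1 + t)" for v t
    by (simp add: y_def inner_add_right inner_diff_right algebra_simps)
  have y: "y \<in> \<Omega>" "a c \<bullet> y + b c = 0" "\<And>c'. c' \<in> C - {c} \<Longrightarrow> 0 < a c' \<bullet> y + b c'"
  proof -
    show "y \<in> \<Omega>" using \<epsilon> by (simp add: y_def)
    show "a c \<bullet> y + b c = 0" unfolding conv using y0(1) y1(1) by (simp add: Fc face_def)
    fix c' assume c': "c' \<in> C - {c}"
    have "0 \<le> (1 - \<epsilon>) * (a c' \<bullet> y0 + b c')" using y0(1) \<epsilon> c' by (simp add: Fc face_def in_simplex)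
    moreover have "0 < \<epsilon> * (a c' \<bullet> y1 + b c')" using y1(2)[OF c'] \<epsilon> by simp
    ultimately show "0 < a c' \<bullet> y + b c'" unfolding conv by linarith
  qed
  let ?U = "\<Omega> \<inter> - \<Union>{K'\<in>\<T>. y \<notin> K'}"
  have "closed (\<Union>{K'\<in>\<T>. y \<notin> K'})"
    using finite_mesh compact_cell by (intro closed_Union) (auto simp: compact_imp_closed)
  then have "open ?U" using open_domain by (simp add: open_Int open_Compl)
  moreover have "y \<in> ?U" using y by auto
  ultimately obtain \<epsilon>' where \<epsilon>': "0 < \<epsilon>'" "y + \<epsilon>' *\<^sub>R n \<in> ?U" using small_step by blast
  let ?z = "y + \<epsilon>' *\<^sub>R n"
  have "?z \<in> \<Union>\<T>" using \<epsilon>'(2) cell_Union closure_subset by blast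
  then obtain K' where K': "K' \<in> \<T>" "?z \<in> K'" by blast
  then have yK': "y \<in> K'" using \<epsilon>'(2) by blast
  have "a c \<bullet> ?z + b c = - (\<epsilon>' * norm (a c))"
    using y(2) normal_dot[OF c, folded n_def[unfolded Fc normal_def[symmetric]]]
    by (simp add: inner_add_right)
  then have "a c \<bullet> ?z + b c < 0" using \<epsilon>'(1) normal_nonzero[OF c] by simp
  then have "?z \<notin> K" using c unfolding in_simplex by force
  then have "K' \<noteq> K" using K' by blast
  have "y \<in> K" unfolding in_simplex using y by (metis DiffI empty_iff insert_iff less_imp_le order_refl)
  then have sub: "F \<subseteq> K \<inter> K'"
    using face_subset_face_of[OF c cell_Int[OF K K'(1)] _ y(3)] yK' Fc by blast
  have "F face_of K" using F by (simp add: facet_of_def)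
  then have "F face_of (K \<inter> K')" using sub by (rule face_of_subset) blast
  then have "F face_of K'" using cell_Int'[OF K K'(1)] by (rule face_of_trans)
  then have "F facet_of K'"
    using F aff_dim_simplex[OF simplex[OF K]] aff_dim_simplex[OF simplex[OF K'(1)]] by (simp add: facet_of_def)
  then show ?thesis using K' \<open>K' \<noteq> K\<close> by blast
qed

text \<open>The cells at an interior facet are exactly two, on opposite sides: neighbours exist, normals of
  the same facet agree up to sign, and each sign occurs only once.\<close>

lemma interior_facet_normals:
  assumes F: "F \<in> mesh_faces \<T>" and int: "\<not> F \<subseteq> frontier \<Omega>"
  shows "(\<Sum>K | K \<in> \<T> \<and> F facet_of K. outward_normal K F) = 0"
proof -
  obtain K where K: "K \<in> \<T>" "F facet_of K" using F by (auto simp: mesh_faces_def)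
  obtain K' where K': "K' \<in> \<T>" "K' \<noteq> K" "F facet_of K'" using interior_facet_neighbour[OF K int] by blast
  have op: "outward_normal K' F = - outward_normal K F"
    using normals_parallel[OF K(1) K'(1) K(2) K'(3)] same_normal_same_cell[OF K(1) K'(1) K(2) K'(3)] K'(2) by metis
  have "K'' = K \<or> K'' = K'" if "K'' \<in> \<T>" "F facet_of K''" for K''
    using normals_parallel[OF K(1) that(1) K(2) that(2)] same_normal_same_cell[OF K(1) that(1) K(2) that(2)]
      same_normal_same_cell[OF K'(1) that(1) K'(3) that(2)] op by metis
  then have "{K. K \<in> \<T> \<and> F facet_of K} = {K, K'}" using K K' by blast
  then show ?thesis using K' op by simp
qed

end

section \<open>The bilinear form of one time step\<close>

definition partial :: "(real^'n \<Rightarrow> real) \<Rightarrow> 'n \<Rightarrow> real^'n \<Rightarrow> real" where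
  "partial p i x = frechet_derivative p (at x) (axis i 1)"

lemma polys_deriv: "p \<in> polys k \<Longrightarrow> (p has_derivative frechet_derivative p (at x)) (at x)"
  by (rule real_polynomial_C1(1)[OF polys_real_polynomial])

lemma continuous_partial: "p \<in> polys k \<Longrightarrow> continuous_on UNIV (partial p i)"
  unfolding partial_def[abs_def] by (rule real_polynomial_C1(2)[OF polys_real_polynomial])

lemma continuous_polys: "p \<in> polys k \<Longrightarrow> continuous_on UNIV p"
  by (rule real_polynomial_continuous[OF polys_real_polynomial])

lemma partial_lincomb:
  assumes "p \<in> polys k" "q \<in> polys k"
  shows "partial (\<lambda>x. c * p x + q x) i x = c * partial p i x + partial q i x"
proof -
  have "((\<lambda>x. c * p x + q x) has_derivative
      (\<lambda>e. c * frechet_derivative p (at x) e + frechet_derivative q (at x) e)) (at x)"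
    using polys_deriv[OF assms(1)] polys_deriv[OF assms(2)] by (auto intro!: derivative_eq_intros)
  from frechet_derivative_at[OF this] show ?thesis by (simp add: partial_def fun_eq_iff)
qed

lemma partial_zero: "partial (\<lambda>x. 0) i x = 0"
  by (simp add: partial_def frechet_derivative_const)

lemma polys_AE_zero:
  assumes p: "p \<in> polys k" and K: "interior K \<noteq> {}" "K \<in> sets lebesgue" and ae: "AE x in lebesgue_on K. p x = 0"
  shows "p x = 0"
proof -
  have cont: "continuous_on UNIV p" by (rule continuous_polys[OF p])
  have "open (p -` (- {0}))" using cont by (intro open_vimage) auto
  then have op: "open (interior K \<inter> {x. p x \<noteq> 0})" by (simp add: vimage_def open_Int)
  have "AE x in lebesgue. x \<in> K \<longrightarrow> p x = 0" using ae K(2) by (subst (asm) AE_restrict_space_iff) auto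
  then have "AE x in lebesgue. x \<notin> interior K \<inter> {x. p x \<noteq> 0}"
    by (rule eventually_mono) (use interior_subset in blast)
  then have "interior K \<inter> {x. p x \<noteq> 0} \<in> null_sets lebesgue"
    using op by (subst AE_iff_null_sets) auto
  then have "negligible (interior K \<inter> {x. p x \<noteq> 0})" by (simp add: negligible_iff_null_sets)
  then have "interior K \<inter> {x. p x \<noteq> 0} = {}" using open_not_negligible[OF op] by blast
  then have "\<And>x. x \<in> interior K \<Longrightarrow> p x = 0" by blast
  moreover obtain y where "y \<in> interior K" using K by blast
  ultimately show ?thesis using real_polynomial_zero[OF polys_real_polynomial[OF p] open_interior] by blast
qed

lemma polys_0_const:
  assumes "p \<in> polys 0"
  shows "\<exists>c. p = (\<lambda>x. c)"
  using assms
proof (induction rule: polys_induct)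
  case (lincomb c p q)
  then obtain r s where "p = (\<lambda>x. r)" "q = (\<lambda>x. s)" by blast
  then show ?case by (intro exI[of _ "c * r + s"]) simp
next
  case (monom m)
  then have "m = (\<lambda>_. 0)" by (auto simp: exponents_def simp flip: of_nat_sum)
  then show ?case by (intro exI[of _ 1]) (simp add: monom_fun_def fun_eq_iff)
qed blast

text \<open>The unknowns of a time step, and likewise the test functions, are families of polynomials: one
  for each cell, for each component of the flux on a cell, and for each face.\<close>

datatype ('a, 'i) dof = Cell 'a | Flux 'a 'i | Face 'a

type_synonym 'n data = "((real^'n) set, 'n) dof \<Rightarrow> real^'n \<Rightarrow> real"

lemma (in hdg_mesh) integration_by_parts:
  assumes K: "K \<in> \<T>" and u: "u \<in> polys l" and v: "\<And>i. v i \<in> polys l"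
  shows "(\<integral>x. (\<Sum>i\<in>UNIV. u x * partial (v i) i x + v i x * partial u i x) \<partial>lebesgue_on K)
    = (\<Sum>F | F facet_of K. \<integral>x. u x * (\<Sum>i\<in>UNIV. v i x * outward_normal K F $ i) \<partial>face_measure F)"
proof -
  note cont [continuous_intros] = continuous_polys[OF u] continuous_polys[OF v] continuous_partial[OF u] continuous_partial[OF v]
  have *: "(\<integral>x. u x * partial (v i) i x + v i x * partial u i x \<partial>lebesgue_on K)
    = (\<Sum>F | F facet_of K. \<integral>x. u x * v i x * outward_normal K F $ i \<partial>face_measure F)" for i
  proof -
    let ?d = "\<lambda>x e. u x * frechet_derivative (v i) (at x) e + frechet_derivative u (at x) e * v i x"
    have d: "((\<lambda>x. u x * v i x) has_derivative ?d x) (at x)" for x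
      by (intro has_derivative_mult polys_deriv[OF u] polys_deriv[OF v])
    have "continuous_on UNIV (\<lambda>x. ?d x e)" for e
      by (intro continuous_intros real_polynomial_C1(2) polys_real_polynomial[OF u] polys_real_polynomial[OF v])
    from divergence_cell[OF K d this, of "axis i 1"] show ?thesis
      by (simp add: partial_def inner_axis' mult.commute[of "v i _"])
  qed
  have "(\<integral>x. (\<Sum>i\<in>UNIV. u x * partial (v i) i x + v i x * partial u i x) \<partial>lebesgue_on K)
    = (\<Sum>i\<in>UNIV. \<integral>x. u x * partial (v i) i x + v i x * partial u i x \<partial>lebesgue_on K)"
    by (intro Bochner_Integration.integral_sum integrable_cell K continuous_intros)
  also have "\<dots> = (\<Sum>F | F facet_of K. \<Sum>i\<in>UNIV. \<integral>x. u x * v i x * outward_normal K F $ i \<partial>face_measure F)"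
    unfolding * by (rule sum.swap)
  also have "\<dots> = (\<Sum>F | F facet_of K. \<integral>x. u x * (\<Sum>i\<in>UNIV. v i x * outward_normal K F $ i) \<partial>face_measure F)"
  proof (rule sum.cong[OF refl])
    fix F assume "F \<in> {F. F facet_of K}"
    then have F: "F \<in> mesh_faces \<T>" using K by (auto simp: mesh_faces_def)
    have "(\<Sum>i\<in>UNIV. \<integral>x. u x * v i x * outward_normal K F $ i \<partial>face_measure F)
      = (\<integral>x. (\<Sum>i\<in>UNIV. u x * v i x * outward_normal K F $ i) \<partial>face_measure F)"
      by (intro Bochner_Integration.integral_sum[symmetric] integrable_face F continuous_intros)
    then show "(\<Sum>i\<in>UNIV. \<integral>x. u x * v i x * outward_normal K F $ i \<partial>face_measure F)
      = (\<integral>x. u x * (\<Sum>i\<in>UNIV. v i x * outward_normal K F $ i) \<partial>face_measure F)"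
      by (simp add: sum_distrib_left mult.assoc)
  qed
  finally show ?thesis .
qed

locale hdg_scheme = hdg_mesh \<Omega> \<T> for \<Omega> :: "(real^'n) set" and \<T> +
  fixes \<tau> :: "(real^'n) set \<Rightarrow> (real^'n) set \<Rightarrow> real" and k :: nat
  assumes tau: "\<And>K F. K \<in> \<T> \<Longrightarrow> F facet_of K \<Longrightarrow> 0 \<le> \<tau> K F"
begin

definition dofs :: "((real^'n) set, 'n) dof set" where
  "dofs = Cell ` \<T> \<union> (\<lambda>(K, i). Flux K i) ` (\<T> \<times> UNIV) \<union> Face ` mesh_faces \<T>"

definition discrete :: "'n data set" where
  "discrete = {Y. \<forall>\<kappa>\<in>dofs. Y \<kappa> \<in> polys (int k)}"

text \<open>A polynomial that vanishes on a cell is zero, but on a face only its values on the face count.\<close>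

definition null_data :: "'n data \<Rightarrow> bool" where
  "null_data Y \<longleftrightarrow> (\<forall>K\<in>\<T>. (\<forall>x. Y (Cell K) x = 0) \<and> (\<forall>i x. Y (Flux K i) x = 0)) \<and>
     (\<forall>F\<in>mesh_faces \<T>. AE x in face_measure F. Y (Face F) x = 0)"

lemma finite_dofs: "finite dofs"
  unfolding dofs_def using finite_mesh finite_mesh_faces by simp

lemma discreteD:
  assumes "Y \<in> discrete"
  shows "K \<in> \<T> \<Longrightarrow> Y (Cell K) \<in> polys (int k)" "K \<in> \<T> \<Longrightarrow> Y (Flux K i) \<in> polys (int k)"
    "F \<in> mesh_faces \<T> \<Longrightarrow> Y (Face F) \<in> polys (int k)"
  using assms by (auto simp: discrete_def dofs_def image_iff)

lemma discreteI:
  assumes "\<And>K. K \<in> \<T> \<Longrightarrow> Y (Cell K) \<in> polys (int k)" "\<And>K i. K \<in> \<T> \<Longrightarrow> Y (Flux K i) \<in> polys (int k)"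
    "\<And>F. F \<in> mesh_faces \<T> \<Longrightarrow> Y (Face F) \<in> polys (int k)"
  shows "Y \<in> discrete"
  using assms by (auto simp: discrete_def dofs_def)

lemma mesh_facesI: "K \<in> \<T> \<Longrightarrow> F facet_of K \<Longrightarrow> F \<in> mesh_faces \<T>"
  by (auto simp: mesh_faces_def)

definition normal_flux :: "'n data \<Rightarrow> (real^'n) set \<Rightarrow> (real^'n) set \<Rightarrow> real^'n \<Rightarrow> real" where
  "normal_flux Y K F x = (\<Sum>i\<in>UNIV. Y (Flux K i) x * outward_normal K F $ i)"

definition numerical_flux :: "'n data \<Rightarrow> (real^'n) set \<Rightarrow> (real^'n) set \<Rightarrow> real^'n \<Rightarrow> real" where
  "numerical_flux Y K F x = normal_flux Y K F x + \<tau> K F * (Y (Cell K) x - Y (Face F) x)"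

text \<open>The new values enter the first two equations through averages, which accounts for the factors
  \<open>1/2\<close>; \<open>\<beta>\<close> is the weight of the newest increment in the memory term. The transmission condition, on
  interior faces, is taken with the factor \<open>-1/2\<close>, so that for \<open>Y = X\<close> the terms with \<open>X (Face F)\<close>
  complete the square in the energy identity; on boundary faces the Dirichlet condition takes its place.\<close>

definition cell_form :: "real \<Rightarrow> 'n data \<Rightarrow> 'n data \<Rightarrow> (real^'n) set \<Rightarrow> real^'n \<Rightarrow> real" where
  "cell_form \<beta> X Y K x = \<beta> * X (Cell K) x * Y (Cell K) x + 1/2 * (\<Sum>i\<in>UNIV. X (Flux K i) x * Y (Flux K i) x
     - X (Cell K) x * partial (Y (Flux K i)) i x - X (Flux K i) x * partial (Y (Cell K)) i x)"

definition trace_form :: "'n data \<Rightarrow> 'n data \<Rightarrow> (real^'n) set \<Rightarrow> (real^'n) set \<Rightarrow> real^'n \<Rightarrow> real" where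
  "trace_form X Y K F x = 1/2 * (X (Face F) x * normal_flux Y K F x + numerical_flux X K F x * Y (Cell K) x)"

definition skeleton_form :: "'n data \<Rightarrow> 'n data \<Rightarrow> (real^'n) set \<Rightarrow> (real^'n) set \<Rightarrow> real^'n \<Rightarrow> real" where
  "skeleton_form X Y K F x = (if F \<subseteq> frontier \<Omega> then X (Face F) x * Y (Face F) x
     else - 1/2 * (numerical_flux X K F x * Y (Face F) x))"

definition form :: "real \<Rightarrow> 'n data \<Rightarrow> 'n data \<Rightarrow> real" where
  "form \<beta> X Y = (\<Sum>K\<in>\<T>. (\<integral>x. cell_form \<beta> X Y K x \<partial>lebesgue_on K) +
     (\<Sum>F | F facet_of K. \<integral>x. trace_form X Y K F x + skeleton_form X Y K F x \<partial>face_measure F))"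

lemma
  assumes X: "X \<in> discrete" and K: "K \<in> \<T>"
  shows continuous_cell: "continuous_on UNIV (X (Cell K))"
    and continuous_flux: "continuous_on UNIV (X (Flux K i))"
    and continuous_partial_cell: "continuous_on UNIV (partial (X (Cell K)) i)"
    and continuous_partial_flux: "continuous_on UNIV (partial (X (Flux K i)) i)"
    and continuous_normal_flux: "continuous_on UNIV (normal_flux X K F)"
proof -
  show "continuous_on UNIV (X (Cell K))" and *: "continuous_on UNIV (X (Flux K i))" for i
    by (rule continuous_polys[OF discreteD(1)[OF X K]] continuous_polys[OF discreteD(2)[OF X K]])+
  show "continuous_on UNIV (partial (X (Cell K)) i)" "continuous_on UNIV (partial (X (Flux K i)) i)"
    by (rule continuous_partial[OF discreteD(1)[OF X K]] continuous_partial[OF discreteD(2)[OF X K]])+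
  show "continuous_on UNIV (normal_flux X K F)"
    unfolding normal_flux_def[abs_def] by (intro continuous_intros *)
qed

lemma continuous_face: "X \<in> discrete \<Longrightarrow> F \<in> mesh_faces \<T> \<Longrightarrow> continuous_on UNIV (X (Face F))"
  using continuous_polys discreteD(3) by blast

lemmas continuous_data = continuous_cell continuous_flux continuous_partial_cell
  continuous_partial_flux continuous_normal_flux continuous_face

lemma continuous_numerical_flux:
  assumes X: "X \<in> discrete" and K: "K \<in> \<T>" and F: "F \<in> mesh_faces \<T>"
  shows "continuous_on UNIV (numerical_flux X K F)"
  unfolding numerical_flux_def[abs_def] by (intro continuous_intros continuous_data[OF X] K F)

lemma
  assumes X: "X \<in> discrete" and Y: "Y \<in> discrete" and K: "K \<in> \<T>"
  shows integrable_cell_form: "integrable (lebesgue_on K) (cell_form \<beta> X Y K)"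
    and integrable_trace_form: "F \<in> mesh_faces \<T> \<Longrightarrow> integrable (face_measure F) (trace_form X Y K F)"
    and integrable_skeleton_form: "F \<in> mesh_faces \<T> \<Longrightarrow> integrable (face_measure F) (skeleton_form X Y K F)"
proof -
  note cont = continuous_intros continuous_data[OF X] continuous_data[OF Y] continuous_numerical_flux[OF X]
  show "integrable (lebesgue_on K) (cell_form \<beta> X Y K)"
    unfolding cell_form_def[abs_def] by (intro integrable_cell cont K)
  assume F: "F \<in> mesh_faces \<T>"
  show "integrable (face_measure F) (trace_form X Y K F)"
    unfolding trace_form_def[abs_def] by (intro integrable_face cont K F)
  show "integrable (face_measure F) (skeleton_form X Y K F)"
  proof (cases "F \<subseteq> frontier \<Omega>")
    case True
    then show ?thesis unfolding skeleton_form_def[abs_def]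
      by (simp only: if_True) (intro integrable_face cont K F)
  next
    case False
    then show ?thesis unfolding skeleton_form_def[abs_def]
      by (simp only: if_False) (intro integrable_face cont K F)
  qed
qed

definition lincomb :: "real \<Rightarrow> 'n data \<Rightarrow> 'n data \<Rightarrow> 'n data" where
  "lincomb c Y Z = (\<lambda>\<kappa> x. c * Y \<kappa> x + Z \<kappa> x)"

lemma lincomb_discrete: "Y \<in> discrete \<Longrightarrow> Z \<in> discrete \<Longrightarrow> lincomb c Y Z \<in> discrete"
  by (auto simp: discrete_def lincomb_def intro!: polys_lincomb)

lemma lincomb_apply: "lincomb c Y Z \<kappa> x = c * Y \<kappa> x + Z \<kappa> x"
  by (simp add: lincomb_def)

lemma partial_lincomb_data:
  assumes "Y \<in> discrete" "Z \<in> discrete" "\<kappa> \<in> dofs"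
  shows "partial (lincomb c Y Z \<kappa>) i x = c * partial (Y \<kappa>) i x + partial (Z \<kappa>) i x"
  using assms unfolding lincomb_def discrete_def by (intro partial_lincomb) auto

lemma normal_flux_lincomb: "normal_flux (lincomb c Y Z) K F x = c * normal_flux Y K F x + normal_flux Z K F x"
  unfolding normal_flux_def lincomb_apply sum_distrib_left sum.distrib[symmetric]
  by (intro sum.cong refl) (simp add: algebra_simps)

lemma numerical_flux_lincomb:
  "numerical_flux (lincomb c Y Z) K F x = c * numerical_flux Y K F x + numerical_flux Z K F x"
  by (simp add: numerical_flux_def normal_flux_lincomb lincomb_apply algebra_simps)

lemma dofsI: "K \<in> \<T> \<Longrightarrow> Cell K \<in> dofs" "K \<in> \<T> \<Longrightarrow> Flux K i \<in> dofs" "F \<in> mesh_faces \<T> \<Longrightarrow> Face F \<in> dofs"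
  by (auto simp: dofs_def)

lemma cell_form_lincomb_right:
  assumes "Y \<in> discrete" "Z \<in> discrete" "K \<in> \<T>"
  shows "cell_form \<beta> X (lincomb c Y Z) K x = c * cell_form \<beta> X Y K x + cell_form \<beta> X Z K x"
proof -
  let ?s = "\<lambda>Y i. X (Flux K i) x * Y (Flux K i) x - X (Cell K) x * partial (Y (Flux K i)) i x
    - X (Flux K i) x * partial (Y (Cell K)) i x"
  have "(\<Sum>i\<in>UNIV. ?s (lincomb c Y Z) i) = c * (\<Sum>i\<in>UNIV. ?s Y i) + (\<Sum>i\<in>UNIV. ?s Z i)"
    unfolding sum_distrib_left sum.distrib[symmetric] partial_lincomb_data[OF assms(1,2) dofsI(1)[OF assms(3)]]
      partial_lincomb_data[OF assms(1,2) dofsI(2)[OF assms(3)]] lincomb_apply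
    by (intro sum.cong refl) (simp add: algebra_simps)
  then show ?thesis unfolding cell_form_def by (simp add: lincomb_apply algebra_simps)
qed

lemma cell_form_lincomb_left:
  "cell_form \<beta> (lincomb c Y Z) X K x = c * cell_form \<beta> Y X K x + cell_form \<beta> Z X K x"
proof -
  let ?s = "\<lambda>Y i. Y (Flux K i) x * X (Flux K i) x - Y (Cell K) x * partial (X (Flux K i)) i x
    - Y (Flux K i) x * partial (X (Cell K)) i x"
  have "(\<Sum>i\<in>UNIV. ?s (lincomb c Y Z) i) = c * (\<Sum>i\<in>UNIV. ?s Y i) + (\<Sum>i\<in>UNIV. ?s Z i)"
    unfolding sum_distrib_left sum.distrib[symmetric] lincomb_apply
    by (intro sum.cong refl) (simp add: algebra_simps)
  then show ?thesis unfolding cell_form_def by (simp add: lincomb_apply algebra_simps)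
qed

lemma face_forms_lincomb_right:
  "trace_form X (lincomb c Y Z) K F x = c * trace_form X Y K F x + trace_form X Z K F x"
  "skeleton_form X (lincomb c Y Z) K F x = c * skeleton_form X Y K F x + skeleton_form X Z K F x"
  by (simp_all add: trace_form_def skeleton_form_def normal_flux_lincomb lincomb_apply algebra_simps)

lemma face_forms_lincomb_left:
  "trace_form (lincomb c Y Z) X K F x = c * trace_form Y X K F x + trace_form Z X K F x"
  "skeleton_form (lincomb c Y Z) X K F x = c * skeleton_form Y X K F x + skeleton_form Z X K F x"
  by (simp_all add: trace_form_def skeleton_form_def numerical_flux_lincomb lincomb_apply algebra_simps)

lemma form_lincomb:
  assumes XYZ: "X \<in> discrete" "Y \<in> discrete" "Z \<in> discrete"
  shows "form \<beta> X (lincomb c Y Z) = c * form \<beta> X Y + form \<beta> X Z"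
    and "form \<beta> (lincomb c Y Z) X = c * form \<beta> Y X + form \<beta> Z X"
proof -
  note int = integrable_cell_form integrable_trace_form integrable_skeleton_form XYZ mesh_facesI
  have lin: "(\<integral>x. c * f x + g x \<partial>M) = c * (\<integral>x. f x \<partial>M) + (\<integral>x. g x \<partial>M)"
    if "integrable M f" "integrable M g" for f g :: "real^'n \<Rightarrow> real" and M using that by simp
  have lin2: "(\<integral>x. (c * f x + g x) + (c * f' x + g' x) \<partial>M) = c * (\<integral>x. f x + f' x \<partial>M) + (\<integral>x. g x + g' x \<partial>M)"
    if "integrable M f" "integrable M g" "integrable M f'" "integrable M g'"
    for f g f' g' :: "real^'n \<Rightarrow> real" and M using that by (simp add: algebra_simps)
  have "(\<integral>x. cell_form \<beta> X (lincomb c Y Z) K x \<partial>lebesgue_on K) +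
      (\<Sum>F | F facet_of K. \<integral>x. trace_form X (lincomb c Y Z) K F x + skeleton_form X (lincomb c Y Z) K F x \<partial>face_measure F)
    = c * ((\<integral>x. cell_form \<beta> X Y K x \<partial>lebesgue_on K) +
      (\<Sum>F | F facet_of K. \<integral>x. trace_form X Y K F x + skeleton_form X Y K F x \<partial>face_measure F)) +
      ((\<integral>x. cell_form \<beta> X Z K x \<partial>lebesgue_on K) +
      (\<Sum>F | F facet_of K. \<integral>x. trace_form X Z K F x + skeleton_form X Z K F x \<partial>face_measure F))"
    if K: "K \<in> \<T>" for K
  proof -
    have "(\<Sum>F | F facet_of K. \<integral>x. trace_form X (lincomb c Y Z) K F x + skeleton_form X (lincomb c Y Z) K F x \<partial>face_measure F)
      = (\<Sum>F | F facet_of K. c * (\<integral>x. trace_form X Y K F x + skeleton_form X Y K F x \<partial>face_measure F)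
        + (\<integral>x. trace_form X Z K F x + skeleton_form X Z K F x \<partial>face_measure F))"
      unfolding face_forms_lincomb_right by (intro sum.cong refl lin2 int) (use K in auto)
    moreover have "(\<integral>x. cell_form \<beta> X (lincomb c Y Z) K x \<partial>lebesgue_on K)
      = c * (\<integral>x. cell_form \<beta> X Y K x \<partial>lebesgue_on K) + (\<integral>x. cell_form \<beta> X Z K x \<partial>lebesgue_on K)"
      unfolding cell_form_lincomb_right[OF XYZ(2,3) K] by (intro lin int K)
    ultimately show ?thesis by (simp add: sum.distrib sum_distrib_left distrib_left)
  qed
  then show "form \<beta> X (lincomb c Y Z) = c * form \<beta> X Y + form \<beta> X Z"
    unfolding form_def sum_distrib_left sum.distrib[symmetric] by (intro sum.cong refl)
  have "(\<integral>x. cell_form \<beta> (lincomb c Y Z) X K x \<partial>lebesgue_on K) +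
      (\<Sum>F | F facet_of K. \<integral>x. trace_form (lincomb c Y Z) X K F x + skeleton_form (lincomb c Y Z) X K F x \<partial>face_measure F)
    = c * ((\<integral>x. cell_form \<beta> Y X K x \<partial>lebesgue_on K) +
      (\<Sum>F | F facet_of K. \<integral>x. trace_form Y X K F x + skeleton_form Y X K F x \<partial>face_measure F)) +
      ((\<integral>x. cell_form \<beta> Z X K x \<partial>lebesgue_on K) +
      (\<Sum>F | F facet_of K. \<integral>x. trace_form Z X K F x + skeleton_form Z X K F x \<partial>face_measure F))"
    if K: "K \<in> \<T>" for K
  proof -
    have "(\<Sum>F | F facet_of K. \<integral>x. trace_form (lincomb c Y Z) X K F x + skeleton_form (lincomb c Y Z) X K F x \<partial>face_measure F)
      = (\<Sum>F | F facet_of K. c * (\<integral>x. trace_form Y X K F x + skeleton_form Y X K F x \<partial>face_measure F)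
        + (\<integral>x. trace_form Z X K F x + skeleton_form Z X K F x \<partial>face_measure F))"
      unfolding face_forms_lincomb_left by (intro sum.cong refl lin2 int) (use K in auto)
    moreover have "(\<integral>x. cell_form \<beta> (lincomb c Y Z) X K x \<partial>lebesgue_on K)
      = c * (\<integral>x. cell_form \<beta> Y X K x \<partial>lebesgue_on K) + (\<integral>x. cell_form \<beta> Z X K x \<partial>lebesgue_on K)"
      unfolding cell_form_lincomb_left by (intro lin int K)
    ultimately show ?thesis by (simp add: sum.distrib sum_distrib_left distrib_left)
  qed
  then show "form \<beta> (lincomb c Y Z) X = c * form \<beta> Y X + form \<beta> Z X"
    unfolding form_def sum_distrib_left sum.distrib[symmetric] by (intro sum.cong refl)
qed

lemma form_null:
  assumes N: "null_data Y"
  shows "form \<beta> X Y = 0" "form \<beta> Y X = 0"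
proof -
  have z: "Y (Cell K) = (\<lambda>x. 0)" "Y (Flux K i) = (\<lambda>x. 0)" if "K \<in> \<T>" for K i
    using N that by (auto simp: null_data_def fun_eq_iff)
  have f: "AE x in face_measure F. Y (Face F) x = 0" if "K \<in> \<T>" "F facet_of K" for K F
    using N mesh_facesI[OF that] by (auto simp: null_data_def)
  have c: "cell_form \<beta> X Y K = (\<lambda>x. 0)" "cell_form \<beta> Y X K = (\<lambda>x. 0)" if "K \<in> \<T>" for K
    by (simp_all add: cell_form_def fun_eq_iff z[OF that] partial_zero)
  have "(\<integral>x. trace_form X Y K F x + skeleton_form X Y K F x \<partial>face_measure F) = 0"
    "(\<integral>x. trace_form Y X K F x + skeleton_form Y X K F x \<partial>face_measure F) = 0" if "K \<in> \<T>" "F facet_of K" for K F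
    using f[OF that]
    by (intro integral_eq_zero_AE; elim eventually_mono;
        simp add: trace_form_def skeleton_form_def normal_flux_def numerical_flux_def z[OF that(1)])+
  then show "form \<beta> X Y = 0" "form \<beta> Y X = 0"
    unfolding form_def by (simp_all add: c)
qed

end

section \<open>Uniqueness\<close>

context simplex_coords
begin

lemma coord_sum_face:
  assumes "c \<in> C" "x \<in> face c"
  shows "(\<Sum>c'\<in>C - {c}. a c' \<bullet> x + b c') = 1" "(\<Sum>c'\<in>C - {c}. (a c' \<bullet> x + b c') *\<^sub>R c') = x"
  using coord_sum[of x] coord_rep[of x] sum.remove[OF finite_C assms(1), of "\<lambda>c. a c \<bullet> x + b c"]
    sum.remove[OF finite_C assms(1), of "\<lambda>c. (a c \<bullet> x + b c) *\<^sub>R c"] assms(2) by (simp_all add: face_def)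

text \<open>On a facet the remaining coordinates have sum 1, so every term can be given one of them as a
  factor without raising the degree.\<close>

lemma polys_on_face:
  assumes c: "c \<in> C" and p: "p \<in> polys (l + 1)" and l: "0 \<le> l"
  shows "\<exists>t. (\<forall>c'. t c' \<in> polys l) \<and> (\<forall>x\<in>face c. p x = (\<Sum>c'\<in>C - {c}. (a c' \<bullet> x + b c') * t c' x))"
proof -
  obtain p0 s where ps: "p0 \<in> polys l" "\<And>i. s i \<in> polys l" "p = (\<lambda>x. p0 x + (\<Sum>i\<in>UNIV. x $ i * s i x))"
    using polys_split[OF p l] by blast
  define t where "t c' x = p0 x + (\<Sum>i\<in>UNIV. c' $ i * s i x)" for c' x
  have "t c' \<in> polys l" for c'
    unfolding t_def[abs_def] by (intro polys_add polys_sum polys_cmult ps)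
  moreover have "p x = (\<Sum>c'\<in>C - {c}. (a c' \<bullet> x + b c') * t c' x)" if x: "x \<in> face c" for x
  proof -
    have xi: "x $ i = (\<Sum>c'\<in>C - {c}. (a c' \<bullet> x + b c') * c' $ i)" for i
      using arg_cong[OF coord_sum_face(2)[OF c x], of "\<lambda>v. v $ i"] by simp
    have "p x = (\<Sum>c'\<in>C - {c}. a c' \<bullet> x + b c') * p0 x
        + (\<Sum>i\<in>UNIV. (\<Sum>c'\<in>C - {c}. (a c' \<bullet> x + b c') * c' $ i) * s i x)"
      unfolding coord_sum_face(1)[OF c x] xi[symmetric] by (simp add: ps(3))
    also have "(\<Sum>i\<in>UNIV. (\<Sum>c'\<in>C - {c}. (a c' \<bullet> x + b c') * c' $ i) * s i x)
      = (\<Sum>c'\<in>C - {c}. (a c' \<bullet> x + b c') * (\<Sum>i\<in>UNIV. c' $ i * s i x))"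
      unfolding sum_distrib_right sum_distrib_left by (subst sum.swap) (simp add: mult.assoc)
    finally have "p x = (\<Sum>c'\<in>C - {c}. (a c' \<bullet> x + b c') * p0 x)
      + (\<Sum>c'\<in>C - {c}. (a c' \<bullet> x + b c') * (\<Sum>i\<in>UNIV. c' $ i * s i x))"
      unfolding sum_distrib_right .
    then show ?thesis unfolding t_def distrib_left sum.distrib .
  qed
  ultimately show ?thesis by blast
qed

lemma edge_normal:
  assumes c: "c \<in> C" "c' \<in> C" "c' \<noteq> c" and c'': "c'' \<in> C"
  shows "(c - c') \<bullet> normal c'' = (if c'' = c then - 1 / norm (a c) else if c'' = c' then 1 / norm (a c') else 0)"
proof -
  have "a c'' \<bullet> (c - c') = (if c'' = c then 1 else if c'' = c' then - 1 else 0)"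
    using coord_vertex[OF c'' c(1)] coord_vertex[OF c'' c(2)] c(3) by (auto simp: inner_diff_right)
  then show ?thesis by (simp add: normal_eq[OF c''] inner_commute[of "c - c'"])
qed

text \<open>The field \<open>\<lambda> t (c - c')\<close>, with \<open>\<lambda>\<close> the coordinate of the vertex \<open>c'\<close>, has a normal component on the
  facet opposite to \<open>c\<close> only: on the one opposite to \<open>c'\<close> the factor \<open>\<lambda>\<close> vanishes, and the other facets
  contain the edge from \<open>c'\<close> to \<open>c\<close>. By \<open>polys_on_face\<close> the functions \<open>\<lambda> t\<close> span all polynomials of
  degree at most \<open>l + 1\<close> on the facet, among them the trace itself.\<close>

lemma traces_zero:
  assumes l: "0 \<le> l" and m: "\<And>c. c \<in> C \<Longrightarrow> m (face c) \<in> polys (l + 1)"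
    and orth: "\<And>r. (\<And>i. r i \<in> polys (l + 1)) \<Longrightarrow>
      (\<Sum>c\<in>C. \<integral>x. m (face c) x * (\<Sum>i\<in>UNIV. r i x * normal c $ i) \<partial>face_measure (face c)) = 0"
    and c: "c \<in> C"
  shows "AE x in face_measure (face c). m (face c) x = 0"
proof -
  let ?M = "face_measure (face c)" and ?p = "m (face c)"
  have cont: "continuous_on UNIV ?p" by (rule continuous_polys[OF m[OF c]])
  have *: "(\<integral>x. ?p x * ((a c' \<bullet> x + b c') * t x) \<partial>?M) = 0" if c': "c' \<in> C - {c}" and t: "t \<in> polys l" for c' t
  proof -
    define T where "T x = (a c' \<bullet> x + b c') * t x" for x
    define r where "r i x = (c - c') $ i * T x" for i x
    have r: "r i \<in> polys (l + 1)" for i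
      unfolding r_def[abs_def] T_def by (intro polys_cmult polys_affine_mult t)
    have rn: "(\<Sum>i\<in>UNIV. r i x * normal c'' $ i) = ((c - c') \<bullet> normal c'') * T x" for x c''
      unfolding r_def inner_vec_def sum_distrib_right by (intro sum.cong refl) (simp add: mult_ac)
    have "(\<integral>x. m (face c'') x * (\<Sum>i\<in>UNIV. r i x * normal c'' $ i) \<partial>face_measure (face c'')) = 0"
      if c'': "c'' \<in> C - {c}" for c''
    proof -
      have "m (face c'') x * (\<Sum>i\<in>UNIV. r i x * normal c'' $ i) = 0" if "x \<in> face c''" for x
        using that c' c'' c edge_normal[of c c' c''] unfolding rn by (auto simp: face_def T_def)
      then show ?thesis
        using space_face_measure[of c''] c'' by (intro integral_eq_zero_AE AE_I2) auto
    qed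
    then have "(\<integral>x. ?p x * (\<Sum>i\<in>UNIV. r i x * normal c $ i) \<partial>?M) = 0"
      using orth[OF r] sum.remove[OF finite_C c, of "\<lambda>c. \<integral>x. m (face c) x * (\<Sum>i\<in>UNIV. r i x * normal c $ i) \<partial>face_measure (face c)"]
      by simp
    then have "(\<integral>x. (- 1 / norm (a c)) * (?p x * T x) \<partial>?M) = 0"
      unfolding rn using edge_normal[of c c' c] c c' by (simp add: mult_ac)
    then show ?thesis using normal_nonzero[OF c] unfolding T_def by simp
  qed
  obtain t where t: "\<And>c'. t c' \<in> polys l"
    and pt: "\<And>x. x \<in> face c \<Longrightarrow> ?p x = (\<Sum>c'\<in>C - {c}. (a c' \<bullet> x + b c') * t c' x)"
    using polys_on_face[OF c m[OF c] l] by blast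
  have "(\<integral>x. ?p x * ?p x \<partial>?M) = (\<integral>x. ?p x * (\<Sum>c'\<in>C - {c}. (a c' \<bullet> x + b c') * t c' x) \<partial>?M)"
    using space_face_measure[OF c] pt by (intro Bochner_Integration.integral_cong) auto
  also have "\<dots> = (\<integral>x. (\<Sum>c'\<in>C - {c}. ?p x * ((a c' \<bullet> x + b c') * t c' x)) \<partial>?M)"
    by (simp add: sum_distrib_left)
  also have "\<dots> = (\<Sum>c'\<in>C - {c}. \<integral>x. ?p x * ((a c' \<bullet> x + b c') * t c' x) \<partial>?M)"
    by (intro Bochner_Integration.integral_sum integrable_face_measure c continuous_intros cont continuous_polys[OF t])
  also have "\<dots> = 0" using * t by simp
  finally have "(\<integral>x. ?p x * ?p x \<partial>?M) = 0" .
  then have "AE x in ?M. ?p x * ?p x = 0"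
    by (subst (asm) integral_nonneg_eq_0_iff_AE) (auto intro!: integrable_face_measure c continuous_intros cont)
  then show ?thesis by simp
qed

text \<open>Volume is base times height divided by the dimension, the height being \<open>1 / norm (a c)\<close>.\<close>

lemma face_area:
  assumes c: "c \<in> C"
  shows "(\<integral>x. 1 \<partial>face_measure (face c)) / norm (a c) = CARD('n) * measure lebesgue K"
proof -
  have "(\<integral>x. real CARD('n) * 1 + (0::real) \<partial>lebesgue_on K) = (\<integral>x. 1 \<partial>face_measure (face c)) / norm (a c)"
    by (rule simplex_cone_integral[OF c, of "\<lambda>_. 1" "\<lambda>_ _. 0"]) auto
  moreover have "measure (lebesgue_on K) K = measure lebesgue K"
    using compact_K by (simp add: measure_restrict_space lmeasurable_compact fmeasurableD)
  ultimately show ?thesis by (simp add: mult.commute)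
qed

lemma volume_pos: "0 < measure lebesgue K"
proof -
  have "\<not> negligible K"
    using interior_nonempty open_not_negligible[OF open_interior] negligible_subset interior_subset by blast
  then have "measure lebesgue K \<noteq> 0"
    using compact_K by (simp add: lmeasurable_compact measure_eq_0_null_sets negligible_iff_measure)
  then show ?thesis using zero_less_measure_iff by blast
qed

text \<open>The constant field along the edge from \<open>c'\<close> to \<open>c\<close> is tangential to all facets but the two
  opposite to these vertices, and its fluxes through them are opposite, namely \<open>d |K|\<close> up to sign.\<close>

lemma constant_traces_equal:
  assumes orth: "\<And>e. (\<Sum>c\<in>C. \<integral>x. m c * (e \<bullet> normal c) \<partial>face_measure (face c)) = 0"
    and c: "c \<in> C" "c' \<in> C"
  shows "m c = (m c' :: real)"
proof (cases "c = c'")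
  case False
  define A where "A c = (\<integral>x. (1::real) \<partial>face_measure (face c))" for c
  define V where "V = CARD('n) * measure lebesgue K"
  have "A c / norm (a c) = V" "A c' / norm (a c') = V"
    using face_area c by (simp_all only: A_def V_def)
  then have A: "A c = V * norm (a c)" "A c' = V * norm (a c')"
    using c normal_nonzero by (auto simp: field_simps)
  have "(\<integral>x. m d * ((c - c') \<bullet> normal d) \<partial>face_measure (face d)) = m d * ((c - c') \<bullet> normal d) * A d" for d
    by (simp add: A_def)
  then have "0 = (\<Sum>d\<in>C. m d * ((c - c') \<bullet> normal d) * A d)"
    using orth[of "c - c'"] by (simp only:)
  also have "\<dots> = (\<Sum>d\<in>{c, c'}. m d * ((c - c') \<bullet> normal d) * A d)"
    by (rule sum.mono_neutral_right) (use finite_C c False edge_normal[of c c'] in auto)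
  also have "\<dots> = V * (m c' - m c)"
    using False c normal_nonzero edge_normal[of c c'] by (simp add: A algebra_simps)
  finally show ?thesis using volume_pos by (simp add: V_def)
qed simp

end

context hdg_scheme
begin

text \<open>Once the cell parts of the solution vanish, a test field supported by one cell leaves only the
  trace term of the first equation on the boundary of that cell.\<close>

lemma trace_orthogonal:
  assumes X: "X \<in> discrete" and K: "K \<in> \<T>" and r: "\<And>i. r i \<in> polys (int k)"
    and zero: "\<And>K x. K \<in> \<T> \<Longrightarrow> X (Cell K) x = 0" "\<And>K i x. K \<in> \<T> \<Longrightarrow> X (Flux K i) x = 0"
    and ker: "\<And>Y. Y \<in> discrete \<Longrightarrow> form \<beta> X Y = 0"
  shows "(\<Sum>F | F facet_of K. \<integral>x. X (Face F) x * (\<Sum>i\<in>UNIV. r i x * outward_normal K F $ i) \<partial>face_measure F) = 0"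
proof -
  define Y :: "'n data" where "Y \<kappa> = (case \<kappa> of Flux K' i \<Rightarrow> (if K' = K then r i else (\<lambda>_. 0)) | _ \<Rightarrow> (\<lambda>_. 0))" for \<kappa>
  have Y: "Y \<in> discrete" by (rule discreteI) (auto simp: Y_def r polys_zero)
  have c: "cell_form \<beta> X Y K' = (\<lambda>_. 0)" if "K' \<in> \<T>" for K'
    using that by (simp add: cell_form_def fun_eq_iff zero Y_def partial_zero)
  define G where "G F x = X (Face F) x * (\<Sum>i\<in>UNIV. r i x * outward_normal K F $ i)" for F x
  have f: "trace_form X Y K' F x + skeleton_form X Y K' F x = (if K' = K then 1/2 * G F x else 0)" for K' F x
    by (simp add: trace_form_def skeleton_form_def normal_flux_def Y_def G_def)
  have "0 = form \<beta> X Y" using ker[OF Y] by simp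
  also have "\<dots> = (\<Sum>K'\<in>\<T>. if K' = K then 1/2 * (\<Sum>F | F facet_of K. \<integral>x. G F x \<partial>face_measure F) else 0)"
    unfolding form_def by (intro sum.cong refl) (simp add: c f sum_divide_distrib)
  also have "\<dots> = 1/2 * (\<Sum>F | F facet_of K. \<integral>x. G F x \<partial>face_measure F)"
    using K finite_mesh by simp
  finally show ?thesis by (simp add: G_def)
qed

text \<open>Testing with the trace itself, cut off to the boundary faces, leaves the sum of its squares.\<close>

lemma form_kernel_boundary:
  assumes X: "X \<in> discrete" and ker: "\<And>Y. Y \<in> discrete \<Longrightarrow> form \<beta> X Y = 0"
    and F: "F \<in> mesh_faces \<T>" "F \<subseteq> frontier \<Omega>"
  shows "AE x in face_measure F. X (Face F) x = 0"
proof -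
  define Y :: "'n data" where "Y \<kappa> = (case \<kappa> of Face F \<Rightarrow> if F \<subseteq> frontier \<Omega> then X (Face F) else (\<lambda>_. 0) | _ \<Rightarrow> (\<lambda>_. 0))" for \<kappa>
  have Y: "Y \<in> discrete" by (rule discreteI) (auto simp: Y_def polys_zero discreteD[OF X])
  let ?g = "\<lambda>F x. if F \<subseteq> frontier \<Omega> then X (Face F) x * X (Face F) x else 0"
  have c: "cell_form \<beta> X Y K = (\<lambda>_. 0)" for K
    by (simp add: cell_form_def fun_eq_iff Y_def partial_zero)
  have f: "trace_form X Y K F x + skeleton_form X Y K F x = ?g F x" for K F x
    by (simp add: trace_form_def skeleton_form_def normal_flux_def Y_def)
  have "form \<beta> X Y = (\<Sum>K\<in>\<T>. \<Sum>F | F facet_of K. \<integral>x. ?g F x \<partial>face_measure F)"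
    unfolding form_def by (simp only: c f) simp
  then have sum0: "(\<Sum>K\<in>\<T>. \<Sum>F | F facet_of K. \<integral>x. ?g F x \<partial>face_measure F) = 0" using ker[OF Y] by simp
  obtain K where K: "K \<in> \<T>" "F facet_of K" using F by (auto simp: mesh_faces_def)
  have nonneg: "0 \<le> (\<integral>x. ?g F x \<partial>face_measure F)" for F by simp
  have "(\<Sum>F | F facet_of K. \<integral>x. ?g F x \<partial>face_measure F) = 0"
    using sum0 K(1) finite_mesh nonneg by (subst (asm) sum_nonneg_eq_0_iff) (auto intro!: sum_nonneg simp del: Bochner_Integration.integral_nonneg)
  then have "(\<integral>x. ?g F x \<partial>face_measure F) = 0"
    using K finite_facets nonneg by (subst (asm) sum_nonneg_eq_0_iff) auto
  then have "(\<integral>x. X (Face F) x * X (Face F) x \<partial>face_measure F) = 0" using F(2) by simp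
  then have "AE x in face_measure F. X (Face F) x * X (Face F) x = 0"
    using continuous_face[OF X F(1)]
    by (subst (asm) integral_nonneg_eq_0_iff_AE) (auto intro!: integrable_face F continuous_intros)
  then show ?thesis by simp
qed

text \<open>The energy identity: integration by parts turns the mixed terms in the cell \<open>K\<close> into the boundary terms \<open>?g\<close>,
  and on every facet the remaining terms combine to \<open>\<tau> (u - \<mu>)\<^sup>2 / 2\<close>, with \<open>\<mu> = 0\<close> on the boundary.\<close>

lemma form_kernel_cells:
  assumes \<beta>: "0 < \<beta>" and X: "X \<in> discrete" and ker: "\<And>Y. Y \<in> discrete \<Longrightarrow> form \<beta> X Y = 0"
    and K: "K \<in> \<T>"
  shows "X (Cell K) x = 0" "X (Flux K i) x = 0"
proof -
  let ?e = "\<lambda>K x. \<beta> * (X (Cell K) x)\<^sup>2 + 1/2 * (\<Sum>i\<in>UNIV. (X (Flux K i) x)\<^sup>2)"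
  let ?d = "\<lambda>K x. \<Sum>i\<in>UNIV. X (Cell K) x * partial (X (Flux K i)) i x + X (Flux K i) x * partial (X (Cell K)) i x"
  let ?f = "\<lambda>K F x. trace_form X X K F x + skeleton_form X X K F x"
  let ?g = "\<lambda>K F x. X (Cell K) x * normal_flux X K F x"
  note cont = continuous_intros continuous_data[OF X]
  have bdry: "AE x in face_measure F. X (Face F) x = 0" if "F \<in> mesh_faces \<T>" "F \<subseteq> frontier \<Omega>" for F
    using form_kernel_boundary[OF X ker that] .
  have e_int: "integrable (lebesgue_on K) (?e K)" if "K \<in> \<T>" for K
    by (intro integrable_cell cont that)
  have e_nonneg: "0 \<le> ?e K x" for K x using \<beta> by (intro add_nonneg_nonneg mult_nonneg_nonneg sum_nonneg) auto
  have face_nonneg: "0 \<le> (\<integral>x. ?f K F x \<partial>face_measure F) - 1/2 * (\<integral>x. ?g K F x \<partial>face_measure F)"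
    if K: "K \<in> \<T>" and F: "F facet_of K" for K F
  proof -
    have Fm: "F \<in> mesh_faces \<T>" by (rule mesh_facesI[OF K F])
    have int: "integrable (face_measure F) (trace_form X X K F)" "integrable (face_measure F) (skeleton_form X X K F)"
      "integrable (face_measure F) (?g K F)"
      using integrable_trace_form[OF X X K Fm] integrable_skeleton_form[OF X X K Fm]
      by (simp_all only:) (intro integrable_face cont K Fm)
    have "(\<integral>x. ?f K F x \<partial>face_measure F) - 1/2 * (\<integral>x. ?g K F x \<partial>face_measure F)
      = (\<integral>x. ?f K F x - 1/2 * ?g K F x \<partial>face_measure F)"
      using int by simp
    also have "0 \<le> \<dots>"
    proof (rule integral_nonneg_AE)
      have t: "0 \<le> \<tau> K F" by (rule tau[OF K F])
      show "AE x in face_measure F. 0 \<le> ?f K F x - 1/2 * ?g K F x"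
      proof (cases "F \<subseteq> frontier \<Omega>")
        case True
        from bdry[OF Fm True] show ?thesis
        proof eventually_elim
          case (elim x)
          then have "?f K F x - 1/2 * ?g K F x = 1/2 * (\<tau> K F * (X (Cell K) x)\<^sup>2)"
            by (simp add: trace_form_def skeleton_form_def numerical_flux_def algebra_simps power2_eq_square)
          moreover have "0 \<le> 1/2 * (\<tau> K F * (X (Cell K) x)\<^sup>2)" using t by simp
          ultimately show ?case by (simp only:)
        qed
      next
        case False
        have "?f K F x - 1/2 * ?g K F x = 1/2 * (\<tau> K F * (X (Cell K) x - X (Face F) x)\<^sup>2)" for x
          using False by (simp add: trace_form_def skeleton_form_def numerical_flux_def power2_eq_square field_simps)
        moreover have "0 \<le> 1/2 * (\<tau> K F * (X (Cell K) x - X (Face F) x)\<^sup>2)" for x using t by simp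
        ultimately show ?thesis by (intro AE_I2) (simp only:)
      qed
    qed
    finally show ?thesis .
  qed
  have cell: "(\<integral>x. cell_form \<beta> X X K x \<partial>lebesgue_on K) + (\<Sum>F | F facet_of K. \<integral>x. ?f K F x \<partial>face_measure F)
    = (\<integral>x. ?e K x \<partial>lebesgue_on K) + (\<Sum>F | F facet_of K. (\<integral>x. ?f K F x \<partial>face_measure F) - 1/2 * (\<integral>x. ?g K F x \<partial>face_measure F))"
    if K: "K \<in> \<T>" for K
  proof -
    have "(\<integral>x. ?d K x \<partial>lebesgue_on K) = (\<Sum>F | F facet_of K. \<integral>x. ?g K F x \<partial>face_measure F)"
      unfolding normal_flux_def by (rule integration_by_parts[OF K discreteD(1)[OF X K] discreteD(2)[OF X K]])
    moreover have "cell_form \<beta> X X K x = ?e K x - 1/2 * ?d K x" for x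
    proof -
      have "(\<Sum>i\<in>UNIV. X (Flux K i) x * X (Flux K i) x - X (Cell K) x * partial (X (Flux K i)) i x
          - X (Flux K i) x * partial (X (Cell K)) i x) = (\<Sum>i\<in>UNIV. (X (Flux K i) x)\<^sup>2) - ?d K x"
        unfolding sum_subtractf[symmetric] by (intro sum.cong refl) (simp add: power2_eq_square)
      then show ?thesis unfolding cell_form_def by (simp only:) (simp add: power2_eq_square algebra_simps)
    qed
    moreover have d_int: "integrable (lebesgue_on K) (?d K)" by (intro integrable_cell cont K)
    have "(\<integral>x. ?e K x - 1/2 * ?d K x \<partial>lebesgue_on K) = (\<integral>x. ?e K x \<partial>lebesgue_on K) - 1/2 * (\<integral>x. ?d K x \<partial>lebesgue_on K)"
      by (subst Bochner_Integration.integral_diff[OF e_int[OF K] integrable_mult_right[OF d_int]])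
        (simp only: integral_mult_right_zero)
    ultimately have 1: "(\<integral>x. cell_form \<beta> X X K x \<partial>lebesgue_on K)
      = (\<integral>x. ?e K x \<partial>lebesgue_on K) - 1/2 * (\<Sum>F | F facet_of K. \<integral>x. ?g K F x \<partial>face_measure F)"
      by (simp only:)
    have 2: "(\<Sum>F | F facet_of K. (\<integral>x. ?f K F x \<partial>face_measure F) - 1/2 * (\<integral>x. ?g K F x \<partial>face_measure F))
      = (\<Sum>F | F facet_of K. \<integral>x. ?f K F x \<partial>face_measure F) - 1/2 * (\<Sum>F | F facet_of K. \<integral>x. ?g K F x \<partial>face_measure F)"
      by (simp only: sum_subtractf sum_distrib_left)
    show ?thesis unfolding 1 2 by simp
  qed
  define J where "J K = (\<Sum>F | F facet_of K. (\<integral>x. ?f K F x \<partial>face_measure F) - 1/2 * (\<integral>x. ?g K F x \<partial>face_measure F))" for K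
  define E where "E K = (\<integral>x. ?e K x \<partial>lebesgue_on K)" for K
  have J: "0 \<le> J K" if "K \<in> \<T>" for K unfolding J_def using face_nonneg that by (intro sum_nonneg) auto
  have E: "0 \<le> E K" for K unfolding E_def using e_nonneg by (intro Bochner_Integration.integral_nonneg)
  have "(\<Sum>K\<in>\<T>. E K + J K) = form \<beta> X X"
    unfolding form_def E_def J_def by (intro sum.cong refl cell[symmetric])
  then have "(\<Sum>K\<in>\<T>. E K + J K) = 0" using ker[OF X] by simp
  then have "E K + J K = 0"
    using sum_nonneg_eq_0_iff[OF finite_mesh, of "\<lambda>K. E K + J K"] E J K by simp
  then have "E K = 0" using E J[OF K] by (simp add: add_nonneg_eq_0_iff)
  then have ae: "AE x in lebesgue_on K. ?e K x = 0"
    unfolding E_def using e_nonneg by (subst (asm) integral_nonneg_eq_0_iff_AE[OF e_int[OF K]]) auto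
  have "X (Cell K) x = 0 \<and> (\<forall>i. X (Flux K i) x = 0)" if "?e K x = 0" for x
  proof -
    have "0 \<le> \<beta> * (X (Cell K) x)\<^sup>2" "0 \<le> (\<Sum>i\<in>UNIV. (X (Flux K i) x)\<^sup>2)" using \<beta> by (auto intro: sum_nonneg)
    then have "\<beta> * (X (Cell K) x)\<^sup>2 = 0" "(\<Sum>i\<in>UNIV. (X (Flux K i) x)\<^sup>2) = 0" using that by linarith+
    then show ?thesis using \<beta> by (simp add: sum_nonneg_eq_0_iff)
  qed
  with ae have ae': "AE x in lebesgue_on K. X (Cell K) x = 0 \<and> (\<forall>i. X (Flux K i) x = 0)"
    by (rule eventually_mono)
  note zero = polys_AE_zero[OF _ interior_cell[OF K] fmeasurableD[OF lmeasurable_compact[OF compact_cell[OF K]]]]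
  show "X (Cell K) x = 0" by (rule zero[OF discreteD(1)[OF X K]]) (use ae' in \<open>auto elim: eventually_mono\<close>)
  show "X (Flux K i) x = 0" by (rule zero[OF discreteD(2)[OF X K]]) (use ae' in \<open>auto elim: eventually_mono\<close>)
qed

text \<open>For \<open>k = 0\<close> the trace is one constant on the boundary of each cell. Instead of following chains of
  neighbouring cells to the boundary of the domain, apply the divergence theorem to \<open>x\<close>, weighted in
  every cell with the square of its constant: the contributions of the two cells at an interior facet
  cancel, since the weight is the same on both sides, and on the boundary the weight vanishes. The sum
  of the volumes, with these weights, is therefore zero.\<close>

lemma form_kernel_constant_faces:
  assumes X: "X \<in> discrete" and ker: "\<And>Y. Y \<in> discrete \<Longrightarrow> form \<beta> X Y = 0" and k: "k = 0"
    and zero: "\<And>K x. K \<in> \<T> \<Longrightarrow> X (Cell K) x = 0" "\<And>K i x. K \<in> \<T> \<Longrightarrow> X (Flux K i) x = 0"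
    and F: "F \<in> mesh_faces \<T>"
  shows "X (Face F) x = 0"
proof -
  define m where "m F = X (Face F) 0" for F
  have m: "X (Face F) x = m F" if "F \<in> mesh_faces \<T>" for F x
    using polys_0_const[of "X (Face F)"] discreteD(3)[OF X that] k by (auto simp: m_def)
  have orth: "(\<Sum>F | F facet_of K. \<integral>x. m F * (e \<bullet> outward_normal K F) \<partial>face_measure F) = 0" if K: "K \<in> \<T>" for K e
  proof -
    have "(\<lambda>_. e $ i) \<in> polys (int k)" for i by (rule polys_const) simp
    from trace_orthogonal[OF X K this zero ker]
    have 0: "(\<Sum>F | F facet_of K. \<integral>x. X (Face F) x * (\<Sum>i\<in>UNIV. e $ i * outward_normal K F $ i) \<partial>face_measure F) = 0" .
    have "(\<Sum>F | F facet_of K. \<integral>x. m F * (e \<bullet> outward_normal K F) \<partial>face_measure F)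
      = (\<Sum>F | F facet_of K. \<integral>x. X (Face F) x * (\<Sum>i\<in>UNIV. e $ i * outward_normal K F $ i) \<partial>face_measure F)"
    proof (rule sum.cong[OF refl])
      fix F assume "F \<in> {F. F facet_of K}"
      then have "X (Face F) x = m F" for x using m[OF mesh_facesI[OF K]] by simp
      then show "(\<integral>x. m F * (e \<bullet> outward_normal K F) \<partial>face_measure F)
        = (\<integral>x. X (Face F) x * (\<Sum>i\<in>UNIV. e $ i * outward_normal K F $ i) \<partial>face_measure F)"
        by (simp only: inner_vec_def inner_real_def)
    qed
    then show ?thesis using 0 by (rule trans)
  qed
  have eq: "m F = m F'" if K: "K \<in> \<T>" and F: "F facet_of K" "F' facet_of K" for K F F'
  proof -
    obtain C a b where "simplex_coords K C a b" using cell_coords[OF K] by blast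
    then interpret simplex_coords K C a b .
    obtain c where c: "c \<in> C" "F = face c" using F(1) facet_iff[THEN iffD1] by blast
    obtain c' where c': "c' \<in> C" "F' = face c'" using F(2) facet_iff[THEN iffD1] by blast
    have "(\<Sum>c\<in>C. \<integral>x. m (face c) * (e \<bullet> normal c) \<partial>face_measure (face c)) = 0" for e
      using orth[OF K, of e] unfolding sum_facets normal_def .
    from constant_traces_equal[OF this c(1) c'(1)] show ?thesis unfolding c(2) c'(2) .
  qed
  define mK where "mK K = m (SOME F. F facet_of K)" for K
  have mK: "mK K = m F" if "K \<in> \<T>" "F facet_of K" for K F
    unfolding mK_def by (rule eq[OF that(1) someI that(2)]) (rule that(2))
  have vol: "CARD('n) * measure lebesgue K = (\<Sum>F | F facet_of K. \<integral>x. x \<bullet> outward_normal K F \<partial>face_measure F)"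
    if K: "K \<in> \<T>" for K
  proof -
    have "(\<integral>x. axis i 1 $ i \<partial>lebesgue_on K) = (\<Sum>F | F facet_of K. \<integral>x. x $ i * (axis i 1 \<bullet> outward_normal K F) \<partial>face_measure F)" for i
      by (rule divergence_cell[OF K]) (auto intro!: bounded_linear_imp_has_derivative bounded_linear_vec_nth)
    then have *: "measure lebesgue K = (\<Sum>F | F facet_of K. \<integral>x. x $ i * outward_normal K F $ i \<partial>face_measure F)" for i
      using compact_cell[OF K] by (simp add: inner_axis' measure_restrict_space lmeasurable_compact fmeasurableD)
    have "CARD('n) * measure lebesgue K = (\<Sum>i::'n\<in>UNIV. measure lebesgue K)" by simp
    also have "\<dots> = (\<Sum>F | F facet_of K. \<Sum>i\<in>UNIV. \<integral>x. x $ i * outward_normal K F $ i \<partial>face_measure F)"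
      by (subst sum.swap) (intro sum.cong refl *)
    also have "\<dots> = (\<Sum>F | F facet_of K. \<integral>x. x \<bullet> outward_normal K F \<partial>face_measure F)"
    proof (rule sum.cong[OF refl])
      fix F assume "F \<in> {F. F facet_of K}"
      then have F: "F \<in> mesh_faces \<T>" using mesh_facesI[OF K] by simp
      have "(\<Sum>i\<in>UNIV. \<integral>x. x $ i * outward_normal K F $ i \<partial>face_measure F)
        = (\<integral>x. (\<Sum>i\<in>UNIV. x $ i * outward_normal K F $ i) \<partial>face_measure F)"
        by (intro Bochner_Integration.integral_sum[symmetric] integrable_face F continuous_intros)
      then show "(\<Sum>i\<in>UNIV. \<integral>x. x $ i * outward_normal K F $ i \<partial>face_measure F)
        = (\<integral>x. x \<bullet> outward_normal K F \<partial>face_measure F)" by (simp add: inner_vec_def)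
    qed
    finally show ?thesis .
  qed
  have "(\<Sum>K\<in>\<T>. (mK K)\<^sup>2 * (CARD('n) * measure lebesgue K))
    = (\<Sum>K\<in>\<T>. \<Sum>F | F \<in> mesh_faces \<T> \<and> F facet_of K. (m F)\<^sup>2 * (\<integral>x. x \<bullet> outward_normal K F \<partial>face_measure F))"
  proof (rule sum.cong[OF refl])
    fix K assume K: "K \<in> \<T>"
    have "{F. F facet_of K} = {F. F \<in> mesh_faces \<T> \<and> F facet_of K}" using mesh_facesI[OF K] by blast
    then show "(mK K)\<^sup>2 * (CARD('n) * measure lebesgue K)
      = (\<Sum>F | F \<in> mesh_faces \<T> \<and> F facet_of K. (m F)\<^sup>2 * (\<integral>x. x \<bullet> outward_normal K F \<partial>face_measure F))"
      unfolding vol[OF K] sum_distrib_left by (intro sum.cong) (auto simp: mK[OF K])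
  qed
  also have "\<dots> = (\<Sum>F\<in>mesh_faces \<T>. \<Sum>K | K \<in> \<T> \<and> F facet_of K. (m F)\<^sup>2 * (\<integral>x. x \<bullet> outward_normal K F \<partial>face_measure F))"
    by (rule sum.swap_restrict[OF finite_mesh finite_mesh_faces])
  also have "\<dots> = 0"
  proof (rule sum.neutral, rule ballI)
    fix F assume F: "F \<in> mesh_faces \<T>"
    show "(\<Sum>K | K \<in> \<T> \<and> F facet_of K. (m F)\<^sup>2 * (\<integral>x. x \<bullet> outward_normal K F \<partial>face_measure F)) = 0"
    proof (cases "F \<subseteq> frontier \<Omega>")
      case True
      have "AE x in face_measure F. m F = 0"
        using form_kernel_boundary[OF X ker F True] m[OF F] by simp
      then have "(m F)\<^sup>2 * (\<integral>x. x \<bullet> outward_normal K F \<partial>face_measure F) = 0" for K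
        by (cases "m F = 0") (auto intro!: integral_eq_zero_AE elim: eventually_mono)
      then show ?thesis by (intro sum.neutral ballI)
    next
      case False
      have "(\<Sum>K | K \<in> \<T> \<and> F facet_of K. \<integral>x. x \<bullet> outward_normal K F \<partial>face_measure F)
        = (\<integral>x. (\<Sum>K | K \<in> \<T> \<and> F facet_of K. x \<bullet> outward_normal K F) \<partial>face_measure F)"
        by (intro Bochner_Integration.integral_sum[symmetric] integrable_face F continuous_intros)
      also have "\<dots> = 0"
        by (simp add: interior_facet_normals[OF F False] flip: inner_sum_right)
      finally show ?thesis by (simp flip: sum_distrib_left)
    qed
  qed
  finally have sum0: "(\<Sum>K\<in>\<T>. (mK K)\<^sup>2 * (CARD('n) * measure lebesgue K)) = 0" .
  obtain K where K: "K \<in> \<T>" "F facet_of K" using F by (auto simp: mesh_faces_def)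
  have "(mK K)\<^sup>2 * (CARD('n) * measure lebesgue K) = 0"
    using sum0 K finite_mesh by (subst (asm) sum_nonneg_eq_0_iff) auto
  moreover have "0 < measure lebesgue K"
    using cell_coords[OF K(1)] simplex_coords.volume_pos by blast
  ultimately have "mK K = 0" by simp
  then show ?thesis using mK[OF K] m[OF F] by simp
qed

theorem form_kernel:
  assumes \<beta>: "0 < \<beta>" and X: "X \<in> discrete" and ker: "\<And>Y. Y \<in> discrete \<Longrightarrow> form \<beta> X Y = 0"
  shows "null_data X"
proof -
  note zero = form_kernel_cells[OF \<beta> X ker]
  have "AE x in face_measure F. X (Face F) x = 0" if F: "F \<in> mesh_faces \<T>" for F
  proof (cases "k = 0")
    case True
    then show ?thesis using form_kernel_constant_faces[OF X ker True zero F] by simp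
  next
    case False
    obtain K where K: "K \<in> \<T>" "F facet_of K" using F by (auto simp: mesh_faces_def)
    obtain C a b where "simplex_coords K C a b" using cell_coords[OF K(1)] by blast
    then interpret simplex_coords K C a b .
    obtain c where c: "c \<in> C" "F = face c" using K(2) facet_iff by blast
    let ?l = "int k - 1"
    have "AE x in face_measure (face c). X (Face (face c)) x = 0"
    proof (rule traces_zero[where m = "\<lambda>F. X (Face F)" and l = ?l])
      show "0 \<le> ?l" using False by simp
      show "X (Face (face c')) \<in> polys (?l + 1)" if "c' \<in> C" for c'
        using discreteD(3)[OF X mesh_facesI[OF K(1)]] facet_iff that by auto
      show "(\<Sum>c\<in>C. \<integral>x. X (Face (face c)) x * (\<Sum>i\<in>UNIV. r i x * normal c $ i) \<partial>face_measure (face c)) = 0"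
        if "\<And>i. r i \<in> polys (?l + 1)" for r
        using trace_orthogonal[OF X K(1) _ zero ker, of r] that unfolding sum_facets normal_def by simp
    qed (rule c)
    then show ?thesis unfolding c(2) .
  qed
  then show ?thesis using zero by (simp add: null_data_def)
qed

end

section \<open>Solvability of the linear problem of one time step\<close>

context hdg_scheme
begin

definition linear_on_discrete :: "('n data \<Rightarrow> real) \<Rightarrow> bool" where
  "linear_on_discrete L \<longleftrightarrow>
     (\<forall>c. \<forall>Y\<in>discrete. \<forall>Z\<in>discrete. L (lincomb c Y Z) = c * L Y + L Z)"

lemma linear_on_discreteI:
  assumes "\<And>c Y Z. Y \<in> discrete \<Longrightarrow> Z \<in> discrete \<Longrightarrow> L (lincomb c Y Z) = c * L Y + L Z"
  shows "linear_on_discrete L"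
  using assms by (simp add: linear_on_discrete_def)

lemma linear_on_discreteD:
  "linear_on_discrete L \<Longrightarrow> Y \<in> discrete \<Longrightarrow> Z \<in> discrete \<Longrightarrow> L (lincomb c Y Z) = c * L Y + L Z"
  by (simp add: linear_on_discrete_def)

lemma linear_null_diff:
  assumes L: "linear_on_discrete L" "\<And>Y. Y \<in> discrete \<Longrightarrow> null_data Y \<Longrightarrow> L Y = 0"
    and YZ: "Y \<in> discrete" "Z \<in> discrete" "null_data (lincomb (-1) Y Z)"
  shows "L Y = L Z"
  using L(2)[OF lincomb_discrete YZ(3)] linear_on_discreteD[OF L(1) YZ(1,2), of "-1"] YZ by simp

text \<open>The monomials on all cells and faces span \<open>discrete\<close>. On the faces they are dependent as
  functions, which is why the linear system has to be solved modulo null data.\<close>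

definition basis_data :: "((real^'n) set, 'n) dof \<times> ('n \<Rightarrow> nat) \<Rightarrow> 'n data" where
  "basis_data i = (\<lambda>\<kappa>. if \<kappa> = fst i then monom_fun (snd i) else (\<lambda>x. 0))"

definition combine :: "(((real^'n) set, 'n) dof \<times> ('n \<Rightarrow> nat)) set \<Rightarrow>
    (((real^'n) set, 'n) dof \<times> ('n \<Rightarrow> nat) \<Rightarrow> real) \<Rightarrow> 'n data" where
  "combine S c = (\<lambda>\<kappa> x. \<Sum>i\<in>S. c i * basis_data i \<kappa> x)"

lemma basis_discrete: "i \<in> dofs \<times> exponents (int k) \<Longrightarrow> basis_data i \<in> discrete"
  by (auto simp: discrete_def basis_data_def polys_zero polys_monom)

lemma combine_discrete:
  assumes "S \<subseteq> dofs \<times> exponents (int k)"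
  shows "combine S c \<in> discrete"
proof -
  have "basis_data i \<kappa> \<in> polys (int k)" if "i \<in> S" "\<kappa> \<in> dofs" for i \<kappa>
    using basis_discrete[of i] that assms by (auto simp: discrete_def)
  then show ?thesis by (auto simp: discrete_def combine_def intro!: polys_sum polys_cmult)
qed

lemma linear_combine:
  assumes L: "linear_on_discrete L" and S: "finite S" "S \<subseteq> dofs \<times> exponents (int k)"
  shows "L (combine S c) = (\<Sum>i\<in>S. c i * L (basis_data i))"
  using S
proof (induction S rule: finite_induct)
  case empty
  have Z: "combine {} c \<in> discrete" by (rule combine_discrete) simp
  have "lincomb (-1) (combine {} c) (combine {} c) = combine {} c"
    by (simp add: lincomb_def combine_def)
  then show ?case using linear_on_discreteD[OF L Z Z, of "-1"] by simp
next
  case (insert i S)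
  have "combine (insert i S) c = lincomb (c i) (basis_data i) (combine S c)"
    using insert.hyps by (simp add: combine_def lincomb_def)
  moreover have "basis_data i \<in> discrete" "combine S c \<in> discrete"
    using insert.prems by (auto intro: basis_discrete combine_discrete)
  ultimately show ?case using insert linear_on_discreteD[OF L] by simp
qed

lemma discrete_combine:
  assumes Y: "Y \<in> discrete"
  shows "\<exists>c. null_data (lincomb (-1) (combine (dofs \<times> exponents (int k)) c) Y)"
proof -
  have "\<forall>\<kappa>\<in>dofs. \<exists>c. Y \<kappa> = (\<lambda>x. \<Sum>m\<in>exponents (int k). c m * monom_fun m x)"
    using Y unfolding discrete_def polys_iff by blast
  then obtain d where d: "\<And>\<kappa>. \<kappa> \<in> dofs \<Longrightarrow> Y \<kappa> = (\<lambda>x. \<Sum>m\<in>exponents (int k). d \<kappa> m * monom_fun m x)"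
    by metis
  let ?c = "\<lambda>i. d (fst i) (snd i)"
  have "combine (dofs \<times> exponents (int k)) ?c \<kappa> x = Y \<kappa> x" if \<kappa>: "\<kappa> \<in> dofs" for \<kappa> x
  proof -
    have "combine (dofs \<times> exponents (int k)) ?c \<kappa> x
      = (\<Sum>\<kappa>'\<in>dofs. \<Sum>m\<in>exponents (int k). d \<kappa>' m * basis_data (\<kappa>', m) \<kappa> x)"
      unfolding combine_def by (subst sum.cartesian_product) (simp add: case_prod_unfold)
    also have "\<dots> = (\<Sum>\<kappa>'\<in>dofs. if \<kappa> = \<kappa>' then (\<Sum>m\<in>exponents (int k). d \<kappa> m * monom_fun m x) else 0)"
      by (intro sum.cong refl) (auto simp: basis_data_def)
    also have "\<dots> = Y \<kappa> x" using \<kappa> finite_dofs d[OF \<kappa>] by simp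
    finally show ?thesis .
  qed
  then have "null_data (lincomb (-1) (combine (dofs \<times> exponents (int k)) ?c) Y)"
    by (auto simp: null_data_def lincomb_apply dofsI)
  then show ?thesis by blast
qed

theorem form_solvable:
  assumes \<beta>: "0 < \<beta>"
    and L: "linear_on_discrete L" "\<And>Y. Y \<in> discrete \<Longrightarrow> null_data Y \<Longrightarrow> L Y = 0"
  shows "\<exists>X\<in>discrete. \<forall>Y\<in>discrete. form \<beta> X Y = L Y"
proof -
  let ?I = "dofs \<times> exponents (int k)"
  have fin: "finite ?I" by (rule finite_cartesian_product[OF finite_dofs finite_exponents])
  let ?C = "combine ?I"
  have C: "?C c \<in> discrete" for c by (rule combine_discrete) simp
  have lin: "linear_in ?I (\<lambda>c. G (?C c))" if "linear_on_discrete G" for G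
    using linear_combine[OF that fin order_refl] unfolding linear_in_def
    by (intro exI[of _ "\<lambda>i. G (basis_data i)"] allI)
  have linr: "linear_on_discrete (form \<beta> X)" and linl: "linear_on_discrete (\<lambda>Y. form \<beta> Y X)"
    if "X \<in> discrete" for X
    using form_lincomb that by (auto intro: linear_on_discreteI)
  have red: "G Y = 0" if G: "linear_on_discrete G" "\<And>Y. Y \<in> discrete \<Longrightarrow> null_data Y \<Longrightarrow> G Y = 0"
    and 0: "\<And>c. G (?C c) = 0" and Y: "Y \<in> discrete" for G Y
  proof -
    obtain c where "null_data (lincomb (-1) (?C c) Y)" using discrete_combine[OF Y] by blast
    from linear_null_diff[OF G C Y this] 0 show ?thesis by simp
  qed
  have "\<exists>x. \<forall>y. form \<beta> (?C x) (?C y) = L (?C y)"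
  proof (rule bilinear_equation_solvable[where I = ?I and N = "\<lambda>x. null_data (?C x)"])
    show "linear_in ?I (\<lambda>x. form \<beta> (?C x) (?C y))" for y by (rule lin[OF linl[OF C]])
    show "linear_in ?I (\<lambda>y. form \<beta> (?C x) (?C y))" for x by (rule lin[OF linr[OF C]])
    show "linear_in ?I (\<lambda>y. L (?C y))" by (rule lin[OF L(1)])
    show "null_data (?C x)" if "\<forall>y. form \<beta> (?C x) (?C y) = 0" for x
      using red[OF linr[OF C] form_null(1)] that by (intro form_kernel[OF \<beta>] C) blast
  qed (use fin form_null L(2) C in auto)
  then obtain x where x: "\<And>y. form \<beta> (?C x) (?C y) - L (?C y) = 0" by auto
  have "form \<beta> (?C x) Y - L Y = 0" if Y: "Y \<in> discrete" for Y
  proof (rule red[of "\<lambda>Y. form \<beta> (?C x) Y - L Y", OF _ _ x Y])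
    show "linear_on_discrete (\<lambda>Y. form \<beta> (?C x) Y - L Y)"
      using linear_on_discreteD[OF linr[OF C]] linear_on_discreteD[OF L(1)]
      by (intro linear_on_discreteI) (simp add: algebra_simps)
  qed (simp add: form_null L(2))
  then show ?thesis using C by (intro bexI[of _ "?C x"]) auto
qed

end

section \<open>Discrete functions and their polynomial pieces\<close>

context hdg_mesh
begin

lemma cell_lebesgue: "K \<in> \<T> \<Longrightarrow> K \<in> sets lebesgue"
  using compact_cell by (simp add: lmeasurable_compact fmeasurableD)

lemma domain_lebesgue: "\<Omega> \<in> sets lebesgue"
  using open_domain by auto

lemma AE_cell_domain:
  assumes ae: "AE x in lebesgue_on \<Omega>. P x" and K: "K \<in> \<T>"
  shows "AE x in lebesgue_on K. P x"
proof -
  have "frontier \<Omega> \<in> null_sets lebesgue"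
    using negligible_convex_frontier[OF convex_domain] by (simp add: negligible_iff_null_sets)
  then have "AE x in lebesgue. x \<notin> frontier \<Omega>" by (rule AE_not_in)
  moreover have "AE x in lebesgue. x \<in> \<Omega> \<longrightarrow> P x"
    using ae domain_lebesgue by (subst (asm) AE_restrict_space_iff) auto
  moreover have sub: "K \<subseteq> \<Omega> \<union> frontier \<Omega>"
    using K cell_Union open_domain by (auto simp: frontier_def interior_open)
  ultimately have "AE x in lebesgue. x \<in> K \<longrightarrow> P x" by (auto elim!: eventually_elim2)
  then show ?thesis using cell_lebesgue[OF K] by (subst AE_restrict_space_iff) auto
qed

lemma AE_domain_cells:
  assumes "\<And>K. K \<in> \<T> \<Longrightarrow> AE x in lebesgue_on K. P x"
  shows "AE x in lebesgue_on \<Omega>. P x"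
proof -
  have "AE x in lebesgue. x \<in> K \<longrightarrow> P x" if "K \<in> \<T>" for K
    using assms[OF that] cell_lebesgue[OF that] by (subst (asm) AE_restrict_space_iff) auto
  then have "AE x in lebesgue. \<forall>K\<in>\<T>. x \<in> K \<longrightarrow> P x"
    using finite_mesh by (subst AE_ball_countable) (auto intro: countable_finite)
  then have "AE x in lebesgue. x \<in> \<Omega> \<longrightarrow> P x"
    by (rule eventually_mono) (use cell_Union closure_subset in blast)
  then show ?thesis using domain_lebesgue by (subst AE_restrict_space_iff) auto
qed

lemma poly_piece_unique:
  assumes K: "K \<in> \<T>" and p: "p \<in> polys l" "q \<in> polys l"
    and ae: "AE x in lebesgue_on K. w x = p x" "AE x in lebesgue_on K. w x = q x"
  shows "p = q"
proof
  fix x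
  have "AE x in lebesgue_on K. p x - q x = 0" using ae by eventually_elim simp
  then have "p x - q x = 0"
    by (rule polys_AE_zero[OF polys_diff[OF p] interior_cell[OF K] cell_lebesgue[OF K]])
  then show "p x = q x" by simp
qed

lemma piece_eqI:
  assumes K: "K \<in> \<T>" and p: "p \<in> polys (int k)" "AE x in lebesgue_on K. w x = p x"
  shows "piece k K w = p"
  unfolding piece_def by (rule the_equality) (use p poly_piece_unique[OF K] in blast)+

lemma piece_W:
  assumes "w \<in> W_space \<Omega> \<T> k" "K \<in> \<T>"
  shows "piece k K w \<in> polys (int k)" "AE x in lebesgue_on K. w x = piece k K w x"
proof -
  obtain p where p: "p \<in> polys (int k)" "AE x in lebesgue_on K. w x = p x"
    using assms by (auto simp: W_space_def)
  with piece_eqI[OF assms(2) p] show "piece k K w \<in> polys (int k)" "AE x in lebesgue_on K. w x = piece k K w x"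
    by simp_all
qed

lemma vpiece_eqI:
  assumes K: "K \<in> \<T>" and p: "p \<in> vpolys (int k)" "AE x in lebesgue_on K. v x = p x"
  shows "vpiece k K v = p"
  unfolding vpiece_def
proof (rule the_equality)
  fix q assume q: "q \<in> vpolys (int k) \<and> (AE x in lebesgue_on K. v x = q x)"
  have "(\<lambda>x. q x $ i) = (\<lambda>x. p x $ i)" for i
  proof (rule poly_piece_unique[OF K, where w = "\<lambda>x. v x $ i"])
    show "AE x in lebesgue_on K. v x $ i = q x $ i" using conjunct2[OF q] by eventually_elim simp
    show "AE x in lebesgue_on K. v x $ i = p x $ i" using p(2) by eventually_elim simp
  qed (use p q in \<open>auto simp: vpolys_def\<close>)
  then show "q = p" by (auto simp: fun_eq_iff vec_eq_iff)
qed (use p in blast)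

lemma vpiece_V:
  assumes "v \<in> V_space \<Omega> \<T> k" "K \<in> \<T>"
  shows "vpiece k K v \<in> vpolys (int k)" "AE x in lebesgue_on K. v x = vpiece k K v x"
proof -
  obtain p where p: "p \<in> vpolys (int k)" "AE x in lebesgue_on K. v x = p x"
    using assms by (auto simp: V_space_def)
  with vpiece_eqI[OF assms(2) p] show "vpiece k K v \<in> vpolys (int k)" "AE x in lebesgue_on K. v x = vpiece k K v x"
    by simp_all
qed

lemma piece_cong:
  assumes "K \<in> \<T>" "w \<in> W_space \<Omega> \<T> k" "cells_eq \<Omega> w' w"
  shows "piece k K w' = piece k K w"
proof (rule piece_eqI[OF assms(1) piece_W(1)[OF assms(2,1)]])
  have "AE x in lebesgue_on K. w' x = w x"
    using AE_cell_domain[OF _ assms(1)] assms(3) by (simp add: cells_eq_def)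
  with piece_W(2)[OF assms(2,1)] show "AE x in lebesgue_on K. w' x = piece k K w x"
    by eventually_elim simp
qed

lemma vpiece_cong:
  assumes "K \<in> \<T>" "w \<in> V_space \<Omega> \<T> k" "cells_eq \<Omega> w' w"
  shows "vpiece k K w' = vpiece k K w"
proof (rule vpiece_eqI[OF assms(1) vpiece_V(1)[OF assms(2,1)]])
  have "AE x in lebesgue_on K. w' x = w x"
    using AE_cell_domain[OF _ assms(1)] assms(3) by (simp add: cells_eq_def)
  with vpiece_V(2)[OF assms(2,1)] show "AE x in lebesgue_on K. w' x = vpiece k K w x"
    by eventually_elim simp
qed

text \<open>Many polynomials may represent a function on a face. The choice depends on the function up to
  null sets only, which makes the right-hand side of a step depend on equivalence classes only.\<close>

definition face_piece :: "nat \<Rightarrow> (real^'n) set \<Rightarrow> (real^'n \<Rightarrow> real) \<Rightarrow> real^'n \<Rightarrow> real" where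
  "face_piece k F \<mu> = (SOME p. p \<in> polys (int k) \<and> (AE x in face_measure F. \<mu> x = p x))"

lemma face_piece_M:
  assumes "\<mu> \<in> M_space \<T> k" "F \<in> mesh_faces \<T>"
  shows "face_piece k F \<mu> \<in> polys (int k)" "AE x in face_measure F. \<mu> x = face_piece k F \<mu> x"
proof -
  have "\<exists>p. p \<in> polys (int k) \<and> (AE x in face_measure F. \<mu> x = p x)"
    using assms by (auto simp: M_space_def)
  from someI_ex[OF this] show "face_piece k F \<mu> \<in> polys (int k)" "AE x in face_measure F. \<mu> x = face_piece k F \<mu> x"
    by (simp_all add: face_piece_def)
qed

lemma face_piece_cong:
  assumes "F \<in> mesh_faces \<T>" "faces_eq \<T> \<mu> \<nu>"
  shows "face_piece k F \<mu> = face_piece k F \<nu>"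
proof -
  have ae: "AE x in face_measure F. \<mu> x = \<nu> x" using assms by (simp add: faces_eq_def)
  have "(AE x in face_measure F. \<mu> x = p x) \<longleftrightarrow> (AE x in face_measure F. \<nu> x = p x)" for p
    by (rule iffI; use ae in \<open>auto elim: eventually_elim2\<close>)
  then show ?thesis by (simp add: face_piece_def)
qed

end

context hdg_scheme
begin

definition data_of :: "(real^'n \<Rightarrow> real) \<times> (real^'n \<Rightarrow> real^'n) \<times> (real^'n \<Rightarrow> real) \<Rightarrow> 'n data" where
  "data_of y \<kappa> = (case y of (u, q, \<mu>) \<Rightarrow> (case \<kappa> of Cell K \<Rightarrow> piece k K u
     | Flux K i \<Rightarrow> (\<lambda>x. vpiece k K q x $ i) | Face F \<Rightarrow> face_piece k F \<mu>))"

lemma data_of_simps [simp]: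
  "data_of (u, q, \<mu>) (Cell K) = piece k K u"
  "data_of (u, q, \<mu>) (Flux K i) = (\<lambda>x. vpiece k K q x $ i)"
  "data_of (u, q, \<mu>) (Face F) = face_piece k F \<mu>"
  by (simp_all add: data_of_def)

definition spaces :: "((real^'n \<Rightarrow> real) \<times> (real^'n \<Rightarrow> real^'n) \<times> (real^'n \<Rightarrow> real)) set" where
  "spaces = W_space \<Omega> \<T> k \<times> V_space \<Omega> \<T> k \<times> M_space \<T> k"

lemma data_of_discrete:
  assumes "y \<in> spaces"
  shows "data_of y \<in> discrete"
proof -
  obtain u q \<mu> where y: "y = (u, q, \<mu>)" "u \<in> W_space \<Omega> \<T> k" "q \<in> V_space \<Omega> \<T> k" "\<mu> \<in> M_space \<T> k"
    using assms by (auto simp: spaces_def)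
  show ?thesis unfolding y(1)
    by (rule discreteI) (use piece_W[OF y(2)] vpiece_V[OF y(3)] face_piece_M[OF y(4)] in \<open>auto simp: vpolys_def\<close>)
qed

lemma bounded_on_compact:
  assumes "compact K" "continuous_on UNIV f"
  shows "\<exists>C\<ge>0. \<forall>x. \<bar>indicator K x * f x :: real\<bar> \<le> C"
proof -
  have "bounded (f ` K)"
    by (intro compact_imp_bounded compact_continuous_image continuous_on_subset[OF assms(2)] assms(1)) simp
  then obtain C where "\<And>x. x \<in> K \<Longrightarrow> \<bar>f x\<bar> \<le> C" unfolding bounded_iff by auto
  then show ?thesis
    by (intro exI[of _ "\<bar>C\<bar>"]) (auto simp: indicator_def intro: order_trans[OF _ abs_ge_self])
qed

lemma bounded_sum_indicator:
  fixes f :: "(real^'n) set \<Rightarrow> real^'n \<Rightarrow> real"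
  assumes "finite A" "\<And>K. K \<in> A \<Longrightarrow> compact K" "\<And>K. K \<in> A \<Longrightarrow> continuous_on UNIV (f K)"
  shows "(\<lambda>x. \<Sum>K\<in>A. indicator K x * f K x) \<in> borel_measurable borel"
    and "\<exists>C\<ge>0. \<forall>x. \<bar>\<Sum>K\<in>A. indicator K x * f K x\<bar> \<le> C"
proof -
  show "(\<lambda>x. \<Sum>K\<in>A. indicator K x * f K x) \<in> borel_measurable borel"
  proof (intro borel_measurable_sum borel_measurable_times borel_measurable_indicator)
    fix K assume "K \<in> A"
    then show "K \<in> sets borel" "f K \<in> borel_measurable borel"
      using assms by (auto intro: borel_measurable_continuous_onI simp: compact_imp_closed)
  qed
  have "\<forall>K\<in>A. \<exists>C\<ge>0. \<forall>x. \<bar>indicator K x * f K x\<bar> \<le> C"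
    using assms bounded_on_compact by blast
  then obtain C where C: "\<And>K. K \<in> A \<Longrightarrow> 0 \<le> C K" "\<And>K x. K \<in> A \<Longrightarrow> \<bar>indicator K x * f K x\<bar> \<le> C K"
    by metis
  have "\<bar>\<Sum>K\<in>A. indicator K x * f K x\<bar> \<le> sum C A" for x
    using C by (intro order_trans[OF sum_abs] sum_mono) auto
  then show "\<exists>C\<ge>0. \<forall>x. \<bar>\<Sum>K\<in>A. indicator K x * f K x\<bar> \<le> C"
    using C by (intro exI[of _ "sum C A"]) (auto intro: sum_nonneg)
qed

lemma L2_fun_bounded:
  fixes f :: "real^'n \<Rightarrow> 'b::euclidean_space"
  assumes M: "finite_measure M" and f: "f \<in> borel_measurable M" and C: "\<And>x. norm (f x) \<le> C"
  shows "L2_fun M f"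
proof -
  have "integrable M (\<lambda>x. (norm (f x))\<^sup>2)"
  proof (rule finite_measure.integrable_const_bound[OF M])
    show "AE x in M. norm ((norm (f x))\<^sup>2) \<le> C\<^sup>2"
      using C by (intro AE_I2) (auto intro: power_mono)
  qed (use f in measurable)
  with f show ?thesis by (simp add: L2_fun_def)
qed

lemma sum_indicator_cell:
  assumes "K \<in> \<T>"
  shows "AE x in lebesgue_on K. (\<Sum>K'\<in>\<T>. indicator K' x * g K' x) = (g K x :: real)"
proof -
  have "AE x in lebesgue_on K. x \<in> K" by (intro AE_I2) (simp add: space_restrict_space)
  with cells_overlap_AE[OF assms] show ?thesis
  proof eventually_elim
    case (elim x)
    have "(\<Sum>K'\<in>\<T>. indicator K' x * g K' x) = (\<Sum>K'\<in>{K}. indicator K' x * g K' x)"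
      by (rule sum.mono_neutral_right) (use elim assms finite_mesh in auto)
    then show ?case using elim by simp
  qed
qed

lemma sum_indicator_face:
  assumes "F \<in> mesh_faces \<T>"
  shows "AE x in face_measure F. (\<Sum>F'\<in>mesh_faces \<T>. indicator F' x * g F' x) = (g F x :: real)"
proof -
  have "AE x in face_measure F. x \<in> F" using space_face[OF assms] by (intro AE_I2) simp
  with faces_overlap_AE[OF assms] show ?thesis
  proof eventually_elim
    case (elim x)
    have "(\<Sum>F'\<in>mesh_faces \<T>. indicator F' x * g F' x) = (\<Sum>F'\<in>{F}. indicator F' x * g F' x)"
      by (rule sum.mono_neutral_right) (use elim assms finite_mesh_faces in auto)
    then show ?case using elim by simp
  qed
qed

text \<open>Cells, and likewise faces, overlap in null sets, so the sum of the pieces cut off to their cells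
  or faces represents all of them.\<close>

lemma glue:
  assumes X: "X \<in> discrete"
  shows "\<exists>y\<in>spaces. null_data (lincomb (-1) X (data_of y))"
proof -
  define u where "u x = (\<Sum>K\<in>\<T>. indicator K x * X (Cell K) x)" for x
  define q where "q x = (\<chi> i. \<Sum>K\<in>\<T>. indicator K x * X (Flux K i) x)" for x
  define \<mu> where "\<mu> x = (\<Sum>F\<in>mesh_faces \<T>. indicator F x * X (Face F) x)" for x
  have finO: "finite_measure (lebesgue_on \<Omega>)"
    using bounded_domain open_domain
    by (intro finite_measure_lebesgue_on bounded_set_imp_lmeasurable) auto
  have leb: "f \<in> borel_measurable (lebesgue_on \<Omega>)" if "f \<in> borel_measurable borel" for f :: "real^'n \<Rightarrow> 'b::euclidean_space"
    using that by (intro measurable_restrict_space1 measurable_completion) simp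
  note bc = bounded_sum_indicator[OF finite_mesh compact_cell, where f = "\<lambda>K. X (Cell K)", OF _ continuous_cell[OF X]]
  note bq = bounded_sum_indicator[OF finite_mesh compact_cell, where f = "\<lambda>K. X (Flux K i)" for i, OF _ continuous_flux[OF X]]
  note bm = bounded_sum_indicator[OF finite_mesh_faces compact_mesh_face, where f = "\<lambda>F. X (Face F)", OF _ continuous_face[OF X]]
  have ucell: "AE x in lebesgue_on K. u x = X (Cell K) x" if "K \<in> \<T>" for K
    unfolding u_def by (rule sum_indicator_cell[OF that])
  have u: "u \<in> W_space \<Omega> \<T> k"
  proof -
    obtain C where "\<And>x. \<bar>u x\<bar> \<le> C" using bc(2) unfolding u_def by blast
    moreover have "u \<in> borel_measurable borel" using bc(1) unfolding u_def[abs_def] by blast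
    ultimately have "L2_fun (lebesgue_on \<Omega>) u" by (intro L2_fun_bounded[OF finO] leb) auto
    then show ?thesis using ucell discreteD(1)[OF X] by (auto simp: W_space_def)
  qed
  have qcell: "AE x in lebesgue_on K. q x = (\<chi> i. X (Flux K i) x)" if "K \<in> \<T>" for K
  proof -
    have "AE x in lebesgue_on K. q x $ i = X (Flux K i) x" for i
      unfolding q_def vec_lambda_beta by (rule sum_indicator_cell[OF that])
    then have "AE x in lebesgue_on K. \<forall>i. q x $ i = X (Flux K i) x"
      by (simp add: AE_all_countable)
    then show ?thesis by eventually_elim (simp add: vec_eq_iff)
  qed
  have q: "q \<in> V_space \<Omega> \<T> k"
  proof -
    have "\<exists>C. \<forall>x. \<bar>q x $ i\<bar> \<le> C" for i using bq(2)[of i] unfolding q_def by auto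
    then obtain C where C: "\<And>x i. \<bar>q x $ i\<bar> \<le> C i" by metis
    have "norm (q x) \<le> sum C UNIV" for x
      using norm_le_l1_cart[of "q x"] C by (meson order_trans sum_mono)
    moreover have "q \<in> borel_measurable borel"
    proof (rule borel_measurable_euclidean_space[THEN iffD2], rule ballI)
      fix e :: "real^'n" assume "e \<in> Basis"
      then obtain i where "e = axis i 1" by (auto simp: Basis_vec_def)
      then show "(\<lambda>x. q x \<bullet> e) \<in> borel_measurable borel"
        using bq(1)[of i] by (simp add: inner_axis q_def)
    qed
    ultimately have "L2_fun (lebesgue_on \<Omega>) q" by (intro L2_fun_bounded[OF finO] leb)
    moreover have "(\<lambda>x. \<chi> i. X (Flux K i) x) \<in> vpolys (int k)" if "K \<in> \<T>" for K
      using discreteD(2)[OF X that] by (simp add: vpolys_def)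
    then have "\<exists>p\<in>vpolys (int k). AE x in lebesgue_on K. q x = p x" if "K \<in> \<T>" for K
      using that qcell by (intro bexI[of _ "\<lambda>x. \<chi> i. X (Flux K i) x"])
    ultimately show ?thesis by (simp add: V_space_def)
  qed
  have mface: "AE x in face_measure F. \<mu> x = X (Face F) x" if "F \<in> mesh_faces \<T>" for F
    unfolding \<mu>_def by (rule sum_indicator_face[OF that])
  have \<mu>: "\<mu> \<in> M_space \<T> k"
  proof -
    obtain C where C: "\<And>x. \<bar>\<mu> x\<bar> \<le> C" using bm(2) unfolding \<mu>_def by blast
    have "\<mu> \<in> borel_measurable borel" using bm(1) unfolding \<mu>_def[abs_def] by blast
    then have "L2_fun (face_measure F) \<mu>" if "F \<in> mesh_faces \<T>" for F
      using C that by (intro L2_fun_bounded[OF finite_measure_face] measurable_face) auto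
    then show ?thesis using mface discreteD(3)[OF X] by (auto simp: M_space_def)
  qed
  have "null_data (lincomb (-1) X (data_of (u, q, \<mu>)))"
    unfolding null_data_def
  proof (intro conjI ballI allI)
    fix K x assume K: "K \<in> \<T>"
    show "lincomb (-1) X (data_of (u, q, \<mu>)) (Cell K) x = 0"
      using piece_eqI[OF K discreteD(1)[OF X K] ucell[OF K]] by (simp add: lincomb_apply)
    have "(\<lambda>x. \<chi> i. X (Flux K i) x) \<in> vpolys (int k)" using discreteD(2)[OF X K] by (simp add: vpolys_def)
    from vpiece_eqI[OF K this qcell[OF K]]
    show "lincomb (-1) X (data_of (u, q, \<mu>)) (Flux K i) x = 0" for i by (simp add: lincomb_apply)
  next
    fix F assume F: "F \<in> mesh_faces \<T>"
    from mface[OF F] face_piece_M(2)[OF \<mu> F]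
    show "AE x in face_measure F. lincomb (-1) X (data_of (u, q, \<mu>)) (Face F) x = 0"
      by eventually_elim (simp add: lincomb_apply)
  qed
  then show ?thesis using u q \<mu> by (intro bexI[of _ "(u, q, \<mu>)"]) (auto simp: spaces_def)
qed

end

section \<open>The scheme in terms of polynomial data\<close>

lemma divg_vpolys:
  assumes "p \<in> vpolys l"
  shows "divg p x = (\<Sum>i\<in>UNIV. partial (\<lambda>x. p x $ i) i x)"
proof -
  let ?D = "\<lambda>v. \<chi> i. frechet_derivative (\<lambda>x. p x $ i) (at x) v"
  have d: "((\<lambda>x. p x $ i) has_derivative frechet_derivative (\<lambda>x. p x $ i) (at x)) (at x)" for i
    using assms polys_deriv[of "\<lambda>x. p x $ i" l] by (simp add: vpolys_def)
  have "(p has_derivative ?D) (at x)"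
  proof (rule has_derivative_componentwise_within[THEN iffD2], rule ballI)
    fix e :: "real^'a" assume "e \<in> Basis"
    then obtain i where "e = axis i 1" by (auto simp: Basis_vec_def)
    then show "((\<lambda>x. p x \<bullet> e) has_derivative (\<lambda>v. ?D v \<bullet> e)) (at x)"
      using d[of i] by (simp add: inner_axis)
  qed
  from frechet_derivative_at[OF this] have "frechet_derivative p (at x) = ?D" by simp
  then show ?thesis by (simp add: divg_def partial_def)
qed

lemma integrable_mult_continuous:
  fixes \<phi> p :: "real^'n \<Rightarrow> real"
  assumes \<phi>: "integrable M \<phi>" and p: "continuous_on UNIV p" "p \<in> borel_measurable M"
    and M: "compact S" "space M = S"
  shows "integrable M (\<lambda>x. \<phi> x * p x)"
proof -
  have "bounded (p ` S)"
    by (intro compact_imp_bounded compact_continuous_image continuous_on_subset[OF p(1)] M(1)) simp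
  then obtain C where C: "\<And>x. x \<in> S \<Longrightarrow> \<bar>p x\<bar> \<le> C" unfolding bounded_iff by auto
  show ?thesis
  proof (rule Bochner_Integration.integrable_bound)
    show "integrable M (\<lambda>x. \<bar>C\<bar> * \<phi> x)" using \<phi> by simp
    show "AE x in M. norm (\<phi> x * p x) \<le> norm (\<bar>C\<bar> * \<phi> x)"
    proof (rule AE_I2)
      fix x assume "x \<in> space M"
      then have "\<bar>p x\<bar> \<le> \<bar>C\<bar>" using C[of x] M by auto
      then have "\<bar>\<phi> x\<bar> * \<bar>p x\<bar> \<le> \<bar>\<phi> x\<bar> * \<bar>C\<bar>" by (intro mult_left_mono) auto
      then show "norm (\<phi> x * p x) \<le> norm (\<bar>C\<bar> * \<phi> x)" by (simp add: abs_mult mult.commute)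
    qed
  qed (use \<phi> p in measurable)
qed

lemma L2_fun_integrable:
  fixes v :: "'a \<Rightarrow> real"
  assumes "finite_measure M" "L2_fun M v"
  shows "integrable M v"
proof (rule Bochner_Integration.integrable_bound)
  show "integrable M (\<lambda>x. 1 + (norm (v x))\<^sup>2)"
    using assms by (auto simp: L2_fun_def finite_measure.integrable_const)
  have "\<bar>r\<bar> \<le> 1 + r\<^sup>2" for r :: real
    using zero_le_power2[of "\<bar>r\<bar> - 1"] zero_le_power2[of r] by (simp add: power2_diff)
  then show "AE x in M. norm (v x) \<le> norm (1 + (norm (v x))\<^sup>2)"
    by (intro AE_I2) (simp add: abs_of_nonneg)
  show "v \<in> borel_measurable M" using assms(2) by (simp add: L2_fun_def)
qed

lemma (in hdg_mesh) integrable_domain_cell: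
  fixes \<phi> :: "real^'n \<Rightarrow> real"
  assumes \<phi>: "integrable (lebesgue_on \<Omega>) \<phi>" and K: "K \<in> \<T>"
  shows "integrable (lebesgue_on K) \<phi>"
proof -
  have 1: "integrable lebesgue (\<lambda>x. indicator \<Omega> x *\<^sub>R \<phi> x)"
    using \<phi> domain_lebesgue by (subst (asm) integrable_restrict_space) auto
  have 2: "integrable lebesgue (\<lambda>x. indicator K x *\<^sub>R (indicator \<Omega> x *\<^sub>R \<phi> x))"
    by (rule integrable_mult_indicator[OF _ 1]) (use cell_lebesgue[OF K] in auto)
  have "frontier \<Omega> \<in> null_sets lebesgue"
    using negligible_convex_frontier[OF convex_domain] by (simp add: negligible_iff_null_sets)
  then have "AE x in lebesgue. x \<notin> frontier \<Omega>" by (rule AE_not_in)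
  moreover have "K \<subseteq> \<Omega> \<union> frontier \<Omega>"
    using K cell_Union open_domain by (auto simp: frontier_def interior_open)
  ultimately have ae: "AE x in lebesgue. indicator K x *\<^sub>R (indicator \<Omega> x *\<^sub>R \<phi> x) = indicator K x *\<^sub>R \<phi> x"
    by (auto elim!: eventually_mono simp: indicator_def)
  have "integrable lebesgue (\<lambda>x. indicator K x *\<^sub>R \<phi> x)"
    using 2 integrable_cong_AE_imp[OF 2 borel_measurable_AE[OF borel_measurable_integrable[OF 2] ae]] ae
    by (auto elim: eventually_mono)
  then show ?thesis using cell_lebesgue[OF K] by (subst integrable_restrict_space) auto
qed

context hdg_scheme
begin

text \<open>The contributions of the previous values to step \<open>j\<close>: \<open>history\<close> is the memory term without the part
  \<open>memory_weight \<alpha> \<delta> j j * u j\<close>, and \<open>previous_flux\<close> collects their half of the averages in the first two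
  equations. The last two equations involve new values only.\<close>

definition history :: "real \<Rightarrow> real \<Rightarrow> nat \<Rightarrow> (nat \<Rightarrow> 'n data) \<Rightarrow> (real^'n) set \<Rightarrow> real^'n \<Rightarrow> real" where
  "history \<alpha> \<delta> j Xs K x =
     (\<Sum>i=1..<j. memory_weight \<alpha> \<delta> j i * (Xs i (Cell K) x - Xs (i - 1) (Cell K) x))
     - memory_weight \<alpha> \<delta> j j * Xs (j - 1) (Cell K) x"

definition previous_flux :: "'n data \<Rightarrow> 'n data \<Rightarrow> real" where
  "previous_flux P Y = (\<Sum>K\<in>\<T>. (\<integral>x. cell_form 0 P Y K x \<partial>lebesgue_on K) +
     (\<Sum>F | F facet_of K. \<integral>x. trace_form P Y K F x \<partial>face_measure F))"

definition load :: "((real^'n) set \<Rightarrow> real^'n \<Rightarrow> real) \<Rightarrow> (real^'n \<Rightarrow> real) \<Rightarrow> 'n data \<Rightarrow> real" where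
  "load \<phi> g Y = (\<Sum>K\<in>\<T>. (\<integral>x. \<phi> K x * Y (Cell K) x \<partial>lebesgue_on K) +
     (\<Sum>F | F facet_of K. if F \<subseteq> frontier \<Omega> then (\<integral>x. g x * Y (Face F) x \<partial>face_measure F) else 0))"

definition step_rhs ::
  "real \<Rightarrow> real \<Rightarrow> (real^'n \<Rightarrow> real \<Rightarrow> real) \<Rightarrow> (real^'n \<Rightarrow> real) \<Rightarrow> nat \<Rightarrow> (nat \<Rightarrow> 'n data) \<Rightarrow> 'n data \<Rightarrow> real" where
  "step_rhs \<alpha> \<delta> f g j Xs Y =
     load (\<lambda>K x. half (\<lambda>i y. f y (real i * \<delta>)) j x - history \<alpha> \<delta> j Xs K x) g Y - previous_flux (Xs (j - 1)) Y"

text \<open>Without face components in the test data, \<open>form\<close> reduces to the terms of \<open>previous_flux\<close>.\<close>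

definition drop_faces :: "'n data \<Rightarrow> 'n data" where
  "drop_faces Y \<kappa> = (case \<kappa> of Face F \<Rightarrow> (\<lambda>x. 0) | _ \<Rightarrow> Y \<kappa>)"

lemma drop_faces_simps [simp]: "drop_faces Y (Cell K) = Y (Cell K)" "drop_faces Y (Flux K i) = Y (Flux K i)"
  "drop_faces Y (Face F) = (\<lambda>x. 0)"
  by (simp_all add: drop_faces_def)

lemma drop_faces_discrete: "Y \<in> discrete \<Longrightarrow> drop_faces Y \<in> discrete"
  by (rule discreteI) (auto simp: discreteD polys_zero)

lemma previous_flux_form: "previous_flux P Y = form 0 P (drop_faces Y)"
proof -
  have "cell_form 0 P (drop_faces Y) = cell_form 0 P Y" "trace_form P (drop_faces Y) = trace_form P Y"
    "skeleton_form P (drop_faces Y) K F x = 0" for K F x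
    by (simp_all add: fun_eq_iff cell_form_def trace_form_def skeleton_form_def normal_flux_def)
  then show ?thesis by (simp add: previous_flux_def form_def)
qed

lemma linear_previous_flux:
  assumes P: "P \<in> discrete"
  shows "linear_on_discrete (previous_flux P)"
proof (rule linear_on_discreteI)
  fix c Y Z assume Y: "Y \<in> discrete" "Z \<in> discrete"
  have "drop_faces (lincomb c Y Z) = lincomb c (drop_faces Y) (drop_faces Z)"
    by (auto simp: fun_eq_iff drop_faces_def lincomb_def split: dof.split)
  then show "previous_flux P (lincomb c Y Z) = c * previous_flux P Y + previous_flux P Z"
    using form_lincomb(1)[OF P drop_faces_discrete[OF Y(1)] drop_faces_discrete[OF Y(2)]]
    by (simp add: previous_flux_form)
qed

lemma previous_flux_null: "null_data Y \<Longrightarrow> previous_flux P Y = 0"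
  unfolding previous_flux_form by (rule form_null) (simp add: null_data_def)

lemma measurable_cell:
  assumes "continuous_on UNIV (p :: real^'n \<Rightarrow> real)"
  shows "p \<in> borel_measurable (lebesgue_on K)"
  using borel_measurable_continuous_onI[OF assms]
  by (intro measurable_restrict_space1 measurable_completion) simp

lemma
  assumes Y: "Y \<in> discrete"
  shows integrable_load_cell: "K \<in> \<T> \<Longrightarrow> integrable (lebesgue_on K) \<phi> \<Longrightarrow> integrable (lebesgue_on K) (\<lambda>x. \<phi> x * Y (Cell K) x)"
    and integrable_load_face: "F \<in> mesh_faces \<T> \<Longrightarrow> integrable (face_measure F) g \<Longrightarrow> integrable (face_measure F) (\<lambda>x. g x * Y (Face F) x)"
proof -
  show "integrable (lebesgue_on K) (\<lambda>x. \<phi> x * Y (Cell K) x)" if "K \<in> \<T>" "integrable (lebesgue_on K) \<phi>"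
    using that continuous_cell[OF Y] compact_cell
    by (intro integrable_mult_continuous[where S = K] measurable_cell) (auto simp: space_restrict_space)
  show "integrable (face_measure F) (\<lambda>x. g x * Y (Face F) x)" if "F \<in> mesh_faces \<T>" "integrable (face_measure F) g"
    using that continuous_face[OF Y] compact_mesh_face space_face
    by (intro integrable_mult_continuous[where S = F] measurable_face borel_measurable_continuous_onI) auto
qed

lemma linear_load:
  assumes \<phi>: "\<And>K. K \<in> \<T> \<Longrightarrow> integrable (lebesgue_on K) (\<phi> K)"
    and g: "\<And>F. F \<in> mesh_faces \<T> \<Longrightarrow> F \<subseteq> frontier \<Omega> \<Longrightarrow> integrable (face_measure F) g"
  shows "linear_on_discrete (load \<phi> g)"
proof (rule linear_on_discreteI)
  fix c Y Z assume Y: "Y \<in> discrete" "Z \<in> discrete"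
  have lin: "(\<integral>x. \<psi> x * (c * p x + q x) \<partial>M) = c * (\<integral>x. \<psi> x * p x \<partial>M) + (\<integral>x. \<psi> x * q x \<partial>M)"
    if "integrable M (\<lambda>x. \<psi> x * p x)" "integrable M (\<lambda>x. \<psi> x * q x)" for \<psi> p q :: "real^'n \<Rightarrow> real" and M
  proof -
    have "(\<integral>x. \<psi> x * (c * p x + q x) \<partial>M) = (\<integral>x. c * (\<psi> x * p x) + \<psi> x * q x \<partial>M)"
      by (simp add: algebra_simps)
    also have "\<dots> = c * (\<integral>x. \<psi> x * p x \<partial>M) + (\<integral>x. \<psi> x * q x \<partial>M)" using that by simp
    finally show ?thesis .
  qed
  have cell: "(\<integral>x. \<phi> K x * lincomb c Y Z (Cell K) x \<partial>lebesgue_on K)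
    = c * (\<integral>x. \<phi> K x * Y (Cell K) x \<partial>lebesgue_on K) + (\<integral>x. \<phi> K x * Z (Cell K) x \<partial>lebesgue_on K)" if "K \<in> \<T>" for K
    unfolding lincomb_apply using that Y \<phi> by (intro lin integrable_load_cell) auto
  have face: "(if F \<subseteq> frontier \<Omega> then (\<integral>x. g x * lincomb c Y Z (Face F) x \<partial>face_measure F) else 0)
    = c * (if F \<subseteq> frontier \<Omega> then (\<integral>x. g x * Y (Face F) x \<partial>face_measure F) else 0)
      + (if F \<subseteq> frontier \<Omega> then (\<integral>x. g x * Z (Face F) x \<partial>face_measure F) else 0)"
    if "F \<in> mesh_faces \<T>" for F
  proof (cases "F \<subseteq> frontier \<Omega>")
    case True
    have "(\<integral>x. g x * lincomb c Y Z (Face F) x \<partial>face_measure F)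
      = c * (\<integral>x. g x * Y (Face F) x \<partial>face_measure F) + (\<integral>x. g x * Z (Face F) x \<partial>face_measure F)"
      unfolding lincomb_apply using that Y g True by (intro lin integrable_load_face) auto
    then show ?thesis using True by simp
  qed simp
  have "(\<Sum>F | F facet_of K. if F \<subseteq> frontier \<Omega> then (\<integral>x. g x * lincomb c Y Z (Face F) x \<partial>face_measure F) else 0)
    = c * (\<Sum>F | F facet_of K. if F \<subseteq> frontier \<Omega> then (\<integral>x. g x * Y (Face F) x \<partial>face_measure F) else 0)
      + (\<Sum>F | F facet_of K. if F \<subseteq> frontier \<Omega> then (\<integral>x. g x * Z (Face F) x \<partial>face_measure F) else 0)"
    if "K \<in> \<T>" for K
    unfolding sum_distrib_left sum.distrib[symmetric]
    by (intro sum.cong refl face) (use mesh_facesI[OF that] in simp)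
  then show "load \<phi> g (lincomb c Y Z) = c * load \<phi> g Y + load \<phi> g Z"
    unfolding load_def sum_distrib_left[of c _ \<T>] sum.distrib[symmetric]
    by (intro sum.cong refl) (simp only: cell distrib_left add.assoc add.left_commute add.commute)
qed

lemma load_null:
  assumes N: "null_data Y"
  shows "load \<phi> g Y = 0"
proof -
  have "(\<integral>x. \<phi> K x * Y (Cell K) x \<partial>lebesgue_on K) = 0" if "K \<in> \<T>" for K
    using N that by (simp add: null_data_def)
  moreover have "(\<integral>x. g x * Y (Face F) x \<partial>face_measure F) = 0" if "K \<in> \<T>" "F facet_of K" for K F
  proof (rule integral_eq_zero_AE)
    have "AE x in face_measure F. Y (Face F) x = 0" using N mesh_facesI[OF that] by (simp add: null_data_def)
    then show "AE x in face_measure F. g x * Y (Face F) x = 0" by (rule eventually_mono) simp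
  qed
  ultimately show ?thesis unfolding load_def by (simp add: sum.neutral)
qed

lemma continuous_history:
  assumes "\<And>i. i < j \<Longrightarrow> Xs i \<in> discrete" "1 \<le> j" "K \<in> \<T>"
  shows "continuous_on UNIV (history \<alpha> \<delta> j Xs K)"
  unfolding history_def[abs_def]
  using assms by (intro continuous_intros continuous_cell) auto

lemma linear_step_rhs:
  assumes Xs: "\<And>i. i < j \<Longrightarrow> Xs i \<in> discrete" and j: "1 \<le> j"
    and f: "integrable (lebesgue_on \<Omega>) (half (\<lambda>i y. f y (real i * \<delta>)) j)"
    and g: "\<And>F. F \<in> mesh_faces \<T> \<Longrightarrow> F \<subseteq> frontier \<Omega> \<Longrightarrow> integrable (face_measure F) g"
  shows "linear_on_discrete (step_rhs \<alpha> \<delta> f g j Xs)"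
    and "null_data Y \<Longrightarrow> step_rhs \<alpha> \<delta> f g j Xs Y = 0"
proof -
  have "integrable (lebesgue_on K) (\<lambda>x. half (\<lambda>i y. f y (real i * \<delta>)) j x - history \<alpha> \<delta> j Xs K x)" if "K \<in> \<T>" for K
    by (intro Bochner_Integration.integrable_diff integrable_domain_cell[OF f] integrable_cell continuous_history Xs j that)
  note l = linear_load[OF this g] and p = linear_previous_flux[OF Xs[of "j - 1"]]
  show "linear_on_discrete (step_rhs \<alpha> \<delta> f g j Xs)"
    unfolding step_rhs_def[abs_def]
    using linear_on_discreteD[OF l] linear_on_discreteD[OF p] j by (intro linear_on_discreteI) (simp add: algebra_simps)
  show "step_rhs \<alpha> \<delta> f g j Xs Y = 0" if "null_data Y"
    using that by (simp add: step_rhs_def load_null previous_flux_null)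
qed

definition flux_residual where
  "flux_residual u q uh j r =
     cells_int \<T> (\<lambda>K x. half q j x \<bullet> r x)
     - cells_int \<T> (\<lambda>K x. half u j x * divg (vpiece k K r) x)
     + skeleton_int \<T> (\<lambda>K F x. half uh j x * (vpiece k K r x \<bullet> outward_normal K F))"

definition balance_residual where
  "balance_residual \<alpha> \<delta> f u q uh j w =
     cells_int \<T> (\<lambda>K x. J_op \<alpha> \<delta> u j x * w x)
     - cells_int \<T> (\<lambda>K x. half q j x \<bullet> grad (piece k K w) x)
     + skeleton_int \<T> (\<lambda>K F x. (half (flux k \<tau> u q uh K F) j x \<bullet> outward_normal K F) * piece k K w x)
     - cells_int \<T> (\<lambda>K x. half (\<lambda>i y. f y (real i * \<delta>)) j x * w x)"

definition boundary_residual where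
  "boundary_residual g uh j \<mu> =
     boundary_int \<Omega> \<T> (\<lambda>K F x. uh j x * \<mu> x) - boundary_int \<Omega> \<T> (\<lambda>K F x. g x * \<mu> x)"

definition transmission_residual where
  "transmission_residual u q uh j \<mu> =
     skeleton_int \<T> (\<lambda>K F x. (flux k \<tau> u q uh K F j x \<bullet> outward_normal K F) * \<mu> x)
     - boundary_int \<Omega> \<T> (\<lambda>K F x. (flux k \<tau> u q uh K F j x \<bullet> outward_normal K F) * \<mu> x)"

lemma cn_hdg_solution_residuals:
  "cn_hdg_solution \<Omega> \<T> k \<tau> \<alpha> \<delta> N f g u q uh \<longleftrightarrow> (\<forall>j\<in>{1..N}. (u j, q j, uh j) \<in> spaces \<and>
     (\<forall>r\<in>V_space \<Omega> \<T> k. flux_residual u q uh j r = 0) \<and>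
     (\<forall>w\<in>W_space \<Omega> \<T> k. balance_residual \<alpha> \<delta> f u q uh j w = 0) \<and>
     (\<forall>\<mu>\<in>M_space \<T> k. boundary_residual g uh j \<mu> = 0) \<and>
     (\<forall>\<mu>\<in>M_space \<T> k. transmission_residual u q uh j \<mu> = 0))"
  unfolding cn_hdg_solution_def spaces_def flux_residual_def balance_residual_def boundary_residual_def
    transmission_residual_def mem_Times_iff fst_conv snd_conv right_minus_eq by blast

lemma boundary_int_alt:
  "boundary_int \<Omega> \<T> \<phi> = (\<Sum>K\<in>\<T>. \<Sum>F | F facet_of K.
    if F \<subseteq> frontier \<Omega> then (\<integral>x. \<phi> K F x \<partial>face_measure F) else 0)"
  unfolding boundary_int_def
proof (rule sum.cong[OF refl])
  fix K assume "K \<in> \<T>"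
  from sum.inter_filter[OF finite_facets[OF this], of "\<lambda>F. \<integral>x. \<phi> K F x \<partial>face_measure F" "\<lambda>F. F \<subseteq> frontier \<Omega>"]
  show "(\<Sum>F | F facet_of K \<and> F \<subseteq> frontier \<Omega>. \<integral>x. \<phi> K F x \<partial>face_measure F)
    = (\<Sum>F | F facet_of K. if F \<subseteq> frontier \<Omega> then (\<integral>x. \<phi> K F x \<partial>face_measure F) else 0)" by simp
qed

context
  fixes \<alpha> \<delta> :: real and f :: "real^'n \<Rightarrow> real \<Rightarrow> real" and g :: "real^'n \<Rightarrow> real"
    and u :: "nat \<Rightarrow> real^'n \<Rightarrow> real" and q :: "nat \<Rightarrow> real^'n \<Rightarrow> real^'n" and uh :: "nat \<Rightarrow> real^'n \<Rightarrow> real"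
    and j :: nat
  assumes \<alpha>: "0 < \<alpha>" and \<delta>: "0 < \<delta>" and j: "1 \<le> j"
    and spaces: "\<And>i. i \<le> j \<Longrightarrow> (u i, q i, uh i) \<in> spaces"
    and f: "integrable (lebesgue_on \<Omega>) (half (\<lambda>i y. f y (real i * \<delta>)) j)"
    and g: "\<And>F. F \<in> mesh_faces \<T> \<Longrightarrow> F \<subseteq> frontier \<Omega> \<Longrightarrow> integrable (face_measure F) g"
begin

abbreviation "Xs \<equiv> \<lambda>i. data_of (u i, q i, uh i)"

lemma in_spaces: "i \<le> j \<Longrightarrow> u i \<in> W_space \<Omega> \<T> k" "i \<le> j \<Longrightarrow> q i \<in> V_space \<Omega> \<T> k" "i \<le> j \<Longrightarrow> uh i \<in> M_space \<T> k"
  using spaces by (auto simp: spaces_def)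

lemma Xs_discrete: "i \<le> j \<Longrightarrow> Xs i \<in> discrete"
  using data_of_discrete spaces by blast

lemma normal_flux_AE:
  "K \<in> \<T> \<Longrightarrow> F facet_of K \<Longrightarrow> i \<le> j \<Longrightarrow>
    AE x in face_measure F. flux k \<tau> u q uh K F i x \<bullet> outward_normal K F = numerical_flux (Xs i) K F x"
proof -
  assume K: "K \<in> \<T>" "F facet_of K" and i: "i \<le> j"
  have nn: "outward_normal K F \<bullet> outward_normal K F = 1"
    using norm_outward_normal[OF K] by (simp add: dot_square_norm)
  from face_piece_M(2)[OF in_spaces(3)[OF i] mesh_facesI[OF K]] show ?thesis
    by eventually_elim
      (simp add: flux_def numerical_flux_def normal_flux_def inner_add_left nn, simp add: inner_vec_def)
qed

lemma J_op_pieces: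
  assumes K: "K \<in> \<T>"
  shows "AE x in lebesgue_on K. J_op \<alpha> \<delta> u j x
    = memory_weight \<alpha> \<delta> j j * Xs j (Cell K) x + history \<alpha> \<delta> j Xs K x"
proof -
  have "AE x in lebesgue_on K. \<forall>i\<in>{..j}. u i x = Xs i (Cell K) x"
    using piece_W(2)[OF in_spaces(1) K] by (subst AE_ball_countable) auto
  then show ?thesis
  proof eventually_elim
    case (elim x)
    have "J_op \<alpha> \<delta> u j x = (\<Sum>i=1..j. memory_weight \<alpha> \<delta> j i * (Xs i (Cell K) x - Xs (i - 1) (Cell K) x))"
      unfolding J_op_eq[OF \<alpha> \<delta> j] using elim by (intro sum.cong refl) (auto simp del: data_of_simps)
    also have "{1..j} = insert j {1..<j}" using j by auto
    finally show ?case by (simp add: history_def algebra_simps)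
  qed
qed

text \<open>Almost everywhere on a cell or face the discrete functions equal their polynomial pieces, and the
  averages split into new and previous values. This gives \<open>residual_identity\<close> cell by cell and facet by
  facet.\<close>

lemma cell_residual:
  fixes w :: "real^'n \<Rightarrow> real" and r :: "real^'n \<Rightarrow> real^'n" and \<mu> :: "real^'n \<Rightarrow> real"
  assumes K: "K \<in> \<T>" and z: "w \<in> W_space \<Omega> \<T> k" "r \<in> V_space \<Omega> \<T> k"
  defines "Y \<equiv> data_of (w, r, \<mu>)" and "\<beta> \<equiv> memory_weight \<alpha> \<delta> j j"
  assumes Y: "Y \<in> discrete"
  shows "(\<integral>x. half q j x \<bullet> r x \<partial>lebesgue_on K) - (\<integral>x. half u j x * divg (vpiece k K r) x \<partial>lebesgue_on K)
      + ((\<integral>x. J_op \<alpha> \<delta> u j x * w x \<partial>lebesgue_on K) - (\<integral>x. half q j x \<bullet> grad (piece k K w) x \<partial>lebesgue_on K)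
      - (\<integral>x. half (\<lambda>i y. f y (real i * \<delta>)) j x * w x \<partial>lebesgue_on K))
    = (\<integral>x. cell_form \<beta> (Xs j) Y K x \<partial>lebesgue_on K) + (\<integral>x. cell_form 0 (Xs (j - 1)) Y K x \<partial>lebesgue_on K)
      - (\<integral>x. (half (\<lambda>i y. f y (real i * \<delta>)) j x - history \<alpha> \<delta> j Xs K x) * Y (Cell K) x \<partial>lebesgue_on K)"
proof -
  let ?M = "lebesgue_on K" and ?X = "Xs j" and ?P = "Xs (j - 1)"
  have j1: "j - 1 \<le> j" by simp
  note X = Xs_discrete[OF order_refl] and P = Xs_discrete[OF j1]
  define a where "a x = (\<Sum>i\<in>UNIV. 1/2 * (?X (Flux K i) x + ?P (Flux K i) x) * Y (Flux K i) x)" for x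
  define b where "b x = (\<Sum>i\<in>UNIV. 1/2 * (?X (Cell K) x + ?P (Cell K) x) * partial (Y (Flux K i)) i x)" for x
  define c where "c x = (\<beta> * ?X (Cell K) x + history \<alpha> \<delta> j Xs K x) * Y (Cell K) x" for x
  define d where "d x = (\<Sum>i\<in>UNIV. 1/2 * (?X (Flux K i) x + ?P (Flux K i) x) * partial (Y (Cell K)) i x)" for x
  define F where "F x = half (\<lambda>i y. f y (real i * \<delta>)) j x" for x
  define h where "h = history \<alpha> \<delta> j Xs K"
  note cont = continuous_intros continuous_data[OF X] continuous_data[OF P] continuous_data[OF Y]
  have h_cont: "continuous_on UNIV h" unfolding h_def
    by (rule continuous_history[OF Xs_discrete j K]) simp
  have conts: "continuous_on UNIV a" "continuous_on UNIV b" "continuous_on UNIV c" "continuous_on UNIV d"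
    unfolding a_def[abs_def] b_def[abs_def] c_def[abs_def] d_def[abs_def] h_def[symmetric]
    by (intro cont K h_cont)+
  have Fint: "integrable ?M F" unfolding F_def[abs_def] by (rule integrable_domain_cell[OF f K])
  have qAE: "AE x in ?M. q j x = vpiece k K (q j) x \<and> q (j - 1) x = vpiece k K (q (j - 1)) x"
    using vpiece_V(2)[OF in_spaces(2)[OF order_refl] K] vpiece_V(2)[OF in_spaces(2)[OF j1] K]
    by eventually_elim simp
  have uAE: "AE x in ?M. u j x = piece k K (u j) x \<and> u (j - 1) x = piece k K (u (j - 1)) x"
    using piece_W(2)[OF in_spaces(1)[OF order_refl] K] piece_W(2)[OF in_spaces(1)[OF j1] K]
    by eventually_elim simp
  have meas: "v \<in> borel_measurable ?M" if "AE x in ?M. v x = p x" "continuous_on UNIV p" for v p :: "real^'n \<Rightarrow> real"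
  proof -
    have p: "p \<in> borel_measurable ?M" by (rule measurable_cell[OF that(2)])
    have KL: "K \<in> sets lebesgue" by (rule cell_lebesgue[OF K])
    have "(\<lambda>x. indicator K x *\<^sub>R p x) \<in> borel_measurable lebesgue"
      using p KL by (subst (asm) borel_measurable_restrict_space_iff) auto
    moreover have "AE x in lebesgue. indicator K x *\<^sub>R p x = indicator K x *\<^sub>R v x"
      using that(1) KL by (subst (asm) AE_restrict_space_iff) (auto elim!: eventually_mono simp: indicator_def)
    ultimately have "(\<lambda>x. indicator K x *\<^sub>R v x) \<in> borel_measurable lebesgue"
      by (rule borel_measurable_AE)
    then show ?thesis using KL by (subst borel_measurable_restrict_space_iff) auto
  qed
  have cong: "(\<integral>x. v x \<partial>?M) = (\<integral>x. p x \<partial>?M)" if "AE x in ?M. v x = p x" "continuous_on UNIV p"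
    for v p :: "real^'n \<Rightarrow> real"
    by (intro integral_cong_AE that meas[OF that] measurable_cell)
  have A: "(\<integral>x. half q j x \<bullet> r x \<partial>?M) = (\<integral>x. a x \<partial>?M)"
  proof (rule cong[OF _ conts(1)])
    show "AE x in ?M. half q j x \<bullet> r x = a x"
      using qAE vpiece_V(2)[OF z(2) K]
      by eventually_elim (simp add: half_def a_def Y_def inner_vec_def)
  qed
  have B: "(\<integral>x. half u j x * divg (vpiece k K r) x \<partial>?M) = (\<integral>x. b x \<partial>?M)"
  proof (rule cong[OF _ conts(2)])
    show "AE x in ?M. half u j x * divg (vpiece k K r) x = b x"
      using uAE by eventually_elim
        (simp add: half_def b_def Y_def divg_vpolys[OF vpiece_V(1)[OF z(2) K]] sum_distrib_left)
  qed
  have Cc: "(\<integral>x. J_op \<alpha> \<delta> u j x * w x \<partial>?M) = (\<integral>x. c x \<partial>?M)"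
  proof (rule cong[OF _ conts(3)])
    show "AE x in ?M. J_op \<alpha> \<delta> u j x * w x = c x"
      using J_op_pieces[OF K] piece_W(2)[OF z(1) K]
      by eventually_elim (simp add: c_def Y_def \<beta>_def)
  qed
  have D: "(\<integral>x. half q j x \<bullet> grad (piece k K w) x \<partial>?M) = (\<integral>x. d x \<partial>?M)"
  proof (rule cong[OF _ conts(4)])
    show "AE x in ?M. half q j x \<bullet> grad (piece k K w) x = d x"
      using qAE by eventually_elim (simp add: half_def d_def Y_def inner_vec_def grad_def partial_def)
  qed
  have Fw: "(\<integral>x. half (\<lambda>i y. f y (real i * \<delta>)) j x * w x \<partial>?M) = (\<integral>x. F x * Y (Cell K) x \<partial>?M)"
  proof (rule integral_cong_AE)
    have ae: "AE x in ?M. w x = Y (Cell K) x" using piece_W(2)[OF z(1) K] by (simp add: Y_def)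
    show "AE x in ?M. half (\<lambda>i y. f y (real i * \<delta>)) j x * w x = F x * Y (Cell K) x"
      using ae by eventually_elim (simp add: F_def)
    show "(\<lambda>x. half (\<lambda>i y. f y (real i * \<delta>)) j x * w x) \<in> borel_measurable ?M"
      using Fint meas[OF ae continuous_cell[OF Y K]] unfolding F_def[abs_def] by measurable
    show "(\<lambda>x. F x * Y (Cell K) x) \<in> borel_measurable ?M"
      using Fint measurable_cell[OF continuous_cell[OF Y K]] by measurable
  qed
  have ints: "integrable ?M a" "integrable ?M b" "integrable ?M c" "integrable ?M d"
    using conts by (auto intro: integrable_cell K)
  have hw: "integrable ?M (\<lambda>x. h x * Y (Cell K) x)" by (intro integrable_cell cont K h_cont)
  have Fw_int: "integrable ?M (\<lambda>x. F x * Y (Cell K) x)" by (rule integrable_load_cell[OF Y K Fint])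
  have pt: "a x - b x + c x - d x - h x * Y (Cell K) x = cell_form \<beta> ?X Y K x + cell_form 0 ?P Y K x" for x
  proof -
    have "a x - b x - d x = 1/2 * (\<Sum>i\<in>UNIV. ?X (Flux K i) x * Y (Flux K i) x
        - ?X (Cell K) x * partial (Y (Flux K i)) i x - ?X (Flux K i) x * partial (Y (Cell K)) i x)
      + 1/2 * (\<Sum>i\<in>UNIV. ?P (Flux K i) x * Y (Flux K i) x
        - ?P (Cell K) x * partial (Y (Flux K i)) i x - ?P (Flux K i) x * partial (Y (Cell K)) i x)"
      unfolding a_def b_def d_def sum_distrib_left sum.distrib[symmetric] sum_subtractf[symmetric]
      by (intro sum.cong refl) (simp add: field_simps)
    then show ?thesis unfolding cell_form_def c_def h_def by (simp add: algebra_simps)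
  qed
  have "(\<integral>x. a x \<partial>?M) - (\<integral>x. b x \<partial>?M) + ((\<integral>x. c x \<partial>?M) - (\<integral>x. d x \<partial>?M) - (\<integral>x. F x * Y (Cell K) x \<partial>?M))
    = (\<integral>x. a x - b x + c x - d x - h x * Y (Cell K) x \<partial>?M)
      - ((\<integral>x. F x * Y (Cell K) x \<partial>?M) - (\<integral>x. h x * Y (Cell K) x \<partial>?M))"
    using ints hw by simp
  also have "(\<integral>x. F x * Y (Cell K) x \<partial>?M) - (\<integral>x. h x * Y (Cell K) x \<partial>?M) = (\<integral>x. (F x - h x) * Y (Cell K) x \<partial>?M)"
    using Fw_int hw by (simp add: left_diff_distrib)
  also have "(\<integral>x. a x - b x + c x - d x - h x * Y (Cell K) x \<partial>?M)
    = (\<integral>x. cell_form \<beta> ?X Y K x \<partial>?M) + (\<integral>x. cell_form 0 ?P Y K x \<partial>?M)"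
    unfolding pt by (intro Bochner_Integration.integral_add integrable_cell_form X P Y K)
  finally show ?thesis unfolding A B Cc D Fw by (simp only: F_def h_def)
qed

lemma face_residual:
  fixes w :: "real^'n \<Rightarrow> real" and r :: "real^'n \<Rightarrow> real^'n" and \<mu> :: "real^'n \<Rightarrow> real"
  assumes K: "K \<in> \<T>" and F: "F facet_of K" and z: "\<mu> \<in> M_space \<T> k"
  defines "Y \<equiv> data_of (w, r, \<mu>)"
  assumes Y: "Y \<in> discrete"
  shows "(\<integral>x. half uh j x * (vpiece k K r x \<bullet> outward_normal K F) \<partial>face_measure F)
      + (\<integral>x. (half (flux k \<tau> u q uh K F) j x \<bullet> outward_normal K F) * piece k K w x \<partial>face_measure F)
      + ((if F \<subseteq> frontier \<Omega> then (\<integral>x. uh j x * \<mu> x \<partial>face_measure F) else 0)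
         - (if F \<subseteq> frontier \<Omega> then (\<integral>x. g x * \<mu> x \<partial>face_measure F) else 0))
      - 1/2 * ((\<integral>x. (flux k \<tau> u q uh K F j x \<bullet> outward_normal K F) * \<mu> x \<partial>face_measure F)
         - (if F \<subseteq> frontier \<Omega> then (\<integral>x. (flux k \<tau> u q uh K F j x \<bullet> outward_normal K F) * \<mu> x \<partial>face_measure F) else 0))
    = (\<integral>x. trace_form (Xs j) Y K F x + skeleton_form (Xs j) Y K F x \<partial>face_measure F)
      + (\<integral>x. trace_form (Xs (j - 1)) Y K F x \<partial>face_measure F)
      - (if F \<subseteq> frontier \<Omega> then (\<integral>x. g x * Y (Face F) x \<partial>face_measure F) else 0)"
proof -
  let ?M = "face_measure F" and ?X = "Xs j" and ?P = "Xs (j - 1)"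
  have Fm: "F \<in> mesh_faces \<T>" by (rule mesh_facesI[OF K F])
  have j1: "j - 1 \<le> j" by simp
  note X = Xs_discrete[OF order_refl] and P = Xs_discrete[OF j1]
  note cont = continuous_intros continuous_data[OF X] continuous_data[OF P] continuous_data[OF Y]
    continuous_numerical_flux[OF X] continuous_numerical_flux[OF P]
  have uhM: "uh i \<in> borel_measurable ?M" if "i \<le> j" for i
    using in_spaces(3)[OF that] Fm by (auto simp: M_space_def L2_fun_def)
  have \<mu>M: "\<mu> \<in> borel_measurable ?M" using z Fm by (auto simp: M_space_def L2_fun_def)
  have cM: "p \<in> borel_measurable ?M" if "continuous_on UNIV p" for p :: "real^'n \<Rightarrow> real"
    using that by (intro measurable_face[OF Fm] borel_measurable_continuous_onI)
  have nn: "outward_normal K F \<bullet> outward_normal K F = 1"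
    using norm_outward_normal[OF K F] by (simp add: dot_square_norm)
  have uhAE: "AE x in ?M. uh j x = ?X (Face F) x \<and> uh (j - 1) x = ?P (Face F) x"
    using face_piece_M(2)[OF in_spaces(3)[OF order_refl] Fm] face_piece_M(2)[OF in_spaces(3)[OF j1] Fm]
    by eventually_elim simp
  have \<mu>AE: "AE x in ?M. \<mu> x = Y (Face F) x" using face_piece_M(2)[OF z Fm] by (simp add: Y_def)
  have nf: "vpiece k K r x \<bullet> outward_normal K F = normal_flux Y K F x" for x
    by (simp add: normal_flux_def Y_def inner_vec_def)
  have fluxM: "(\<lambda>x. flux k \<tau> u q uh K F i x \<bullet> outward_normal K F) \<in> borel_measurable ?M" if i: "i \<le> j" for i
  proof -
    have "flux k \<tau> u q uh K F i x \<bullet> outward_normal K F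
      = normal_flux (Xs i) K F x + \<tau> K F * (Xs i (Cell K) x - uh i x)" for x
      unfolding flux_def inner_add_left inner_scaleR_left nn by (simp add: normal_flux_def inner_vec_def)
    moreover have "normal_flux (Xs i) K F \<in> borel_measurable ?M" "Xs i (Cell K) \<in> borel_measurable ?M"
      using continuous_normal_flux[OF Xs_discrete[OF i] K] continuous_cell[OF Xs_discrete[OF i] K] cM by blast+
    ultimately show ?thesis using uhM[OF i] by simp
  qed
  define c where "c x = 1/2 * (?X (Face F) x + ?P (Face F) x) * normal_flux Y K F x" for x
  define d where "d x = 1/2 * (numerical_flux ?X K F x + numerical_flux ?P K F x) * Y (Cell K) x" for x
  define m where "m x = ?X (Face F) x * Y (Face F) x" for x
  define h where "h x = numerical_flux ?X K F x * Y (Face F) x" for x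
  have conts: "continuous_on UNIV c" "continuous_on UNIV d" "continuous_on UNIV m" "continuous_on UNIV h"
    unfolding c_def[abs_def] d_def[abs_def] m_def[abs_def] h_def[abs_def] by (intro cont K Fm)+
  have Cc: "(\<integral>x. half uh j x * (vpiece k K r x \<bullet> outward_normal K F) \<partial>?M) = (\<integral>x. c x \<partial>?M)"
  proof (rule integral_cong_AE)
    show "AE x in ?M. half uh j x * (vpiece k K r x \<bullet> outward_normal K F) = c x"
      using uhAE by eventually_elim (simp add: half_def c_def nf)
    have "normal_flux Y K F \<in> borel_measurable ?M" by (rule cM[OF continuous_normal_flux[OF Y K]])
    then show "(\<lambda>x. half uh j x * (vpiece k K r x \<bullet> outward_normal K F)) \<in> borel_measurable ?M"
      unfolding nf half_def using uhM[of j] uhM[of "j - 1"] by simp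
  qed (rule cM[OF conts(1)])
  have D: "(\<integral>x. (half (flux k \<tau> u q uh K F) j x \<bullet> outward_normal K F) * piece k K w x \<partial>?M) = (\<integral>x. d x \<partial>?M)"
  proof (rule integral_cong_AE)
    show "AE x in ?M. (half (flux k \<tau> u q uh K F) j x \<bullet> outward_normal K F) * piece k K w x = d x"
      using normal_flux_AE[OF K F order_refl] normal_flux_AE[OF K F j1]
      by eventually_elim (simp add: half_def d_def Y_def inner_add_left)
    have "Y (Cell K) \<in> borel_measurable ?M" by (rule cM[OF continuous_cell[OF Y K]])
    then have "piece k K w \<in> borel_measurable ?M" by (simp add: Y_def)
    then show "(\<lambda>x. (half (flux k \<tau> u q uh K F) j x \<bullet> outward_normal K F) * piece k K w x) \<in> borel_measurable ?M"
      unfolding half_def inner_scaleR_left inner_add_left using fluxM[of j] fluxM[of "j - 1"] by simp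
  qed (rule cM[OF conts(2)])
  have Mm: "(\<integral>x. uh j x * \<mu> x \<partial>?M) = (\<integral>x. m x \<partial>?M)"
  proof (rule integral_cong_AE)
    show "AE x in ?M. uh j x * \<mu> x = m x" using uhAE \<mu>AE by eventually_elim (simp add: m_def)
  qed (use uhM[of j] \<mu>M cM[OF conts(3)] in auto)
  have G: "(\<integral>x. g x * \<mu> x \<partial>?M) = (\<integral>x. g x * Y (Face F) x \<partial>?M)" if "F \<subseteq> frontier \<Omega>"
  proof (rule integral_cong_AE)
    show "AE x in ?M. g x * \<mu> x = g x * Y (Face F) x" using \<mu>AE by eventually_elim simp
  qed (use g[OF Fm that] \<mu>M cM[OF continuous_face[OF Y Fm]] in auto)
  have H: "(\<integral>x. (flux k \<tau> u q uh K F j x \<bullet> outward_normal K F) * \<mu> x \<partial>?M) = (\<integral>x. h x \<partial>?M)"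
  proof (rule integral_cong_AE)
    show "AE x in ?M. (flux k \<tau> u q uh K F j x \<bullet> outward_normal K F) * \<mu> x = h x"
      using normal_flux_AE[OF K F order_refl] \<mu>AE by eventually_elim (simp add: h_def)
  qed (use fluxM[of j] \<mu>M cM[OF conts(4)] in auto)
  have ints: "integrable ?M c" "integrable ?M d" "integrable ?M m" "integrable ?M h"
    using conts by (auto intro: integrable_face Fm)
  note forms = integrable_trace_form[OF X Y K Fm] integrable_skeleton_form[OF X Y K Fm] integrable_trace_form[OF P Y K Fm]
  have cd: "(\<integral>x. c x \<partial>?M) + (\<integral>x. d x \<partial>?M)
    = (\<integral>x. trace_form ?X Y K F x \<partial>?M) + (\<integral>x. trace_form ?P Y K F x \<partial>?M)"
  proof -
    have "(\<integral>x. c x \<partial>?M) + (\<integral>x. d x \<partial>?M) = (\<integral>x. c x + d x \<partial>?M)" using ints by simp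
    also have "\<dots> = (\<integral>x. trace_form ?X Y K F x + trace_form ?P Y K F x \<partial>?M)"
      by (intro Bochner_Integration.integral_cong refl) (simp add: c_def d_def trace_form_def field_simps)
    also have "\<dots> = (\<integral>x. trace_form ?X Y K F x \<partial>?M) + (\<integral>x. trace_form ?P Y K F x \<partial>?M)"
      using forms by simp
    finally show ?thesis .
  qed
  have skel: "(\<integral>x. skeleton_form ?X Y K F x \<partial>?M) = (if F \<subseteq> frontier \<Omega> then (\<integral>x. m x \<partial>?M) else - 1/2 * (\<integral>x. h x \<partial>?M))"
    by (simp add: skeleton_form_def m_def h_def)
  have split: "(\<integral>x. trace_form ?X Y K F x + skeleton_form ?X Y K F x \<partial>?M)
    = (\<integral>x. trace_form ?X Y K F x \<partial>?M) + (\<integral>x. skeleton_form ?X Y K F x \<partial>?M)"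
    using forms by simp
  show ?thesis
    unfolding Cc D Mm H split skel using cd G by (cases "F \<subseteq> frontier \<Omega>") simp_all
qed

text \<open>The weights \<open>1, 1, 1, -1/2\<close> of the four residuals are those built into \<open>form\<close>.\<close>

theorem residual_identity:
  assumes z: "(w, r, \<mu>) \<in> spaces"
  shows "flux_residual u q uh j r + balance_residual \<alpha> \<delta> f u q uh j w
      + boundary_residual g uh j \<mu> - 1/2 * transmission_residual u q uh j \<mu>
    = form (memory_weight \<alpha> \<delta> j j) (Xs j) (data_of (w, r, \<mu>)) - step_rhs \<alpha> \<delta> f g j Xs (data_of (w, r, \<mu>))"
proof -
  let ?Y = "data_of (w, r, \<mu>)"
  have Y: "?Y \<in> discrete" by (rule data_of_discrete[OF z])
  have w: "w \<in> W_space \<Omega> \<T> k" and r: "r \<in> V_space \<Omega> \<T> k" and \<mu>: "\<mu> \<in> M_space \<T> k"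
    using z by (auto simp: spaces_def)
  have "flux_residual u q uh j r + balance_residual \<alpha> \<delta> f u q uh j w
      + boundary_residual g uh j \<mu> - 1/2 * transmission_residual u q uh j \<mu>
    = (\<Sum>K\<in>\<T>. ((\<integral>x. half q j x \<bullet> r x \<partial>lebesgue_on K) - (\<integral>x. half u j x * divg (vpiece k K r) x \<partial>lebesgue_on K)
      + ((\<integral>x. J_op \<alpha> \<delta> u j x * w x \<partial>lebesgue_on K) - (\<integral>x. half q j x \<bullet> grad (piece k K w) x \<partial>lebesgue_on K)
      - (\<integral>x. half (\<lambda>i y. f y (real i * \<delta>)) j x * w x \<partial>lebesgue_on K)))
      + (\<Sum>F | F facet_of K. (\<integral>x. half uh j x * (vpiece k K r x \<bullet> outward_normal K F) \<partial>face_measure F)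
      + (\<integral>x. (half (flux k \<tau> u q uh K F) j x \<bullet> outward_normal K F) * piece k K w x \<partial>face_measure F)
      + ((if F \<subseteq> frontier \<Omega> then (\<integral>x. uh j x * \<mu> x \<partial>face_measure F) else 0)
         - (if F \<subseteq> frontier \<Omega> then (\<integral>x. g x * \<mu> x \<partial>face_measure F) else 0))
      - 1/2 * ((\<integral>x. (flux k \<tau> u q uh K F j x \<bullet> outward_normal K F) * \<mu> x \<partial>face_measure F)
         - (if F \<subseteq> frontier \<Omega> then (\<integral>x. (flux k \<tau> u q uh K F j x \<bullet> outward_normal K F) * \<mu> x \<partial>face_measure F) else 0))))"
    unfolding flux_residual_def balance_residual_def boundary_residual_def transmission_residual_def
      cells_int_def skeleton_int_def
    by (simp only: boundary_int_alt sum.distrib sum_subtractf sum_distrib_left[symmetric])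
  also have "\<dots> = (\<Sum>K\<in>\<T>. ((\<integral>x. cell_form (memory_weight \<alpha> \<delta> j j) (Xs j) ?Y K x \<partial>lebesgue_on K)
      + (\<integral>x. cell_form 0 (Xs (j - 1)) ?Y K x \<partial>lebesgue_on K)
      - (\<integral>x. (half (\<lambda>i y. f y (real i * \<delta>)) j x - history \<alpha> \<delta> j Xs K x) * ?Y (Cell K) x \<partial>lebesgue_on K))
      + (\<Sum>F | F facet_of K. (\<integral>x. trace_form (Xs j) ?Y K F x + skeleton_form (Xs j) ?Y K F x \<partial>face_measure F)
      + (\<integral>x. trace_form (Xs (j - 1)) ?Y K F x \<partial>face_measure F)
      - (if F \<subseteq> frontier \<Omega> then (\<integral>x. g x * ?Y (Face F) x \<partial>face_measure F) else 0)))"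
    by (intro sum.cong refl arg_cong2[where f = "(+)"] cell_residual[OF _ w r Y] face_residual[OF _ _ \<mu> Y]) auto
  also have "\<dots> = form (memory_weight \<alpha> \<delta> j j) (Xs j) ?Y - step_rhs \<alpha> \<delta> f g j Xs ?Y"
    unfolding form_def step_rhs_def load_def previous_flux_def
    by (simp only: sum.distrib sum_subtractf)
  finally show ?thesis .
qed

end

end

section \<open>Existence and uniqueness for the scheme\<close>

context hdg_scheme
begin

lemma zero_spaces: "(\<lambda>x. 0) \<in> W_space \<Omega> \<T> k" "(\<lambda>x. 0) \<in> V_space \<Omega> \<T> k" "(\<lambda>x. 0) \<in> M_space \<T> k"
proof -
  show "(\<lambda>x. 0) \<in> W_space \<Omega> \<T> k" "(\<lambda>x. 0) \<in> M_space \<T> k"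
    by (auto simp: W_space_def M_space_def L2_fun_def intro!: polys_zero bexI[of _ "\<lambda>x. 0"])
  have "(\<lambda>x. 0) \<in> vpolys k" by (simp add: vpolys_def polys_zero)
  then show "(\<lambda>x. 0) \<in> V_space \<Omega> \<T> k"
    by (auto simp: V_space_def L2_fun_def intro!: bexI[of _ "\<lambda>x. 0"])
qed

lemma zero_pieces:
  assumes "K \<in> \<T>"
  shows "piece k K (\<lambda>x. 0) = (\<lambda>x. 0)" "vpiece k K (\<lambda>x. 0) = (\<lambda>x. 0)"
  using assms by (auto intro!: piece_eqI vpiece_eqI simp: polys_zero vpolys_def)

lemma residuals_zero:
  "flux_residual u q uh j (\<lambda>x. 0) = 0" "balance_residual \<alpha> \<delta> f u q uh j (\<lambda>x. 0) = 0"
  "boundary_residual g uh j (\<lambda>x. 0) = 0" "transmission_residual u q uh j (\<lambda>x. 0) = 0"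
proof -
  have [simp]: "grad (\<lambda>x. 0) x = 0" "divg (\<lambda>x. 0) x = 0" for x :: "real^'n"
    by (simp_all add: grad_def divg_def frechet_derivative_const vec_eq_iff)
  show "flux_residual u q uh j (\<lambda>x. 0) = 0" "balance_residual \<alpha> \<delta> f u q uh j (\<lambda>x. 0) = 0"
    by (simp_all add: flux_residual_def balance_residual_def cells_int_def skeleton_int_def zero_pieces)
  show "boundary_residual g uh j (\<lambda>x. 0) = 0" "transmission_residual u q uh j (\<lambda>x. 0) = 0"
    by (simp_all add: boundary_residual_def transmission_residual_def boundary_int_def skeleton_int_def)
qed

text \<open>The Dirichlet condition lives on the boundary faces and the transmission condition on the others, so
  test functions cut off in this way separate the two conditions in their sum.\<close>

lemma boundary_cutoff:
  assumes \<mu>: "\<mu> \<in> M_space \<T> k"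
  shows "\<exists>\<nu>\<in>M_space \<T> k. \<forall>F\<in>mesh_faces \<T>. AE x in face_measure F. \<nu> x = (if F \<subseteq> frontier \<Omega> then \<mu> x else 0)"
proof -
  define X :: "'n data" where
    "X \<kappa> = (case \<kappa> of Face F \<Rightarrow> if F \<subseteq> frontier \<Omega> then face_piece k F \<mu> else (\<lambda>x. 0) | _ \<Rightarrow> (\<lambda>x. 0))" for \<kappa>
  have "X \<in> discrete" by (rule discreteI) (auto simp: X_def polys_zero face_piece_M[OF \<mu>])
  from glue[OF this] obtain w r \<nu> where z: "(w, r, \<nu>) \<in> spaces" "null_data (lincomb (-1) X (data_of (w, r, \<nu>)))"
    by (metis prod_cases3)
  have \<nu>: "\<nu> \<in> M_space \<T> k" using z by (simp add: spaces_def)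
  have "AE x in face_measure F. \<nu> x = (if F \<subseteq> frontier \<Omega> then \<mu> x else 0)" if F: "F \<in> mesh_faces \<T>" for F
  proof -
    have "AE x in face_measure F. lincomb (-1) X (data_of (w, r, \<nu>)) (Face F) x = 0"
      using z(2) F by (simp add: null_data_def)
    with face_piece_M(2)[OF \<nu> F] face_piece_M(2)[OF \<mu> F] show ?thesis
      by eventually_elim (auto simp: lincomb_apply X_def split: if_splits)
  qed
  then show ?thesis using \<nu> by blast
qed

text \<open>The test functions of the four equations vary independently, so setting some of them to zero
  recovers the equations from their weighted sum; the two conditions on the faces, which share a test
  function, are separated by \<open>boundary_cutoff\<close>.\<close>

lemma scheme_step_iff:
  assumes \<alpha>: "0 < \<alpha>" and \<delta>: "0 < \<delta>" and j: "1 \<le> j"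
    and sp: "\<And>i. i \<le> j \<Longrightarrow> (u i, q i, uh i) \<in> spaces"
    and f: "integrable (lebesgue_on \<Omega>) (half (\<lambda>i y. f y (real i * \<delta>)) j)"
    and g: "\<And>F. F \<in> mesh_faces \<T> \<Longrightarrow> F \<subseteq> frontier \<Omega> \<Longrightarrow> integrable (face_measure F) g"
  shows "(\<forall>r\<in>V_space \<Omega> \<T> k. flux_residual u q uh j r = 0) \<and>
     (\<forall>w\<in>W_space \<Omega> \<T> k. balance_residual \<alpha> \<delta> f u q uh j w = 0) \<and>
     (\<forall>\<mu>\<in>M_space \<T> k. boundary_residual g uh j \<mu> = 0) \<and>
     (\<forall>\<mu>\<in>M_space \<T> k. transmission_residual u q uh j \<mu> = 0) \<longleftrightarrow>
     (\<forall>Y\<in>discrete. form (memory_weight \<alpha> \<delta> j j) (data_of (u j, q j, uh j)) Y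
       = step_rhs \<alpha> \<delta> f g j (\<lambda>i. data_of (u i, q i, uh i)) Y)" (is "?residuals \<longleftrightarrow> ?form")
proof
  let ?Xs = "\<lambda>i. data_of (u i, q i, uh i)"
  have id: "flux_residual u q uh j r + balance_residual \<alpha> \<delta> f u q uh j w
      + boundary_residual g uh j \<mu> - 1/2 * transmission_residual u q uh j \<mu>
      = form (memory_weight \<alpha> \<delta> j j) (?Xs j) (data_of (w, r, \<mu>)) - step_rhs \<alpha> \<delta> f g j ?Xs (data_of (w, r, \<mu>))"
    if "(w, r, \<mu>) \<in> spaces" for w r \<mu>
    using that by (intro residual_identity \<alpha> \<delta> j sp f g)
  have Xs: "?Xs i \<in> discrete" if "i \<le> j" for i using data_of_discrete sp that by blast
  {
    assume R: ?residuals
    let ?G = "\<lambda>Y. form (memory_weight \<alpha> \<delta> j j) (?Xs j) Y - step_rhs \<alpha> \<delta> f g j ?Xs Y"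
    have rhs: "linear_on_discrete (step_rhs \<alpha> \<delta> f g j ?Xs)" "\<And>Y. null_data Y \<Longrightarrow> step_rhs \<alpha> \<delta> f g j ?Xs Y = 0"
      using linear_step_rhs[OF Xs j f g] by auto
    have lin: "linear_on_discrete ?G"
      using form_lincomb(1)[OF Xs[OF order_refl]] linear_on_discreteD[OF rhs(1)]
      by (intro linear_on_discreteI) (simp add: algebra_simps)
    show ?form
    proof
      fix Y assume Y: "Y \<in> discrete"
      obtain w r \<mu> where z: "(w, r, \<mu>) \<in> spaces" "null_data (lincomb (-1) Y (data_of (w, r, \<mu>)))"
        using glue[OF Y] by (metis prod_cases3)
      have "?G Y = ?G (data_of (w, r, \<mu>))"
        by (rule linear_null_diff[OF lin _ Y data_of_discrete[OF z(1)] z(2)]) (simp add: form_null rhs(2))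
      also have "\<dots> = 0" using id[OF z(1)] R z(1) by (simp add: spaces_def)
      finally show "form (memory_weight \<alpha> \<delta> j j) (?Xs j) Y = step_rhs \<alpha> \<delta> f g j ?Xs Y" by simp
    qed
  }
  assume E: ?form
  have res: "flux_residual u q uh j r + balance_residual \<alpha> \<delta> f u q uh j w
      + boundary_residual g uh j \<mu> - 1/2 * transmission_residual u q uh j \<mu> = 0"
    if "w \<in> W_space \<Omega> \<T> k" "r \<in> V_space \<Omega> \<T> k" "\<mu> \<in> M_space \<T> k" for w r \<mu>
  proof -
    have z: "(w, r, \<mu>) \<in> spaces" using that by (simp add: spaces_def)
    show ?thesis using id[OF z] E data_of_discrete[OF z] by simp
  qed
  have mu: "boundary_residual g uh j \<mu> - 1/2 * transmission_residual u q uh j \<mu> = 0" if "\<mu> \<in> M_space \<T> k" for \<mu>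
    using res[OF zero_spaces(1,2) that] by (simp add: residuals_zero)
  have b: "boundary_residual g uh j \<mu> = 0" if \<mu>: "\<mu> \<in> M_space \<T> k" for \<mu>
  proof -
    obtain \<nu> where \<nu>: "\<nu> \<in> M_space \<T> k"
      and ae: "\<And>F. F \<in> mesh_faces \<T> \<Longrightarrow> AE x in face_measure F. \<nu> x = (if F \<subseteq> frontier \<Omega> then \<mu> x else 0)"
      using boundary_cutoff[OF \<mu>] by blast
    have int: "(\<integral>x. \<psi> x * \<nu> x \<partial>face_measure F) = (if F \<subseteq> frontier \<Omega> then (\<integral>x. \<psi> x * \<mu> x \<partial>face_measure F) else 0)"
      if F: "F \<in> mesh_faces \<T>" and \<psi>: "F \<subseteq> frontier \<Omega> \<Longrightarrow> \<psi> \<in> borel_measurable (face_measure F)" for \<psi> F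
    proof (cases "F \<subseteq> frontier \<Omega>")
      case True
      have m: "\<mu> \<in> borel_measurable (face_measure F)" "\<nu> \<in> borel_measurable (face_measure F)"
        using \<mu> \<nu> F by (auto simp: M_space_def L2_fun_def)
      have "AE x in face_measure F. \<psi> x * \<nu> x = \<psi> x * \<mu> x" using ae[OF F] by eventually_elim (simp add: True)
      then have "(\<integral>x. \<psi> x * \<nu> x \<partial>face_measure F) = (\<integral>x. \<psi> x * \<mu> x \<partial>face_measure F)"
        using m \<psi>[OF True] by (intro integral_cong_AE) auto
      then show ?thesis using True by simp
    next
      case False
      then have "AE x in face_measure F. \<psi> x * \<nu> x = 0" using ae[OF F] by (auto elim: eventually_mono)
      then show ?thesis using False by (simp add: integral_eq_zero_AE)
    qed
    have uh: "uh j \<in> borel_measurable (face_measure F)" if "F \<in> mesh_faces \<T>" for F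
      using sp[of j] that by (auto simp: spaces_def M_space_def L2_fun_def)
    have "boundary_residual g uh j \<nu> = boundary_residual g uh j \<mu>"
    proof -
      have "boundary_int \<Omega> \<T> (\<lambda>K F x. \<psi> x * \<nu> x) = boundary_int \<Omega> \<T> (\<lambda>K F x. \<psi> x * \<mu> x)"
        if "\<And>F. F \<in> mesh_faces \<T> \<Longrightarrow> F \<subseteq> frontier \<Omega> \<Longrightarrow> \<psi> \<in> borel_measurable (face_measure F)" for \<psi>
        unfolding boundary_int_def using int[OF mesh_facesI that[OF mesh_facesI]]
        by (intro sum.cong refl) auto
      then show ?thesis using uh g by (simp add: boundary_residual_def borel_measurable_integrable)
    qed
    moreover have "transmission_residual u q uh j \<nu> = 0"
    proof -
      have "(\<integral>x. (flux k \<tau> u q uh K F j x \<bullet> outward_normal K F) * \<nu> x \<partial>face_measure F) = 0"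
        if "K \<in> \<T>" "F facet_of K" "\<not> F \<subseteq> frontier \<Omega>" for K F
        using int[OF mesh_facesI[OF that(1,2)]] that(3) by simp
      then have "skeleton_int \<T> (\<lambda>K F x. (flux k \<tau> u q uh K F j x \<bullet> outward_normal K F) * \<nu> x)
        = boundary_int \<Omega> \<T> (\<lambda>K F x. (flux k \<tau> u q uh K F j x \<bullet> outward_normal K F) * \<nu> x)"
        unfolding skeleton_int_def boundary_int_alt by (intro sum.cong refl) auto
      then show ?thesis by (simp add: transmission_residual_def)
    qed
    ultimately show ?thesis using mu[OF \<nu>] by simp
  qed
  moreover have "transmission_residual u q uh j \<mu> = 0" if "\<mu> \<in> M_space \<T> k" for \<mu>
    using mu[OF that] b[OF that] by simp
  moreover have "flux_residual u q uh j r = 0" if "r \<in> V_space \<Omega> \<T> k" for r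
    using res[OF zero_spaces(1) that zero_spaces(3)] by (simp add: residuals_zero)
  moreover have "balance_residual \<alpha> \<delta> f u q uh j w = 0" if "w \<in> W_space \<Omega> \<T> k" for w
    using res[OF that zero_spaces(2,3)] by (simp add: residuals_zero)
  ultimately show ?residuals by blast
qed

lemma step_rhs_cong:
  assumes eq: "\<And>i \<kappa>. i < j \<Longrightarrow> \<kappa> \<in> dofs \<Longrightarrow> P i \<kappa> = P' i \<kappa>" and j: "1 \<le> j"
  shows "step_rhs \<alpha> \<delta> f g j P = step_rhs \<alpha> \<delta> f g j P'"
proof
  fix Y
  have c: "P i (Cell K) = P' i (Cell K)" if "i < j" "K \<in> \<T>" for i K using eq dofsI that by blast
  have q: "P i (Flux K l) = P' i (Flux K l)" if "i < j" "K \<in> \<T>" for i K l using eq dofsI that by blast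
  have m: "P i (Face F) = P' i (Face F)" if "i < j" "K \<in> \<T>" "F facet_of K" for i K F
    using eq dofsI mesh_facesI that by blast
  have h: "history \<alpha> \<delta> j P K x = history \<alpha> \<delta> j P' K x" if "K \<in> \<T>" for K x
    unfolding history_def using c[OF _ that] j by (simp add: less_imp_diff_less)
  have cf: "cell_form 0 (P (j - 1)) Y K = cell_form 0 (P' (j - 1)) Y K" if "K \<in> \<T>" for K
    using c[OF _ that, of "j - 1"] q[OF _ that, of "j - 1"] j by (simp add: fun_eq_iff cell_form_def)
  have t: "trace_form (P (j - 1)) Y K F = trace_form (P' (j - 1)) Y K F" if "K \<in> \<T>" "F facet_of K" for K F
    using c[OF _ that(1), of "j - 1"] q[OF _ that(1), of "j - 1"] m[OF _ that, of "j - 1"] j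
    by (simp add: fun_eq_iff trace_form_def numerical_flux_def normal_flux_def)
  have "load (\<lambda>K x. half (\<lambda>i y. f y (real i * \<delta>)) j x - history \<alpha> \<delta> j P K x) g Y
    = load (\<lambda>K x. half (\<lambda>i y. f y (real i * \<delta>)) j x - history \<alpha> \<delta> j P' K x) g Y"
    unfolding load_def by (simp add: h)
  moreover have "previous_flux (P (j - 1)) Y = previous_flux (P' (j - 1)) Y"
    unfolding previous_flux_def by (simp add: cf t del: One_nat_def)
  ultimately show "step_rhs \<alpha> \<delta> f g j P Y = step_rhs \<alpha> \<delta> f g j P' Y"
    by (simp add: step_rhs_def)
qed

lemma data_of_cong:
  assumes "(u, q, \<mu>) \<in> spaces" "cells_eq \<Omega> u' u" "cells_eq \<Omega> q' q" "faces_eq \<T> \<mu>' \<mu>" "\<kappa> \<in> dofs"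
  shows "data_of (u', q', \<mu>') \<kappa> = data_of (u, q, \<mu>) \<kappa>"
  using assms piece_cong[of _ u k u'] vpiece_cong[of _ q k q'] face_piece_cong[of _ \<mu>' \<mu> k]
  by (auto simp: dofs_def spaces_def)

lemma data_of_inj:
  assumes y: "(u', q', \<mu>') \<in> spaces" "(u, q, \<mu>) \<in> spaces"
    and null: "null_data (lincomb (-1) (data_of (u', q', \<mu>')) (data_of (u, q, \<mu>)))"
  shows "cells_eq \<Omega> u' u \<and> cells_eq \<Omega> q' q \<and> faces_eq \<T> \<mu>' \<mu>"
proof -
  have W: "u' \<in> W_space \<Omega> \<T> k" "u \<in> W_space \<Omega> \<T> k" and V: "q' \<in> V_space \<Omega> \<T> k" "q \<in> V_space \<Omega> \<T> k"
    and M: "\<mu>' \<in> M_space \<T> k" "\<mu> \<in> M_space \<T> k" using y by (auto simp: spaces_def)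
  have p: "piece k K u' x = piece k K u x" "vpiece k K q' x = vpiece k K q x" if "K \<in> \<T>" for K x
    using null that by (auto simp: null_data_def lincomb_apply vec_eq_iff)
  have "cells_eq \<Omega> u' u" unfolding cells_eq_def
  proof (rule AE_domain_cells)
    fix K assume K: "K \<in> \<T>"
    from piece_W(2)[OF W(1) K] piece_W(2)[OF W(2) K] show "AE x in lebesgue_on K. u' x = u x"
      by eventually_elim (simp add: p[OF K])
  qed
  moreover have "cells_eq \<Omega> q' q" unfolding cells_eq_def
  proof (rule AE_domain_cells)
    fix K assume K: "K \<in> \<T>"
    from vpiece_V(2)[OF V(1) K] vpiece_V(2)[OF V(2) K] show "AE x in lebesgue_on K. q' x = q x"
      by eventually_elim (simp add: p[OF K])
  qed
  moreover have "faces_eq \<T> \<mu>' \<mu>" unfolding faces_eq_def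
  proof
    fix F assume F: "F \<in> mesh_faces \<T>"
    have "AE x in face_measure F. lincomb (-1) (data_of (u', q', \<mu>')) (data_of (u, q, \<mu>)) (Face F) x = 0"
      using null F by (simp add: null_data_def)
    with face_piece_M(2)[OF M(1) F] face_piece_M(2)[OF M(2) F] show "AE x in face_measure F. \<mu>' x = \<mu> x"
      by eventually_elim (simp add: lincomb_apply)
  qed
  ultimately show ?thesis by blast
qed

end

theorem mainTheorem3:
  fixes \<Omega> :: "(real^'n) set" and \<T> :: "(real^'n) set set"
    and \<tau> :: "(real^'n) set \<Rightarrow> (real^'n) set \<Rightarrow> real"
    and f :: "real^'n \<Rightarrow> real \<Rightarrow> real" and g u0 :: "real^'n \<Rightarrow> real"
    and q0 :: "real^'n \<Rightarrow> real^'n"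
    and PV qh0 :: "real^'n \<Rightarrow> real^'n" and PW uhat0 :: "real^'n \<Rightarrow> real"
    and T \<alpha> \<delta> :: real and k N :: nat
  assumes dim: "CARD('n) \<in> {1, 2, 3}"
    and domain: "convex_polyhedral_domain \<Omega>"
    and mesh: "conforming_mesh \<Omega> \<T>"
    and tau: "\<And>K F. K \<in> \<T> \<Longrightarrow> F facet_of K \<Longrightarrow> 0 \<le> \<tau> K F"
    and T: "0 < T" and alpha: "0 < \<alpha>" "\<alpha> < 1"
    and N: "1 \<le> N" and delta: "\<delta> = T / real N"
    and f: "\<And>t. t \<in> {0..T} \<Longrightarrow> L2_fun (lebesgue_on \<Omega>) (\<lambda>x. f x t)"
    and g: "\<And>F. F \<in> mesh_faces \<T> \<Longrightarrow> F \<subseteq> frontier \<Omega> \<Longrightarrow> L2_fun (face_measure F) g"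
    and u0: "continuous_on (closure \<Omega>) u0"
    and q0: "continuous_on (closure \<Omega>) q0" "\<And>x. x \<in> \<Omega> \<Longrightarrow> GDERIV u0 x :> - q0 x"
    and proj: "hdg_projection \<Omega> \<T> k \<tau> q0 u0 PV PW"
    and qh0: "qh0 \<in> V_space \<Omega> \<T> k" and uhat0: "uhat0 \<in> M_space \<T> k"
  shows "\<exists>u q uh.
      u 0 = PW \<and> q 0 = qh0 \<and> uh 0 = uhat0 \<and> cn_hdg_solution \<Omega> \<T> k \<tau> \<alpha> \<delta> N f g u q uh \<and>
      (\<forall>u' q' uh'.
         u' 0 = PW \<and> q' 0 = qh0 \<and> uh' 0 = uhat0 \<and> cn_hdg_solution \<Omega> \<T> k \<tau> \<alpha> \<delta> N f g u' q' uh' \<longrightarrow>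
         (\<forall>j\<in>{1..N}. cells_eq \<Omega> (u' j) (u j) \<and> cells_eq \<Omega> (q' j) (q j) \<and> faces_eq \<T> (uh' j) (uh j)))"
proof -
  interpret hdg_scheme \<Omega> \<T> \<tau> k by unfold_locales (use domain mesh tau in auto)
  have \<delta>: "0 < \<delta>" using T N delta by simp
  define \<beta> where "\<beta> j = memory_weight \<alpha> \<delta> j j" for j
  have \<beta>: "0 < \<beta> j" if "1 \<le> j" for j unfolding \<beta>_def by (rule memory_weight_pos[OF alpha(1) \<delta> that])
  have fint: "integrable (lebesgue_on \<Omega>) (half (\<lambda>i y. f y (real i * \<delta>)) j)" if j: "j \<in> {1..N}" for j
  proof -
    have fin: "finite_measure (lebesgue_on \<Omega>)"
      using bounded_domain open_domain
      by (intro finite_measure_lebesgue_on bounded_set_imp_lmeasurable) auto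
    have "integrable (lebesgue_on \<Omega>) (\<lambda>x. f x (real i * \<delta>))" if "i \<le> N" for i
    proof (rule L2_fun_integrable[OF fin f])
      have "real i * T \<le> real N * T" using that T by simp
      then show "real i * \<delta> \<in> {0..T}" using T N by (simp add: delta field_simps)
    qed
    then have "integrable (lebesgue_on \<Omega>) (\<lambda>x. (1/2) *\<^sub>R (f x (real j * \<delta>) + f x (real (j - 1) * \<delta>)))"
      using j by (intro integrable_scaleR_right Bochner_Integration.integrable_add) (auto simp del: of_nat_diff)
    then show ?thesis unfolding half_def[abs_def] .
  qed
  have gint: "integrable (face_measure F) g" if "F \<in> mesh_faces \<T>" "F \<subseteq> frontier \<Omega>" for F
    by (rule L2_fun_integrable[OF finite_measure_face[OF that(1)] g[OF that]])
  have init: "(PW, qh0, uhat0) \<in> spaces" using proj qh0 uhat0 by (simp add: spaces_def hdg_projection_def)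
  \<comment> \<open>The memory term reaches back to the initial value, so each step depends on all earlier ones.
    Beyond step \<open>N\<close> nothing is required, which makes the choice total.\<close>
  define step where "step y j z \<longleftrightarrow> (if j = 0 then z = (PW, qh0, uhat0) else j \<le> N \<longrightarrow> z \<in> spaces \<and>
    (\<forall>Y\<in>discrete. form (\<beta> j) (data_of z) Y = step_rhs \<alpha> \<delta> f g j (\<lambda>i. data_of (y i)) Y))" for y j z
  have "\<exists>y. \<forall>j. step y j (y j)"
  proof (rule dependent_wellorder_choice)
    fix z and y y' :: "nat \<Rightarrow> (real^'n \<Rightarrow> real) \<times> (real^'n \<Rightarrow> real^'n) \<times> (real^'n \<Rightarrow> real)" and j
    assume eq: "\<And>i. i < j \<Longrightarrow> y i = y' i"
    show "step y j z = step y' j z"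
    proof (cases "j = 0")
      case False
      then have "step_rhs \<alpha> \<delta> f g j (\<lambda>i. data_of (y i)) = step_rhs \<alpha> \<delta> f g j (\<lambda>i. data_of (y' i))"
        by (intro step_rhs_cong) (auto simp: eq)
      then show ?thesis by (simp add: step_def)
    qed (simp add: step_def)
  next
    fix j y assume prev: "\<And>i. i < j \<Longrightarrow> step y i (y i)"
    show "\<exists>z. step y j z"
    proof (cases "j = 0 \<or> N < j")
      case False
      then have j: "j \<in> {1..N}" "1 \<le> j" by auto
      have sp: "y i \<in> spaces" if "i < j" for i
        using prev[OF that] init that j by (auto simp: step_def split: if_splits)
      let ?b = "step_rhs \<alpha> \<delta> f g j (\<lambda>i. data_of (y i))"
      have rhs: "linear_on_discrete ?b" "\<And>Y. null_data Y \<Longrightarrow> ?b Y = 0"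
        by (intro linear_step_rhs data_of_discrete sp j(2) fint[OF j(1)] gint; assumption)+
      have "\<exists>X\<in>discrete. \<forall>Y\<in>discrete. form (\<beta> j) X Y = ?b Y"
        by (rule form_solvable[OF \<beta>[OF j(2)] rhs])
      then obtain X where X: "X \<in> discrete"
        "\<And>Y. Y \<in> discrete \<Longrightarrow> form (\<beta> j) X Y = ?b Y"
        by blast
      obtain z where z: "z \<in> spaces" "null_data (lincomb (-1) X (data_of z))" using glue[OF X(1)] by blast
      have "form (\<beta> j) (data_of z) Y = form (\<beta> j) X Y" if "Y \<in> discrete" for Y
      proof -
        have "linear_on_discrete (\<lambda>X. form (\<beta> j) X Y)" by (intro linear_on_discreteI form_lincomb(2) that)
        from linear_null_diff[OF this form_null(2) X(1) data_of_discrete[OF z(1)] z(2)]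
        show ?thesis by simp
      qed
      then have "step y j z" using X z j by (simp add: step_def)
      then show ?thesis ..
    qed (auto simp: step_def)
  qed
  then obtain y where y: "\<And>j. step y j (y j)" by blast
  define u q uh where "u i = fst (y i)" and "q i = fst (snd (y i))" and "uh i = snd (snd (y i))" for i
  have yi: "(u i, q i, uh i) = y i" for i by (simp add: u_def q_def uh_def)
  have y0: "y 0 = (PW, qh0, uhat0)" using y[of 0] by (simp add: step_def)
  have sp: "(u i, q i, uh i) \<in> spaces" if "i \<le> N" for i
    unfolding yi using y[of i] y0 init that by (cases "i = 0") (simp_all add: step_def)
  have eq: "form (\<beta> j) (data_of (u j, q j, uh j)) Y = step_rhs \<alpha> \<delta> f g j (\<lambda>i. data_of (u i, q i, uh i)) Y"
    if "j \<in> {1..N}" "Y \<in> discrete" for j Y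
    unfolding yi using y[of j] that by (simp add: step_def)
  have sol: "cn_hdg_solution \<Omega> \<T> k \<tau> \<alpha> \<delta> N f g u q uh"
    unfolding cn_hdg_solution_residuals
  proof (intro ballI conjI)
    fix j assume j: "j \<in> {1..N}"
    then have j1: "1 \<le> j" and jN: "j \<le> N" by auto
    show "(u j, q j, uh j) \<in> spaces" using sp jN .
    have sp': "(u i, q i, uh i) \<in> spaces" if "i \<le> j" for i using sp that jN by simp
    have R: "(\<forall>r\<in>V_space \<Omega> \<T> k. flux_residual u q uh j r = 0) \<and>
     (\<forall>w\<in>W_space \<Omega> \<T> k. balance_residual \<alpha> \<delta> f u q uh j w = 0) \<and>
     (\<forall>\<mu>\<in>M_space \<T> k. boundary_residual g uh j \<mu> = 0) \<and>
     (\<forall>\<mu>\<in>M_space \<T> k. transmission_residual u q uh j \<mu> = 0)"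
      by (rule scheme_step_iff[OF alpha(1) \<delta> j1, THEN iffD2])
        (use sp' fint[OF j] gint eq[OF j] in \<open>simp_all add: \<beta>_def\<close>)
    show "flux_residual u q uh j r = 0" if "r \<in> V_space \<Omega> \<T> k" for r using R that by blast
    show "balance_residual \<alpha> \<delta> f u q uh j w = 0" if "w \<in> W_space \<Omega> \<T> k" for w using R that by blast
    show "boundary_residual g uh j \<mu> = 0" if "\<mu> \<in> M_space \<T> k" for \<mu> using R that by blast
    show "transmission_residual u q uh j \<mu> = 0" if "\<mu> \<in> M_space \<T> k" for \<mu> using R that by blast
  qed
  have unique: "cells_eq \<Omega> (u' j) (u j) \<and> cells_eq \<Omega> (q' j) (q j) \<and> faces_eq \<T> (uh' j) (uh j)"
    if init': "u' 0 = PW" "q' 0 = qh0" "uh' 0 = uhat0"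
      and sol': "cn_hdg_solution \<Omega> \<T> k \<tau> \<alpha> \<delta> N f g u' q' uh'" and "j \<le> N" for u' q' uh' j
    using \<open>j \<le> N\<close>
  proof (induction j rule: less_induct)
    case (less j)
    show ?case
    proof (cases "j = 0")
      case True
      have "u 0 = PW" "q 0 = qh0" "uh 0 = uhat0" using y0 by (simp_all add: u_def q_def uh_def)
      then show ?thesis using True init' by (simp add: cells_eq_def faces_eq_def)
    next
      case False
      then have j: "j \<in> {1..N}" "1 \<le> j" using less.prems by auto
      have sp': "(u' i, q' i, uh' i) \<in> spaces" if "i \<le> j" for i
        using sol' init init' that less.prems unfolding cn_hdg_solution_residuals by (cases "i = 0") auto
      have spj: "(u i, q i, uh i) \<in> spaces" if "i \<le> j" for i using sp that less.prems by simp
      have R: "(\<forall>r\<in>V_space \<Omega> \<T> k. flux_residual u' q' uh' j r = 0) \<and>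
        (\<forall>w\<in>W_space \<Omega> \<T> k. balance_residual \<alpha> \<delta> f u' q' uh' j w = 0) \<and>
        (\<forall>\<mu>\<in>M_space \<T> k. boundary_residual g uh' j \<mu> = 0) \<and>
        (\<forall>\<mu>\<in>M_space \<T> k. transmission_residual u' q' uh' j \<mu> = 0)"
        using sol' j(1) unfolding cn_hdg_solution_residuals by blast
      have "\<forall>Y\<in>discrete. form (\<beta> j) (data_of (u' j, q' j, uh' j)) Y
        = step_rhs \<alpha> \<delta> f g j (\<lambda>i. data_of (u' i, q' i, uh' i)) Y" unfolding \<beta>_def
        by (rule scheme_step_iff[OF alpha(1) \<delta> j(2), THEN iffD1]) (use sp' fint[OF j(1)] gint R in simp_all)
      moreover have "step_rhs \<alpha> \<delta> f g j (\<lambda>i. data_of (u' i, q' i, uh' i)) = step_rhs \<alpha> \<delta> f g j (\<lambda>i. data_of (u i, q i, uh i))"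
      proof (rule step_rhs_cong[OF _ j(2)])
        fix i \<kappa> assume i: "i < j" and \<kappa>: "\<kappa> \<in> dofs"
        have "cells_eq \<Omega> (u' i) (u i) \<and> cells_eq \<Omega> (q' i) (q i) \<and> faces_eq \<T> (uh' i) (uh i)"
          using less.IH[OF i] i less.prems by simp
        then show "data_of (u' i, q' i, uh' i) \<kappa> = data_of (u i, q i, uh i) \<kappa>"
          using data_of_cong[OF spj _ _ _ \<kappa>, of i] i by simp
      qed
      ultimately have "form (\<beta> j) (lincomb (-1) (data_of (u' j, q' j, uh' j)) (data_of (u j, q j, uh j))) Y = 0"
        if "Y \<in> discrete" for Y
        using form_lincomb(2)[OF that data_of_discrete data_of_discrete, OF sp' spj] eq[OF j(1) that] that by simp
      then have "null_data (lincomb (-1) (data_of (u' j, q' j, uh' j)) (data_of (u j, q j, uh j)))"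
        by (intro form_kernel[OF \<beta>[OF j(2)]] lincomb_discrete data_of_discrete sp' spj) simp_all
      then show ?thesis by (intro data_of_inj sp' spj) simp_all
    qed
  qed
  show ?thesis
  proof (intro exI conjI allI impI ballI)
    show "u 0 = PW" "q 0 = qh0" "uh 0 = uhat0" using y0 by (simp_all add: u_def q_def uh_def)
    show "cn_hdg_solution \<Omega> \<T> k \<tau> \<alpha> \<delta> N f g u q uh" by (rule sol)
    fix u' q' uh' j
    assume "u' 0 = PW \<and> q' 0 = qh0 \<and> uh' 0 = uhat0 \<and> cn_hdg_solution \<Omega> \<T> k \<tau> \<alpha> \<delta> N f g u' q' uh'" "j \<in> {1..N}"
    then have *: "cells_eq \<Omega> (u' j) (u j) \<and> cells_eq \<Omega> (q' j) (q j) \<and> faces_eq \<T> (uh' j) (uh j)"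
      by (intro unique) auto
    then show "cells_eq \<Omega> (u' j) (u j)" "cells_eq \<Omega> (q' j) (q j)" "faces_eq \<T> (uh' j) (uh j)" by auto
  qed
qed

end
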